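(* The odd symplectic group $\mathrm{Sp}_{2n+1}$ acts on the odd symplectic flag manifold $\mathbb{F}_\omega(2n+1)$ with $n+1$ orbits $$\mathcal{O}_i=\{(V_1\subset\cdots\subset V_{n+1})\in\mathbb{F}_\omega(2n+1)\mid e_0\in V_i,\ e_0\notin V_{i-1}\},\qquad 1\le i\le n+1.$$ Moreover, for all $1\le i\le n+1$, the orbit $\mathcal{O}_i$ is isomorphic to the total space of the dual $T_{i-1}^*$ of the rank $i-1$ tautological bundle on the symplectic flag manifold $\mathbb{F}_\omega(2n)$.
   Context: $E$ is a complex vector space of dimension $2n+1$ with a skew-form $\omega\in\Lambda^2E^*$ of maximal rank $2n$, and $e_0$ is a generator of the one-dimensional kernel of $\omega$. The odd symplectic group $\mathrm{Sp}_{2n+1}$ is the stabilizer of $\omega$ in $\mathrm{GL}(E)$. A subspace is isotropic if $\omega$ vanishes on it. $\mathbb{F}_\omega(2n+1)$ is the variety of flags $(V_1\subset\cdots\subset V_{n+1})$ of isotropic subspaces of $E$ with $\dim V_i=i$; by convention $V_0=0$. $\mathbb{F}_\omega(2n)$ is the variety of flags $(W_1\subset\cdots\subset W_n)$ of isotropic subspaces, $\dim W_i=i$, of a $2n$-dimensional complex symplectic vector space; its tautological bundle $T_j$ has fiber $W_j$ at $(W_1\subset\cdots\subset W_n)$, with $T_0=0$. *)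

theory Defs
  imports "HOL-Analysis.Abstract_Topology" "HOL-Algebra.Group_Action"
begin

section \<open>Complex varieties as spaces with functions\<close>

text \<open>A variety over the complex numbers is represented by its set of closed points (the
  \<open>topspace\<close>) with the Zariski topology and, for every open set, the complex-valued regular
  functions on it.  Membership in \<open>regular X U\<close> depends only on the values on \<open>U\<close>.\<close>

record 'x variety =
  zariski :: "'x topology"
  regular :: "'x set \<Rightarrow> ('x \<Rightarrow> complex) set"

definition variety_isomorphism :: "'x variety \<Rightarrow> 'y variety \<Rightarrow> ('x \<Rightarrow> 'y) \<Rightarrow> bool" where
  "variety_isomorphism X Y h \<longleftrightarrow>
     homeomorphic_map (zariski X) (zariski Y) h \<and>
     (\<forall>U f. openin (zariski Y) U \<longrightarrow>
        (f \<in> regular Y U \<longleftrightarrow> f \<circ> h \<in> regular X {x \<in> topspace (zariski X). h x \<in> U}))"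

definition isomorphic_varieties :: "'x variety \<Rightarrow> 'y variety \<Rightarrow> bool" where
  "isomorphic_varieties X Y \<longleftrightarrow> (\<exists>h. variety_isomorphism X Y h)"

inductive_set polynomial_functions :: "('x \<Rightarrow> complex) set \<Rightarrow> ('x \<Rightarrow> complex) set"
  for C :: "('x \<Rightarrow> complex) set" where
  const: "(\<lambda>_. c) \<in> polynomial_functions C"
| coord: "f \<in> C \<Longrightarrow> f \<in> polynomial_functions C"
| add: "f \<in> polynomial_functions C \<Longrightarrow> g \<in> polynomial_functions C \<Longrightarrow>
    (\<lambda>x. f x + g x) \<in> polynomial_functions C"
| mult: "f \<in> polynomial_functions C \<Longrightarrow> g \<in> polynomial_functions C \<Longrightarrow>
    (\<lambda>x. f x * g x) \<in> polynomial_functions C"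

text \<open>The quasi-affine variety \<open>A\<close>, embedded into an affine space by the coordinate
  functions \<open>C\<close> (meant to be jointly injective on \<open>A\<close>, with locally closed image).\<close>

definition quasi_affine_variety :: "'x set \<Rightarrow> ('x \<Rightarrow> complex) set \<Rightarrow> 'x variety" where
  "quasi_affine_variety A C =
     (let T = topology_generated_by {{x \<in> A. p x \<noteq> 0} | p. p \<in> polynomial_functions C}
      in \<lparr>zariski = T,
          regular = (\<lambda>U. {f. \<forall>x\<in>U. \<exists>V. openin T V \<and> x \<in> V \<and> V \<subseteq> U \<and>
            (\<exists>p\<in>polynomial_functions C. \<exists>q\<in>polynomial_functions C.
               \<forall>y\<in>V. q y \<noteq> 0 \<and> f y = p y / q y)})\<rparr>)"

definition subvariety :: "'x variety \<Rightarrow> 'x set \<Rightarrow> 'x variety" where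
  "subvariety X S =
     \<lparr>zariski = subtopology (zariski X) S,
      regular = (\<lambda>U. {f. \<forall>x\<in>U. \<exists>V. openin (zariski X) V \<and> x \<in> V \<and>
        (\<exists>g\<in>regular X V. \<forall>y\<in>U \<inter> V. f y = g y)})\<rparr>"

text \<open>The quotient variety structure on \<open>Y\<close> along a surjection \<open>\<pi>\<close> from \<open>X\<close> onto \<open>Y\<close>.\<close>

definition quotient_variety :: "'x variety \<Rightarrow> ('x \<Rightarrow> 'y) \<Rightarrow> 'y set \<Rightarrow> 'y variety" where
  "quotient_variety X \<pi> Y =
     \<lparr>zariski = topology (\<lambda>U. U \<subseteq> Y \<and> openin (zariski X) {x \<in> topspace (zariski X). \<pi> x \<in> U}),
      regular = (\<lambda>U. {f. f \<circ> \<pi> \<in> regular X {x \<in> topspace (zariski X). \<pi> x \<in> U}})\<rparr>"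

lemma openin_quotient_variety:
  "openin (zariski (quotient_variety X \<pi> Y)) U \<longleftrightarrow>
     U \<subseteq> Y \<and> openin (zariski X) {x \<in> topspace (zariski X). \<pi> x \<in> U}"
proof -
  let ?L = "\<lambda>U. U \<subseteq> Y \<and> openin (zariski X) {x \<in> topspace (zariski X). \<pi> x \<in> U}"
  have "istopology ?L"
    unfolding istopology_def
  proof (intro conjI allI impI)
    fix S T assume S: "?L S" and T: "?L T"
    show "S \<inter> T \<subseteq> Y" using S by blast
    have "{x \<in> topspace (zariski X). \<pi> x \<in> S \<inter> T} =
        {x \<in> topspace (zariski X). \<pi> x \<in> S} \<inter> {x \<in> topspace (zariski X). \<pi> x \<in> T}" by blast
    with S T show "openin (zariski X) {x \<in> topspace (zariski X). \<pi> x \<in> S \<inter> T}"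
      by (metis (no_types, lifting) openin_Int)
  next
    fix K assume K: "\<forall>S\<in>K. ?L S"
    show "\<Union>K \<subseteq> Y" using K by blast
    have "{x \<in> topspace (zariski X). \<pi> x \<in> \<Union>K} =
        (\<Union>S\<in>K. {x \<in> topspace (zariski X). \<pi> x \<in> S})" by blast
    moreover have "openin (zariski X) (\<Union>S\<in>K. {x \<in> topspace (zariski X). \<pi> x \<in> S})"
      using K by (intro openin_Union) auto
    ultimately show "openin (zariski X) {x \<in> topspace (zariski X). \<pi> x \<in> \<Union>K}" by metis
  qed
  then show ?thesis
    unfolding quotient_variety_def by (simp add: topology_inverse')
qed

section \<open>Skew-forms and isotropic flags\<close>

definition complex_space :: "(complex \<Rightarrow> 'a::ab_group_add \<Rightarrow> 'a) \<Rightarrow> nat \<Rightarrow> bool" where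
  "complex_space s d \<longleftrightarrow>
     (\<exists>B. finite_dimensional_vector_space s B) \<and> vector_space.dim s UNIV = d"

definition skew_form ::
    "(complex \<Rightarrow> 'a::ab_group_add \<Rightarrow> 'a) \<Rightarrow> ('a \<Rightarrow> 'a \<Rightarrow> complex) \<Rightarrow> bool" where
  "skew_form s \<omega> \<longleftrightarrow>
     (\<forall>x. Vector_Spaces.linear s (*) (\<omega> x)) \<and> (\<forall>x y. \<omega> x y = - \<omega> y x)"

definition form_kernel :: "('a \<Rightarrow> 'a \<Rightarrow> complex) \<Rightarrow> 'a set" where
  "form_kernel \<omega> = {x. \<forall>y. \<omega> x y = 0}"

definition form_rank ::
    "(complex \<Rightarrow> 'a::ab_group_add \<Rightarrow> 'a) \<Rightarrow> ('a \<Rightarrow> 'a \<Rightarrow> complex) \<Rightarrow> nat" where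
  "form_rank s \<omega> = vector_space.dim s UNIV - vector_space.dim s (form_kernel \<omega>)"

definition symplectic_space ::
    "nat \<Rightarrow> (complex \<Rightarrow> 'a::ab_group_add \<Rightarrow> 'a) \<Rightarrow> ('a \<Rightarrow> 'a \<Rightarrow> complex) \<Rightarrow> bool" where
  "symplectic_space n s \<omega> \<longleftrightarrow>
     complex_space s (2 * n) \<and> skew_form s \<omega> \<and> form_kernel \<omega> = {0}"

definition odd_symplectic_space ::
    "nat \<Rightarrow> (complex \<Rightarrow> 'a::ab_group_add \<Rightarrow> 'a) \<Rightarrow> ('a \<Rightarrow> 'a \<Rightarrow> complex) \<Rightarrow> 'a \<Rightarrow> bool" where
  "odd_symplectic_space n s \<omega> e0 \<longleftrightarrow>
     complex_space s (2 * n + 1) \<and> skew_form s \<omega> \<and> form_rank s \<omega> = 2 * n \<and>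
     form_kernel \<omega> = module.span s {e0}"

definition isotropic :: "('a \<Rightarrow> 'a \<Rightarrow> complex) \<Rightarrow> 'a set \<Rightarrow> bool" where
  "isotropic \<omega> V \<longleftrightarrow> (\<forall>x\<in>V. \<forall>y\<in>V. \<omega> x y = 0)"

text \<open>Flags carry their zeroth member explicitly.\<close>

definition isotropic_flags ::
    "(complex \<Rightarrow> 'a::ab_group_add \<Rightarrow> 'a) \<Rightarrow> ('a \<Rightarrow> 'a \<Rightarrow> complex) \<Rightarrow> nat \<Rightarrow> (nat \<Rightarrow> 'a set) set" where
  "isotropic_flags s \<omega> k =
     {V \<in> extensional {0..k}. V 0 = {0} \<and>
        (\<forall>j\<in>{1..k}. module.subspace s (V j) \<and> vector_space.dim s (V j) = j \<and> isotropic \<omega> (V j)) \<and>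
        (\<forall>j<k. V j \<subseteq> V (Suc j))}"

definition isotropic_frames ::
    "(complex \<Rightarrow> 'a::ab_group_add \<Rightarrow> 'a) \<Rightarrow> ('a \<Rightarrow> 'a \<Rightarrow> complex) \<Rightarrow> nat \<Rightarrow> (nat \<Rightarrow> 'a) set" where
  "isotropic_frames s \<omega> k =
     {v \<in> extensional {1..k}. inj_on v {1..k} \<and> \<not> module.dependent s (v ` {1..k}) \<and>
        isotropic \<omega> (module.span s (v ` {1..k}))}"

definition flag_of_frame ::
    "(complex \<Rightarrow> 'a::ab_group_add \<Rightarrow> 'a) \<Rightarrow> nat \<Rightarrow> (nat \<Rightarrow> 'a) \<Rightarrow> (nat \<Rightarrow> 'a set)" where
  "flag_of_frame s k v = (\<lambda>j\<in>{0..k}. module.span s (v ` {1..j}))"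

definition frame_coordinates ::
    "(complex \<Rightarrow> 'a::ab_group_add \<Rightarrow> 'a) \<Rightarrow> nat \<Rightarrow> ((nat \<Rightarrow> 'a) \<Rightarrow> complex) set" where
  "frame_coordinates s k =
     {(\<lambda>v. l (v m)) | l m. Vector_Spaces.linear s (*) l \<and> m \<in> {1..k}}"

text \<open>The flag variety is the quotient of the variety of frames (quasi-affine, inside the
  \<open>k\<close>-fold power of the vector space) by the Borel group of invertible upper triangular matrices:
  two frames lie in the same orbit of this group iff they span the same flag.  The quotient map
  has local sections for the Zariski topology, so this is the usual structure of a
  projective variety on the set of flags.\<close>

definition isotropic_flag_variety ::
    "(complex \<Rightarrow> 'a::ab_group_add \<Rightarrow> 'a) \<Rightarrow> ('a \<Rightarrow> 'a \<Rightarrow> complex) \<Rightarrow> nat \<Rightarrow> (nat \<Rightarrow> 'a set) variety" where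
  "isotropic_flag_variety s \<omega> k =
     quotient_variety
       (quasi_affine_variety (isotropic_frames s \<omega> k) (frame_coordinates s k))
       (flag_of_frame s k)
       (isotropic_flags s \<omega> k)"

definition dual_of_subspace ::
    "(complex \<Rightarrow> 'a::ab_group_add \<Rightarrow> 'a) \<Rightarrow> 'a set \<Rightarrow> ('a \<Rightarrow> complex) set" where
  "dual_of_subspace s W =
     {\<phi> \<in> extensional W. (\<forall>x\<in>W. \<forall>y\<in>W. \<phi> (x + y) = \<phi> x + \<phi> y) \<and> (\<forall>c. \<forall>x\<in>W. \<phi> (s c x) = c * \<phi> x)}"

text \<open>The total space of the dual of the \<open>j\<close>-th tautological bundle.  Its pullback to the variety
  of frames is trivialised by the tautological frame: a pair \<open>(v, \<phi>)\<close> with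
  \<open>\<phi>\<close> a linear form on the span of \<open>v 1, \<dots>, v j\<close> is determined by \<open>v\<close> and the \<open>j\<close>
  numbers \<open>\<phi> (v m)\<close>, which may be arbitrary, so these pairs form the product of the variety of
  frames with affine \<open>j\<close>-space.  The total space is its quotient by the Borel group, i.e. the
  associated bundle.\<close>

definition dual_tautological_points ::
    "(complex \<Rightarrow> 'a::ab_group_add \<Rightarrow> 'a) \<Rightarrow> ('a \<Rightarrow> 'a \<Rightarrow> complex) \<Rightarrow> nat \<Rightarrow> nat \<Rightarrow>
       ((nat \<Rightarrow> 'a set) \<times> ('a \<Rightarrow> complex)) set" where
  "dual_tautological_points s \<omega> k j =
     (SIGMA W : isotropic_flags s \<omega> k. dual_of_subspace s (W j))"

definition framed_dual_variety ::
    "(complex \<Rightarrow> 'a::ab_group_add \<Rightarrow> 'a) \<Rightarrow> ('a \<Rightarrow> 'a \<Rightarrow> complex) \<Rightarrow> nat \<Rightarrow> nat \<Rightarrow>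
       ((nat \<Rightarrow> 'a) \<times> ('a \<Rightarrow> complex)) variety" where
  "framed_dual_variety s \<omega> k j =
     quasi_affine_variety
       (SIGMA v : isotropic_frames s \<omega> k. dual_of_subspace s (module.span s (v ` {1..j})))
       ({(\<lambda>(v, \<phi>). c v) | c. c \<in> frame_coordinates s k} \<union>
        {(\<lambda>(v, \<phi>). \<phi> (v m)) | m. m \<in> {1..j}})"

definition dual_tautological_total_space ::
    "(complex \<Rightarrow> 'a::ab_group_add \<Rightarrow> 'a) \<Rightarrow> ('a \<Rightarrow> 'a \<Rightarrow> complex) \<Rightarrow> nat \<Rightarrow> nat \<Rightarrow>
       ((nat \<Rightarrow> 'a set) \<times> ('a \<Rightarrow> complex)) variety" where
  "dual_tautological_total_space s \<omega> k j =
     quotient_variety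
       (framed_dual_variety s \<omega> k j)
       (\<lambda>(v, \<phi>). (flag_of_frame s k v, \<phi>))
       (dual_tautological_points s \<omega> k j)"

section \<open>The odd symplectic group and its action\<close>

definition form_stabilizer ::
    "(complex \<Rightarrow> 'a::ab_group_add \<Rightarrow> 'a) \<Rightarrow> ('a \<Rightarrow> 'a \<Rightarrow> complex) \<Rightarrow> ('a \<Rightarrow> 'a) monoid" where
  "form_stabilizer s \<omega> =
     \<lparr>carrier = {g. Vector_Spaces.linear s s g \<and> bij g \<and> (\<forall>x y. \<omega> (g x) (g y) = \<omega> x y)},
      monoid.mult = (\<circ>), one = id\<rparr>"

text \<open>The restriction to the set of flags is what \<open>group_action\<close> expects of an action.\<close>

definition flag_action ::
    "(complex \<Rightarrow> 'a::ab_group_add \<Rightarrow> 'a) \<Rightarrow> ('a \<Rightarrow> 'a \<Rightarrow> complex) \<Rightarrow> nat \<Rightarrow>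
       ('a \<Rightarrow> 'a) \<Rightarrow> (nat \<Rightarrow> 'a set) \<Rightarrow> (nat \<Rightarrow> 'a set)" where
  "flag_action s \<omega> k g = (\<lambda>V\<in>isotropic_flags s \<omega> k. \<lambda>j\<in>{0..k}. g ` V j)"

definition odd_orbit ::
    "nat \<Rightarrow> (complex \<Rightarrow> 'a::ab_group_add \<Rightarrow> 'a) \<Rightarrow> ('a \<Rightarrow> 'a \<Rightarrow> complex) \<Rightarrow> 'a \<Rightarrow> nat \<Rightarrow>
       (nat \<Rightarrow> 'a set) set" where
  "odd_orbit n s \<omega> e0 i = {V \<in> isotropic_flags s \<omega> (n + 1). e0 \<in> V i \<and> e0 \<notin> V (i - 1)}"

end

theory Submission
  imports Defs
begin

text \<open>
  Modulo the line of \<open>e0\<close>, the odd symplectic space \<open>E\<close> becomes a symplectic space of dimension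
  \<open>2 n\<close>.  Darboux bases identify this quotient with \<open>F\<close>, so there are a surjection
  \<open>p : E \<rightarrow> F\<close> that preserves the forms and has kernel spanned by \<open>e0\<close>, a linear section \<open>\<iota>\<close> of \<open>p\<close>, and a
  coordinate \<open>\<kappa>\<close> along \<open>e0\<close> (\<open>odd_symplectic_projection_exists\<close>).

  An isotropic flag \<open>V\<close> of length \<open>n + 1\<close> must contain \<open>e0\<close> in its last step, since \<open>F\<close> has no
  isotropic subspace of dimension \<open>n + 1\<close>.  Hence \<open>e0\<close> enters the flag at exactly one step \<open>i\<close>, the type of
  \<open>V\<close>, which is invariant because isometries preserve the kernel line.  Conversely, a flag of type \<open>i\<close> has
  a frame with \<open>e0\<close> in position \<open>i\<close> whose other \<open>n\<close> vectors form half of a Darboux basis; an isometry that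
  matches two such bases matches the flags (\<open>odd_orbit_transitive\<close>).

  Let \<open>V\<close> be of type \<open>i\<close>.  Its images under \<open>p\<close>, with the repetition at step \<open>i\<close> omitted, form an
  isotropic flag \<open>W\<close> of \<open>F\<close>.  The step \<open>V (i - 1)\<close> misses \<open>e0\<close>, so it is the graph over \<open>W (i - 1)\<close> of a functional
  \<open>\<phi>\<close>.  The pair \<open>(W, \<phi>)\<close>, a point of the dual tautological bundle, determines \<open>V\<close>: below \<open>i\<close> the
  steps of \<open>V\<close> are the graphs of the restrictions of \<open>\<phi>\<close>, and from \<open>i\<close> on they are preimages under \<open>p\<close>.
  Any pair arises in this way.

  This bijection is an isomorphism of varieties.  It lifts in both directions to maps between
  frames (\<open>lift_frame\<close>, and \<open>project_frame\<close> with \<open>graph_functional\<close>) that are polynomial in the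
  coordinates.  To descend these lifts to the quotients one needs functions on the orbit, a subvariety of
  the flag variety, to extend locally to functions on the flag variety.  The extension is provided by local
  sections of the quotient map from frames to flags
  (\<open>flag_of_frame_local_section\<close>), which come from Gaussian elimination; the descent itself is the
  general statement \<open>isomorphic_varieties_by_lifts\<close>.
\<close>

section \<open>Regular functions on quasi-affine varieties\<close>

text \<open>The nonvanishing locus of a product is the intersection of the loci of its factors, so the
  sets that generate the Zariski topology form a basis of it.\<close>

lemma openin_quasi_affine_variety:
  "openin (zariski (quasi_affine_variety A C)) U \<longleftrightarrow>
     U \<subseteq> A \<and> (\<forall>x\<in>U. \<exists>p\<in>polynomial_functions C. p x \<noteq> 0 \<and> (\<forall>y\<in>A. p y \<noteq> 0 \<longrightarrow> y \<in> U))"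
proof -
  let ?S = "{{x \<in> A. p x \<noteq> 0} | p. p \<in> polynomial_functions C}"
  have "generate_topology_on ?S U \<longleftrightarrow>
     U \<subseteq> A \<and> (\<forall>x\<in>U. \<exists>p\<in>polynomial_functions C. p x \<noteq> 0 \<and> (\<forall>y\<in>A. p y \<noteq> 0 \<longrightarrow> y \<in> U))"
    (is "_ \<longleftrightarrow> ?R U")
  proof
    assume "generate_topology_on ?S U"
    then show "?R U"
    proof induction
      case (Int a b)
      show ?case
      proof (intro conjI ballI)
        show "a \<inter> b \<subseteq> A" using Int.IH by blast
        fix x assume "x \<in> a \<inter> b"
        then obtain p q where p: "p \<in> polynomial_functions C" "p x \<noteq> 0" "\<forall>y\<in>A. p y \<noteq> 0 \<longrightarrow> y \<in> a"
          and q: "q \<in> polynomial_functions C" "q x \<noteq> 0" "\<forall>y\<in>A. q y \<noteq> 0 \<longrightarrow> y \<in> b"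
          using Int.IH by blast
        show "\<exists>p\<in>polynomial_functions C. p x \<noteq> 0 \<and> (\<forall>y\<in>A. p y \<noteq> 0 \<longrightarrow> y \<in> a \<inter> b)"
          using p q by (intro bexI[of _ "\<lambda>y. p y * q y"]) (auto intro: polynomial_functions.mult)
      qed
    next
      case (UN K)
      show ?case
      proof (intro conjI ballI)
        show "\<Union>K \<subseteq> A" using UN.IH by blast
        fix x assume "x \<in> \<Union>K"
        then obtain k where k: "k \<in> K" "x \<in> k" by blast
        then show "\<exists>p\<in>polynomial_functions C. p x \<noteq> 0 \<and> (\<forall>y\<in>A. p y \<noteq> 0 \<longrightarrow> y \<in> \<Union>K)"
          using UN.IH[OF k(1)] by (meson UnionI)
      qed
    qed auto
  next
    assume R: "?R U"
    define K where "K = {V \<in> ?S. V \<subseteq> U}"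
    have "\<Union>K = U"
    proof
      show "\<Union>K \<subseteq> U" by (auto simp: K_def)
      show "U \<subseteq> \<Union>K"
      proof
        fix x assume x: "x \<in> U"
        then obtain p where p: "p \<in> polynomial_functions C" "p x \<noteq> 0" "\<forall>y\<in>A. p y \<noteq> 0 \<longrightarrow> y \<in> U"
          using R by blast
        have "{y \<in> A. p y \<noteq> 0} \<in> K" using p by (auto simp: K_def)
        moreover have "x \<in> {y \<in> A. p y \<noteq> 0}" using x p R by blast
        ultimately show "x \<in> \<Union>K" by blast
      qed
    qed
    moreover have "generate_topology_on ?S (\<Union>K)"
      by (rule generate_topology_on.UN) (auto simp: K_def intro: generate_topology_on.Basis)
    ultimately show "generate_topology_on ?S U" by simp
  qed
  then show ?thesis
    by (simp add: quasi_affine_variety_def Let_def openin_topology_generated_by_iff)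
qed

lemma topspace_quasi_affine_variety [simp]: "topspace (zariski (quasi_affine_variety A C)) = A"
proof -
  have "openin (zariski (quasi_affine_variety A C)) A"
    unfolding openin_quasi_affine_variety
    by (auto intro!: bexI[of _ "\<lambda>_. 1"] polynomial_functions.const)
  then show ?thesis
    by (metis openin_quasi_affine_variety openin_subset openin_topspace subset_antisym)
qed

text \<open>Expanding a fraction by a polynomial that vanishes outside the neighbourhood on which it
  is valid makes this neighbourhood the nonvanishing locus of the new denominator.  A local
  representation of a regular function is thus a single fraction that carries its own domain.\<close>

lemma regular_quasi_affine_variety_iff:
  assumes "U \<subseteq> A"
  shows "f \<in> regular (quasi_affine_variety A C) U \<longleftrightarrow>
    (\<forall>x\<in>U. \<exists>p\<in>polynomial_functions C. \<exists>r\<in>polynomial_functions C.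
       r x \<noteq> 0 \<and> (\<forall>y\<in>A. r y \<noteq> 0 \<longrightarrow> y \<in> U \<and> f y = p y / r y))"
    (is "_ \<longleftrightarrow> (\<forall>x\<in>U. ?R x)")
proof -
  let ?T = "zariski (quasi_affine_variety A C)"
  have "f \<in> regular (quasi_affine_variety A C) U \<longleftrightarrow>
    (\<forall>x\<in>U. \<exists>V. openin ?T V \<and> x \<in> V \<and> V \<subseteq> U \<and>
            (\<exists>p\<in>polynomial_functions C. \<exists>q\<in>polynomial_functions C.
               \<forall>y\<in>V. q y \<noteq> 0 \<and> f y = p y / q y))" (is "_ \<longleftrightarrow> (\<forall>x\<in>U. ?L x)")
    by (simp add: quasi_affine_variety_def Let_def)
  also have "\<dots> \<longleftrightarrow> (\<forall>x\<in>U. ?R x)"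
  proof (rule ball_cong[OF refl])
    fix x assume x: "x \<in> U"
    show "?L x \<longleftrightarrow> ?R x"
  proof
    assume "?L x"
    then obtain V p q where V: "openin ?T V" "x \<in> V" "V \<subseteq> U"
      and pq: "p \<in> polynomial_functions C" "q \<in> polynomial_functions C"
        "\<And>y. y \<in> V \<Longrightarrow> q y \<noteq> 0 \<and> f y = p y / q y" by blast
    then obtain r where r: "r \<in> polynomial_functions C" "r x \<noteq> 0" "\<And>y. y \<in> A \<Longrightarrow> r y \<noteq> 0 \<Longrightarrow> y \<in> V"
      unfolding openin_quasi_affine_variety by blast
    show "?R x"
    proof (rule bexI[of _ "\<lambda>y. p y * r y"], rule bexI[of _ "\<lambda>y. q y * r y"], intro conjI ballI impI)
      show "(\<lambda>y. p y * r y) \<in> polynomial_functions C" "(\<lambda>y. q y * r y) \<in> polynomial_functions C"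
        using pq r by (auto intro: polynomial_functions.mult)
      show "q x * r x \<noteq> 0" using V pq r by simp
      fix y assume "y \<in> A" "q y * r y \<noteq> 0"
      then show "y \<in> U" "f y = (p y * r y) / (q y * r y)" using V pq(3)[of y] r(3)[of y] by auto
    qed
  next
    assume "?R x"
    then obtain p r where pr: "p \<in> polynomial_functions C" "r \<in> polynomial_functions C" "r x \<noteq> 0"
       "\<And>y. y \<in> A \<Longrightarrow> r y \<noteq> 0 \<Longrightarrow> y \<in> U \<and> f y = p y / r y" by blast
    have "openin ?T {y\<in>A. r y \<noteq> 0}"
      unfolding openin_quasi_affine_variety using pr(2) by auto
    moreover have "x \<in> {y\<in>A. r y \<noteq> 0}" using x assms pr by blast
    moreover have "{y\<in>A. r y \<noteq> 0} \<subseteq> U" using pr(4) by blast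
    moreover have "\<forall>y\<in>{y\<in>A. r y \<noteq> 0}. r y \<noteq> 0 \<and> f y = p y / r y" using pr(4) by blast
    ultimately show "?L x" using pr(1,2) by blast
  qed
  qed
  finally show ?thesis .
qed

lemma regular_cong:
  assumes "U \<subseteq> A" "f \<in> regular (quasi_affine_variety A C) U" "\<And>x. x \<in> U \<Longrightarrow> f x = g x"
  shows "g \<in> regular (quasi_affine_variety A C) U"
  unfolding regular_quasi_affine_variety_iff[OF assms(1)]
proof
  fix x assume "x \<in> U"
  then obtain p r where "p \<in> polynomial_functions C" "r \<in> polynomial_functions C" "r x \<noteq> 0"
        "\<forall>y\<in>A. r y \<noteq> 0 \<longrightarrow> y \<in> U \<and> f y = p y / r y"
    using assms(2) unfolding regular_quasi_affine_variety_iff[OF assms(1)] by blast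
  then show "\<exists>p\<in>polynomial_functions C. \<exists>r\<in>polynomial_functions C.
       r x \<noteq> 0 \<and> (\<forall>y\<in>A. r y \<noteq> 0 \<longrightarrow> y \<in> U \<and> g y = p y / r y)"
    using assms(3)
    by - (rule bexI[of _ p], rule bexI[of _ r], auto)
qed

lemma regular_polynomial:
  assumes U: "openin (zariski (quasi_affine_variety A C)) U" and f: "f \<in> polynomial_functions C"
  shows "f \<in> regular (quasi_affine_variety A C) U"
proof -
  have UA: "U \<subseteq> A" using U by (simp add: openin_quasi_affine_variety)
  show ?thesis unfolding regular_quasi_affine_variety_iff[OF UA]
  proof
    fix x assume "x \<in> U"
    then obtain r where r: "r \<in> polynomial_functions C" "r x \<noteq> 0" "\<forall>y\<in>A. r y \<noteq> 0 \<longrightarrow> y \<in> U"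
      using U unfolding openin_quasi_affine_variety by blast
    show "\<exists>p\<in>polynomial_functions C. \<exists>r\<in>polynomial_functions C.
       r x \<noteq> 0 \<and> (\<forall>y\<in>A. r y \<noteq> 0 \<longrightarrow> y \<in> U \<and> f y = p y / r y)"
      using r f
      by - (rule bexI[of _ "\<lambda>y. f y * r y"], rule bexI[of _ r], auto intro: polynomial_functions.mult)
  qed
qed

lemma regular_subset:
  assumes V: "openin (zariski (quasi_affine_variety A C)) V" "V \<subseteq> U" and UA: "U \<subseteq> A"
    and f: "f \<in> regular (quasi_affine_variety A C) U"
  shows "f \<in> regular (quasi_affine_variety A C) V"
proof -
  have VA: "V \<subseteq> A" using V by (simp add: openin_quasi_affine_variety)
  show ?thesis unfolding regular_quasi_affine_variety_iff[OF VA]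
  proof
    fix x assume x: "x \<in> V"
    then obtain r where r: "r \<in> polynomial_functions C" "r x \<noteq> 0" "\<forall>y\<in>A. r y \<noteq> 0 \<longrightarrow> y \<in> V"
      using V unfolding openin_quasi_affine_variety by blast
    obtain p q where "p \<in> polynomial_functions C" "q \<in> polynomial_functions C" "q x \<noteq> 0"
        "\<forall>y\<in>A. q y \<noteq> 0 \<longrightarrow> y \<in> U \<and> f y = p y / q y"
      using f x V(2) unfolding regular_quasi_affine_variety_iff[OF UA] by blast
    then show "\<exists>p\<in>polynomial_functions C. \<exists>r\<in>polynomial_functions C.
       r x \<noteq> 0 \<and> (\<forall>y\<in>A. r y \<noteq> 0 \<longrightarrow> y \<in> V \<and> f y = p y / r y)"
      using r
      by - (rule bexI[of _ "\<lambda>y. p y * r y"], rule bexI[of _ "\<lambda>y. q y * r y"], auto intro: polynomial_functions.mult)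
  qed
qed

lemma
  assumes UA: "U \<subseteq> A" and f: "f \<in> regular (quasi_affine_variety A C) U"
    and g: "g \<in> regular (quasi_affine_variety A C) U"
  shows regular_add: "(\<lambda>x. f x + g x) \<in> regular (quasi_affine_variety A C) U"
    and regular_mult: "(\<lambda>x. f x * g x) \<in> regular (quasi_affine_variety A C) U"
proof -
  have "\<exists>p\<in>polynomial_functions C. \<exists>p'\<in>polynomial_functions C. \<exists>r\<in>polynomial_functions C.
       r x \<noteq> 0 \<and> (\<forall>y\<in>A. r y \<noteq> 0 \<longrightarrow> y \<in> U \<and> f y = p y / r y \<and> g y = p' y / r y)"
    if x: "x \<in> U" for x
  proof -
    obtain p q where pq: "p \<in> polynomial_functions C" "q \<in> polynomial_functions C" "q x \<noteq> 0"
        "\<forall>y\<in>A. q y \<noteq> 0 \<longrightarrow> y \<in> U \<and> f y = p y / q y"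
      using f x unfolding regular_quasi_affine_variety_iff[OF UA] by blast
    obtain p' q' where pq': "p' \<in> polynomial_functions C" "q' \<in> polynomial_functions C" "q' x \<noteq> 0"
        "\<forall>y\<in>A. q' y \<noteq> 0 \<longrightarrow> y \<in> U \<and> g y = p' y / q' y"
      using g x unfolding regular_quasi_affine_variety_iff[OF UA] by blast
    show ?thesis
      using pq pq'
      by - (rule bexI[of _ "\<lambda>y. p y * q' y"], rule bexI[of _ "\<lambda>y. p' y * q y"], rule bexI[of _ "\<lambda>y. q y * q' y"], auto intro: polynomial_functions.mult)
  qed
  note fractions = this
  show "(\<lambda>x. f x + g x) \<in> regular (quasi_affine_variety A C) U"
    unfolding regular_quasi_affine_variety_iff[OF UA]
  proof
    fix x assume "x \<in> U"
    from fractions[OF this] obtain p p' r where pr: "p \<in> polynomial_functions C"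
      "p' \<in> polynomial_functions C" "r \<in> polynomial_functions C"
      "r x \<noteq> 0" "\<forall>y\<in>A. r y \<noteq> 0 \<longrightarrow> y \<in> U \<and> f y = p y / r y \<and> g y = p' y / r y" by blast
    then show "\<exists>p\<in>polynomial_functions C. \<exists>r\<in>polynomial_functions C.
       r x \<noteq> 0 \<and> (\<forall>y\<in>A. r y \<noteq> 0 \<longrightarrow> y \<in> U \<and> f y + g y = p y / r y)"
      by - (rule bexI[of _ "\<lambda>y. p y + p' y"], rule bexI[of _ r],
        auto intro: polynomial_functions.add simp: add_divide_distrib)
  qed
  show "(\<lambda>x. f x * g x) \<in> regular (quasi_affine_variety A C) U"
    unfolding regular_quasi_affine_variety_iff[OF UA]
  proof
    fix x assume "x \<in> U"
    from fractions[OF this] obtain p p' r where pr: "p \<in> polynomial_functions C"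
      "p' \<in> polynomial_functions C" "r \<in> polynomial_functions C"
      "r x \<noteq> 0" "\<forall>y\<in>A. r y \<noteq> 0 \<longrightarrow> y \<in> U \<and> f y = p y / r y \<and> g y = p' y / r y" by blast
    then show "\<exists>p\<in>polynomial_functions C. \<exists>r\<in>polynomial_functions C.
       r x \<noteq> 0 \<and> (\<forall>y\<in>A. r y \<noteq> 0 \<longrightarrow> y \<in> U \<and> f y * g y = p y / r y)"
      by - (rule bexI[of _ "\<lambda>y. p y * p' y"], rule bexI[of _ "\<lambda>y. r y * r y"],
        auto intro: polynomial_functions.mult)
  qed
qed

lemma regular_inverse:
  assumes UA: "U \<subseteq> A" and f: "f \<in> regular (quasi_affine_variety A C) U"
    and nz: "\<And>x. x \<in> U \<Longrightarrow> f x \<noteq> 0"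
  shows "(\<lambda>x. inverse (f x)) \<in> regular (quasi_affine_variety A C) U"
  unfolding regular_quasi_affine_variety_iff[OF UA]
proof
  fix x assume x: "x \<in> U"
  then obtain p r where pr: "p \<in> polynomial_functions C" "r \<in> polynomial_functions C" "r x \<noteq> 0"
        "\<forall>y\<in>A. r y \<noteq> 0 \<longrightarrow> y \<in> U \<and> f y = p y / r y"
    using f unfolding regular_quasi_affine_variety_iff[OF UA] by blast
  \<comment> \<open>The reciprocal of \<open>p / r\<close> is written with denominator \<open>p r\<close>, whose nonvanishing locus
     lies inside that of \<open>r\<close>.\<close>
  moreover have "p x \<noteq> 0" using pr nz[OF x] UA x by auto
  ultimately show "\<exists>p\<in>polynomial_functions C. \<exists>r\<in>polynomial_functions C.
       r x \<noteq> 0 \<and> (\<forall>y\<in>A. r y \<noteq> 0 \<longrightarrow> y \<in> U \<and> inverse (f y) = p y / r y)"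
    by - (rule bexI[of _ "\<lambda>y. r y * r y"], rule bexI[of _ "\<lambda>y. p y * r y"],
      auto intro: polynomial_functions.mult)
qed

lemma openin_regular_nonzero:
  assumes UA: "U \<subseteq> A" and f: "f \<in> regular (quasi_affine_variety A C) U"
  shows "openin (zariski (quasi_affine_variety A C)) {x \<in> U. f x \<noteq> 0}"
  unfolding openin_quasi_affine_variety
proof (intro conjI ballI)
  show "{x \<in> U. f x \<noteq> 0} \<subseteq> A" using UA by blast
  fix x assume x: "x \<in> {x \<in> U. f x \<noteq> 0}"
  then obtain p r where pr: "p \<in> polynomial_functions C" "r \<in> polynomial_functions C" "r x \<noteq> 0"
        "\<forall>y\<in>A. r y \<noteq> 0 \<longrightarrow> y \<in> U \<and> f y = p y / r y"
    using f unfolding regular_quasi_affine_variety_iff[OF UA] by blast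
  moreover have "p x \<noteq> 0" using pr x UA by auto
  ultimately show "\<exists>p\<in>polynomial_functions C. p x \<noteq> 0 \<and> (\<forall>y\<in>A. p y \<noteq> 0 \<longrightarrow> y \<in> {x \<in> U. f x \<noteq> 0})"
    by (intro bexI[of _ "\<lambda>y. p y * r y"]) (auto intro: polynomial_functions.mult)
qed

lemma regular_polynomial_compose:
  assumes U: "openin (zariski (quasi_affine_variety A C)) U"
    and s: "\<And>c. c \<in> C' \<Longrightarrow> (\<lambda>x. c (s x)) \<in> regular (quasi_affine_variety A C) U"
    and P: "P \<in> polynomial_functions C'"
  shows "(\<lambda>x. P (s x)) \<in> regular (quasi_affine_variety A C) U"
proof -
  have UA: "U \<subseteq> A" using U by (simp add: openin_quasi_affine_variety)
  show ?thesis using P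
    by induction (auto intro: regular_polynomial[OF U] polynomial_functions.const s
      regular_add[OF UA] regular_mult[OF UA])
qed

lemma polynomial_functions_pullback:
  assumes "\<And>c. c \<in> C' \<Longrightarrow> \<exists>q\<in>polynomial_functions C. \<forall>x\<in>A. q x = c (\<Phi> x)"
    and P: "P \<in> polynomial_functions C'"
  shows "\<exists>q\<in>polynomial_functions C. \<forall>x\<in>A. q x = P (\<Phi> x)"
  using P
proof induction
  case (const c)
  show ?case by (intro bexI[of _ "\<lambda>_. c"]) (auto intro: polynomial_functions.const)
next
  case (coord f)
  then show ?case by (rule assms(1))
next
  case (add f g)
  then obtain q q' where "q \<in> polynomial_functions C" "\<forall>x\<in>A. q x = f (\<Phi> x)"
    "q' \<in> polynomial_functions C" "\<forall>x\<in>A. q' x = g (\<Phi> x)" by blast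
  then show ?case by (intro bexI[of _ "\<lambda>x. q x + q' x"]) (auto intro: polynomial_functions.add)
next
  case (mult f g)
  then obtain q q' where "q \<in> polynomial_functions C" "\<forall>x\<in>A. q x = f (\<Phi> x)"
    "q' \<in> polynomial_functions C" "\<forall>x\<in>A. q' x = g (\<Phi> x)" by blast
  then show ?case by (intro bexI[of _ "\<lambda>x. q x * q' x"]) (auto intro: polynomial_functions.mult)
qed

section \<open>Isomorphisms between quotients by lifting\<close>

lemma topspace_quotient_variety:
  assumes "\<pi> ` topspace (zariski X) \<subseteq> Y"
  shows "topspace (zariski (quotient_variety X \<pi> Y)) = Y"
proof -
  have "{x \<in> topspace (zariski X). \<pi> x \<in> Y} = topspace (zariski X)" using assms by blast
  then have "openin (zariski (quotient_variety X \<pi> Y)) Y"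
    by (simp add: openin_quotient_variety)
  then show ?thesis
    by (metis openin_quotient_variety openin_subset openin_topspace subset_antisym)
qed

text \<open>A section over the image of \<open>D\<close> is recorded by its composite \<open>s\<close> with \<open>\<pi>\<close>: then \<open>D\<close> is a
  saturated subset of \<open>A\<close>, the map \<open>s\<close> is constant on fibres, and regularity of the section can
  be stated on \<open>A\<close>, where the coordinates live.\<close>

definition local_section ::
    "'x set \<Rightarrow> ('x \<Rightarrow> complex) set \<Rightarrow> ('x \<Rightarrow> 'y) \<Rightarrow> 'x \<Rightarrow> 'x set \<Rightarrow> ('x \<Rightarrow> 'x) \<Rightarrow> bool" where
  "local_section A C \<pi> x0 D s \<longleftrightarrow>
     openin (zariski (quasi_affine_variety A C)) D \<and> x0 \<in> D \<and> s x0 = x0 \<and>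
     (\<forall>x\<in>D. s x \<in> A \<and> \<pi> (s x) = \<pi> x) \<and>
     (\<forall>x\<in>D. \<forall>x'\<in>A. \<pi> x' = \<pi> x \<longrightarrow> x' \<in> D \<and> s x' = s x) \<and>
     (\<forall>c\<in>C. (\<lambda>x. c (s x)) \<in> regular (quasi_affine_variety A C) D)"

text \<open>Functions on a quotient are tested after pulling them back, so \<open>\<Phi>\<close> alone makes the induced
  map into \<open>S\<close> a morphism.  The other direction is different: a function on \<open>S\<close> has to be
  extended, locally, to a function on the whole quotient, whereas pulling back along \<open>\<Psi>\<close> only
  provides a fraction on \<open>A\<close>, which need not be constant on fibres outside the preimage of
  \<open>S\<close>.  Evaluating this fraction on the values of a local section repairs this without changing
  its values over \<open>S\<close>.\<close>

theorem isomorphic_varieties_by_lifts: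
  fixes A :: "'x set" and A' :: "'y set" and \<pi> :: "'x \<Rightarrow> 'u" and \<pi>' :: "'y \<Rightarrow> 'v"
  assumes \<pi>: "\<pi> ` A \<subseteq> Q" and S: "S \<subseteq> \<pi> ` A" and \<pi>': "\<pi>' ` A' = R"
    and \<Phi>_in: "\<And>y. y \<in> A' \<Longrightarrow> \<Phi> y \<in> A \<and> \<pi> (\<Phi> y) \<in> S"
    and \<Psi>_in: "\<And>x. x \<in> A \<Longrightarrow> \<pi> x \<in> S \<Longrightarrow> \<Psi> x \<in> A'"
    and \<Phi>_poly: "\<And>c. c \<in> C \<Longrightarrow> \<exists>q\<in>polynomial_functions C'. \<forall>y\<in>A'. q y = c (\<Phi> y)"
    and \<Psi>_poly: "\<And>c. c \<in> C' \<Longrightarrow> \<exists>q\<in>polynomial_functions C. \<forall>x\<in>{x\<in>A. \<pi> x \<in> S}. q x = c (\<Psi> x)"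
    and \<Phi>_descends: "\<And>y y'. y \<in> A' \<Longrightarrow> y' \<in> A' \<Longrightarrow> \<pi>' y = \<pi>' y' \<Longrightarrow> \<pi> (\<Phi> y) = \<pi> (\<Phi> y')"
    and \<Psi>_descends: "\<And>x x'. x \<in> A \<Longrightarrow> x' \<in> A \<Longrightarrow> \<pi> x \<in> S \<Longrightarrow> \<pi> x = \<pi> x' \<Longrightarrow> \<pi>' (\<Psi> x) = \<pi>' (\<Psi> x')"
    and \<Phi>\<Psi>: "\<And>x. x \<in> A \<Longrightarrow> \<pi> x \<in> S \<Longrightarrow> \<pi> (\<Phi> (\<Psi> x)) = \<pi> x"
    and \<Psi>\<Phi>: "\<And>y. y \<in> A' \<Longrightarrow> \<pi>' (\<Psi> (\<Phi> y)) = \<pi>' y"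
    and sections: "\<And>x. x \<in> A \<Longrightarrow> \<pi> x \<in> S \<Longrightarrow> \<exists>D s. local_section A C \<pi> x D s"
  shows "isomorphic_varieties
           (subvariety (quotient_variety (quasi_affine_variety A C) \<pi> Q) S)
           (quotient_variety (quasi_affine_variety A' C') \<pi>' R)"
proof -
  let ?A = "quasi_affine_variety A C" and ?A' = "quasi_affine_variety A' C'"
  let ?Q = "quotient_variety ?A \<pi> Q" and ?Y = "quotient_variety ?A' \<pi>' R"
  let ?X = "subvariety ?Q S"
  define h where "h z = \<pi>' (\<Psi> (SOME x. x \<in> A \<and> \<pi> x = z))" for z
  define k where "k z = \<pi> (\<Phi> (SOME y. y \<in> A' \<and> \<pi>' y = z))" for z
  have h: "h (\<pi> x) = \<pi>' (\<Psi> x)" if "x \<in> A" "\<pi> x \<in> S" for x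
  proof -
    have "(SOME x'. x' \<in> A \<and> \<pi> x' = \<pi> x) \<in> A \<and> \<pi> (SOME x'. x' \<in> A \<and> \<pi> x' = \<pi> x) = \<pi> x"
      by (rule someI[of _ x]) (use that in auto)
    then show ?thesis unfolding h_def using that by (intro \<Psi>_descends) auto
  qed
  have k: "k (\<pi>' y) = \<pi> (\<Phi> y)" if "y \<in> A'" for y
  proof -
    have "(SOME y'. y' \<in> A' \<and> \<pi>' y' = \<pi>' y) \<in> A' \<and> \<pi>' (SOME y'. y' \<in> A' \<and> \<pi>' y' = \<pi>' y) = \<pi>' y"
      by (rule someI[of _ y]) (use that in auto)
    then show ?thesis unfolding k_def using that by (intro \<Phi>_descends) auto
  qed
  have tQ: "topspace (zariski ?Q) = Q" using \<pi> by (intro topspace_quotient_variety) simp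
  have tY: "topspace (zariski ?Y) = R" using \<pi>' by (intro topspace_quotient_variety) simp
  have SQ: "S \<subseteq> Q" using S \<pi> by blast
  have tX: "topspace (zariski ?X) = S"
    using SQ tQ by (simp add: subvariety_def topspace_subtopology Int_absorb1)
  have hS: "h z \<in> R" "k (h z) = z" if z: "z \<in> S" for z
  proof -
    obtain x where x: "x \<in> A" "z = \<pi> x" using z S by blast
    have "\<Psi> x \<in> A'" using x z \<Psi>_in by simp
    moreover have "h z = \<pi>' (\<Psi> x)" using h x z by simp
    ultimately show "h z \<in> R" "k (h z) = z" using \<pi>' k[of "\<Psi> x"] \<Phi>\<Psi>[of x] x z by auto
  qed
  have kR: "k z \<in> S" "h (k z) = z" if z: "z \<in> R" for z
  proof -
    obtain y where y: "y \<in> A'" "z = \<pi>' y" using z \<pi>' by blast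
    show "k z \<in> S" "h (k z) = z" using k[OF y(1)] \<Phi>_in[OF y(1)] h[of "\<Phi> y"] \<Psi>\<Phi>[OF y(1)] y by auto
  qed
  \<comment> \<open>Evaluated on the values of a local section through \<open>x\<close>, fractions with denominator
     \<open>r\<close> become functions on one and the same neighbourhood of \<open>\<pi> x\<close>.\<close>
  have section_open:
    "\<exists>V. openin (zariski ?Q) V \<and> \<pi> x \<in> V \<and>
       (\<forall>z\<in>V. \<exists>x'\<in>A. \<pi> x' = z \<and> r x' \<noteq> 0) \<and>
       (\<forall>p\<in>polynomial_functions C. \<exists>g\<in>regular ?Q V. \<forall>z\<in>V. \<exists>x'\<in>A. \<pi> x' = z \<and> r x' \<noteq> 0 \<and> g z = p x' / r x')"
    if x: "x \<in> A" "\<pi> x \<in> S" and r: "r \<in> polynomial_functions C" "r x \<noteq> 0" for x r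
  proof -
    obtain D s where Ds: "local_section A C \<pi> x D s" using sections x by blast
    then have D: "openin (zariski ?A) D" "x \<in> D" "s x = x"
      and s: "\<And>x. x \<in> D \<Longrightarrow> s x \<in> A \<and> \<pi> (s x) = \<pi> x"
      and sat: "\<And>x x'. x \<in> D \<Longrightarrow> x' \<in> A \<Longrightarrow> \<pi> x' = \<pi> x \<Longrightarrow> x' \<in> D \<and> s x' = s x"
      and reg: "\<And>c. c \<in> C \<Longrightarrow> (\<lambda>x. c (s x)) \<in> regular ?A D"
      unfolding local_section_def by blast+
    have DA: "D \<subseteq> A" using D(1) by (simp add: openin_quasi_affine_variety)
    define E where "E = {y \<in> D. r (s y) \<noteq> 0}"
    have rs: "(\<lambda>y. r (s y)) \<in> regular ?A D" by (rule regular_polynomial_compose[OF D(1) reg r(1)])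
    have E: "openin (zariski ?A) E" unfolding E_def by (rule openin_regular_nonzero[OF DA rs])
    have EA: "E \<subseteq> A" using DA by (auto simp: E_def)
    have xE: "x \<in> E" using D r by (simp add: E_def)
    have sat_E: "{y \<in> A. \<pi> y \<in> \<pi> ` E} = E"
      using EA sat unfolding E_def by (auto 4 4)
    have V: "openin (zariski ?Q) (\<pi> ` E)"
      using E EA \<pi> sat_E by (auto simp: openin_quotient_variety)
    have pts: "\<exists>x'\<in>A. \<pi> x' = z \<and> r x' \<noteq> 0" if "z \<in> \<pi> ` E" for z
      using that s unfolding E_def by blast
    have fns: "\<exists>g\<in>regular ?Q (\<pi> ` E). \<forall>z\<in>\<pi> ` E. \<exists>x'\<in>A. \<pi> x' = z \<and> r x' \<noteq> 0 \<and> g z = p x' / r x'"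
      if p: "p \<in> polynomial_functions C" for p
    proof -
      define g where "g z = (let y = (SOME y. y \<in> E \<and> \<pi> y = z) in p (s y) / r (s y))" for z
      have g: "g (\<pi> y) = p (s y) / r (s y)" if "y \<in> E" for y
      proof -
        have "(SOME y'. y' \<in> E \<and> \<pi> y' = \<pi> y) \<in> E \<and> \<pi> (SOME y'. y' \<in> E \<and> \<pi> y' = \<pi> y) = \<pi> y"
          by (rule someI[of _ y]) (use that in auto)
        then have "s (SOME y'. y' \<in> E \<and> \<pi> y' = \<pi> y) = s y"
          using sat[of y] that EA unfolding E_def by blast
        then show ?thesis by (simp add: g_def Let_def)
      qed
      have ps: "(\<lambda>y. p (s y)) \<in> regular ?A E"
        by (rule regular_polynomial_compose[OF E _ p])
          (rule regular_subset[OF E _ DA reg], auto simp: E_def)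
      have rs': "(\<lambda>y. r (s y)) \<in> regular ?A E"
        by (rule regular_subset[OF E _ DA rs]) (auto simp: E_def)
      have "(\<lambda>y. p (s y) * inverse (r (s y))) \<in> regular ?A E"
        by (intro regular_mult[OF EA] ps regular_inverse[OF EA] rs') (auto simp: E_def)
      then have "g \<circ> \<pi> \<in> regular ?A E"
        by (rule regular_cong[OF EA]) (simp add: g divide_inverse)
      then have "g \<in> regular ?Q (\<pi> ` E)"
        using sat_E by (simp add: quotient_variety_def)
      moreover have "\<exists>x'\<in>A. \<pi> x' = z \<and> r x' \<noteq> 0 \<and> g z = p x' / r x'" if z: "z \<in> \<pi> ` E" for z
      proof -
        obtain y where y: "y \<in> E" "z = \<pi> y" using z by blast
        then show ?thesis using g[OF y(1)] s[of y] by (intro bexI[of _ "s y"]) (auto simp: E_def)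
      qed
      ultimately show ?thesis by blast
    qed
    show ?thesis using V xE pts fns by (intro exI[of _ "\<pi> ` E"] conjI) auto
  qed
  have openX: "openin (zariski ?X) U \<longleftrightarrow> (\<exists>V. openin (zariski ?Q) V \<and> U = V \<inter> S)" for U
    by (auto simp: subvariety_def openin_subtopology)
  have h_open: "openin (zariski ?X) {z \<in> S. h z \<in> U}" if U: "openin (zariski ?Y) U" for U
  proof (subst openin_subopen, rule ballI)
    fix z assume z: "z \<in> {z \<in> S. h z \<in> U}"
    then obtain x where x: "x \<in> A" "z = \<pi> x" using S by blast
    have "openin (zariski ?A') {y \<in> A'. \<pi>' y \<in> U}" using U by (simp add: openin_quotient_variety)
    moreover have "\<Psi> x \<in> {y \<in> A'. \<pi>' y \<in> U}" using h \<Psi>_in x z by auto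
    ultimately obtain P where P: "P \<in> polynomial_functions C'" "P (\<Psi> x) \<noteq> 0"
      "\<And>y. y \<in> A' \<Longrightarrow> P y \<noteq> 0 \<Longrightarrow> \<pi>' y \<in> U" unfolding openin_quasi_affine_variety by blast
    obtain r where r: "r \<in> polynomial_functions C" "\<forall>x\<in>{x\<in>A. \<pi> x \<in> S}. r x = P (\<Psi> x)"
      using polynomial_functions_pullback[where \<Phi>=\<Psi>, OF \<Psi>_poly P(1)] by blast
    have "r x \<noteq> 0" using r P x z by auto
    from section_open[OF x(1) _ r(1) this] obtain V where V: "openin (zariski ?Q) V" "\<pi> x \<in> V"
      "\<forall>z\<in>V. \<exists>x'\<in>A. \<pi> x' = z \<and> r x' \<noteq> 0" using x z by auto
    have "V \<inter> S \<subseteq> {z \<in> S. h z \<in> U}"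
    proof
      fix z' assume z': "z' \<in> V \<inter> S"
      then obtain x' where x': "x' \<in> A" "\<pi> x' = z'" "r x' \<noteq> 0" using V by blast
      then have "\<pi>' (\<Psi> x') \<in> U" using P(3) \<Psi>_in z' r by auto
      then show "z' \<in> {z \<in> S. h z \<in> U}" using h x' z' by auto
    qed
    then show "\<exists>T. openin (zariski ?X) T \<and> z \<in> T \<and> T \<subseteq> {z \<in> S. h z \<in> U}"
      using V x z openX by (intro exI[of _ "V \<inter> S"]) auto
  qed
  have k_open: "openin (zariski ?Y) {z \<in> R. k z \<in> U}" if U: "openin (zariski ?X) U" for U
  proof -
    obtain V where V: "openin (zariski ?Q) V" "U = V \<inter> S" using U openX by blast
    have "openin (zariski ?A') {y \<in> A'. \<pi>' y \<in> {z \<in> R. k z \<in> U}}"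
      unfolding openin_quasi_affine_variety
    proof (intro conjI ballI)
      fix y assume "y \<in> {y \<in> A'. \<pi>' y \<in> {z \<in> R. k z \<in> U}}"
      then have y: "y \<in> A'" "\<pi> (\<Phi> y) \<in> V" using k V by auto
      have "openin (zariski ?A) {x \<in> A. \<pi> x \<in> V}" using V by (simp add: openin_quotient_variety)
      moreover have "\<Phi> y \<in> {x \<in> A. \<pi> x \<in> V}" using \<Phi>_in y by blast
      ultimately obtain P where P: "P \<in> polynomial_functions C" "P (\<Phi> y) \<noteq> 0"
        "\<And>x. x \<in> A \<Longrightarrow> P x \<noteq> 0 \<Longrightarrow> \<pi> x \<in> V" unfolding openin_quasi_affine_variety by blast
      obtain r where r: "r \<in> polynomial_functions C'" "\<forall>y\<in>A'. r y = P (\<Phi> y)"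
        using polynomial_functions_pullback[where \<Phi>=\<Phi>, OF \<Phi>_poly P(1)] by blast
      show "\<exists>p\<in>polynomial_functions C'. p y \<noteq> 0 \<and> (\<forall>y\<in>A'. p y \<noteq> 0 \<longrightarrow> y \<in> {y \<in> A'. \<pi>' y \<in> {z \<in> R. k z \<in> U}})"
        using r P y \<Phi>_in k \<pi>' V by (intro bexI[of _ r]) auto
    qed auto
    then show ?thesis by (simp add: openin_quotient_variety)
  qed
  have "homeomorphic_maps (zariski ?X) (zariski ?Y) h k"
    unfolding homeomorphic_maps_def continuous_map_def tX tY
    using h_open k_open hS kR by auto
  then have homeo: "homeomorphic_map (zariski ?X) (zariski ?Y) h"
    using homeomorphic_map_maps by blast
  have pull: "f \<circ> h \<in> regular ?X {z \<in> S. h z \<in> U}"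
    if U: "openin (zariski ?Y) U" and f: "f \<in> regular ?Y U" for U f
  proof -
    have f': "f \<circ> \<pi>' \<in> regular ?A' {y \<in> A'. \<pi>' y \<in> U}" using f by (simp add: quotient_variety_def)
    have "\<exists>V. openin (zariski ?Q) V \<and> z \<in> V \<and> (\<exists>g\<in>regular ?Q V. \<forall>z'\<in>{z \<in> S. h z \<in> U} \<inter> V. (f \<circ> h) z' = g z')"
      if z: "z \<in> {z \<in> S. h z \<in> U}" for z
    proof -
      obtain x where x: "x \<in> A" "z = \<pi> x" using S z by blast
      have "\<Psi> x \<in> {y \<in> A'. \<pi>' y \<in> U}" using h \<Psi>_in x z by auto
      with f' obtain P N where P: "P \<in> polynomial_functions C'" "N \<in> polynomial_functions C'" "P (\<Psi> x) \<noteq> 0"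
        "\<And>y. y \<in> A' \<Longrightarrow> P y \<noteq> 0 \<Longrightarrow> f (\<pi>' y) = N y / P y"
        unfolding regular_quasi_affine_variety_iff[of "{y \<in> A'. \<pi>' y \<in> U}" A', simplified] by force
      obtain r where r: "r \<in> polynomial_functions C" "\<forall>x\<in>{x\<in>A. \<pi> x \<in> S}. r x = P (\<Psi> x)"
        using polynomial_functions_pullback[where \<Phi>=\<Psi>, OF \<Psi>_poly P(1)] by blast
      obtain p where p: "p \<in> polynomial_functions C" "\<forall>x\<in>{x\<in>A. \<pi> x \<in> S}. p x = N (\<Psi> x)"
        using polynomial_functions_pullback[where \<Phi>=\<Psi>, OF \<Psi>_poly P(2)] by blast
      have "r x \<noteq> 0" using r P x z by auto
      from section_open[OF x(1) _ r(1) this] p obtain V g where V: "openin (zariski ?Q) V" "\<pi> x \<in> V"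
        "g \<in> regular ?Q V" "\<forall>z\<in>V. \<exists>x'\<in>A. \<pi> x' = z \<and> r x' \<noteq> 0 \<and> g z = p x' / r x'"
        using x z by blast
      have "(f \<circ> h) z' = g z'" if z': "z' \<in> {z \<in> S. h z \<in> U} \<inter> V" for z'
      proof -
        obtain x' where x': "x' \<in> A" "\<pi> x' = z'" "r x' \<noteq> 0" "g z' = p x' / r x'" using V z' by blast
        then show ?thesis using P(4)[of "\<Psi> x'"] r p z' h[of x'] \<Psi>_in[of x'] by auto
      qed
      then show ?thesis using V x by blast
    qed
    then show ?thesis by (simp add: subvariety_def)
  qed
  have push: "f \<in> regular ?Y U"
    if U: "openin (zariski ?Y) U" and f: "f \<circ> h \<in> regular ?X {z \<in> S. h z \<in> U}" for U f
  proof -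
    have UR: "U \<subseteq> R" using U by (simp add: openin_quotient_variety)
    have U': "openin (zariski ?A') {y \<in> A'. \<pi>' y \<in> U}" using U by (simp add: openin_quotient_variety)
    have "f \<circ> \<pi>' \<in> regular ?A' {y \<in> A'. \<pi>' y \<in> U}"
    proof (subst regular_quasi_affine_variety_iff, blast, rule ballI)
      fix y assume y: "y \<in> {y \<in> A'. \<pi>' y \<in> U}"
      then have z: "\<pi> (\<Phi> y) \<in> {z \<in> S. h z \<in> U}" using k \<Phi>_in[of y] kR[of "\<pi>' y"] UR by auto
      then obtain V g where V: "openin (zariski ?Q) V" "\<pi> (\<Phi> y) \<in> V" "g \<in> regular ?Q V"
        "\<forall>z'\<in>{z \<in> S. h z \<in> U} \<inter> V. (f \<circ> h) z' = g z'" using f by (auto simp: subvariety_def)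
      have "g \<circ> \<pi> \<in> regular ?A {x \<in> A. \<pi> x \<in> V}" using V(3) by (simp add: quotient_variety_def)
      moreover have "\<Phi> y \<in> {x \<in> A. \<pi> x \<in> V}" using \<Phi>_in y V by blast
      ultimately obtain P N where P: "N \<in> polynomial_functions C" "P \<in> polynomial_functions C" "P (\<Phi> y) \<noteq> 0"
        "\<And>x. x \<in> A \<Longrightarrow> P x \<noteq> 0 \<Longrightarrow> \<pi> x \<in> V \<and> g (\<pi> x) = N x / P x"
        unfolding regular_quasi_affine_variety_iff[of "{x \<in> A. \<pi> x \<in> V}" A, simplified] by force
      obtain r where r: "r \<in> polynomial_functions C'" "\<forall>y\<in>A'. r y = P (\<Phi> y)"
        using polynomial_functions_pullback[where \<Phi>=\<Phi>, OF \<Phi>_poly P(2)] by blast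
      obtain p where p: "p \<in> polynomial_functions C'" "\<forall>y\<in>A'. p y = N (\<Phi> y)"
        using polynomial_functions_pullback[where \<Phi>=\<Phi>, OF \<Phi>_poly P(1)] by blast
      obtain e where e: "e \<in> polynomial_functions C'" "e y \<noteq> 0" "\<forall>y\<in>A'. e y \<noteq> 0 \<longrightarrow> \<pi>' y \<in> U"
        using U' y unfolding openin_quasi_affine_variety by blast
      \<comment> \<open>The factor \<open>e\<close> confines the fraction to the preimage of \<open>U\<close>.\<close>
      show "\<exists>p\<in>polynomial_functions C'. \<exists>r\<in>polynomial_functions C'. r y \<noteq> 0 \<and>
          (\<forall>y\<in>A'. r y \<noteq> 0 \<longrightarrow> y \<in> {y \<in> A'. \<pi>' y \<in> U} \<and> (f \<circ> \<pi>') y = p y / r y)"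
      proof (rule bexI[of _ "\<lambda>y. p y * e y"], rule bexI[of _ "\<lambda>y. r y * e y"], intro conjI ballI impI)
        show "(\<lambda>y. p y * e y) \<in> polynomial_functions C'" "(\<lambda>y. r y * e y) \<in> polynomial_functions C'"
          using p r e by (auto intro: polynomial_functions.mult)
        show "r y * e y \<noteq> 0" using r e P y by auto
        fix y' assume y': "y' \<in> A'" "r y' * e y' \<noteq> 0"
        then show U1: "y' \<in> {y \<in> A'. \<pi>' y \<in> U}" using e by auto
        then have "\<pi> (\<Phi> y') \<in> {z \<in> S. h z \<in> U}" "h (\<pi> (\<Phi> y')) = \<pi>' y'"
          using k \<Phi>_in[of y'] kR[of "\<pi>' y'"] UR by auto
        moreover have "\<pi> (\<Phi> y') \<in> V \<and> g (\<pi> (\<Phi> y')) = N (\<Phi> y') / P (\<Phi> y')"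
          using P(4)[of "\<Phi> y'"] \<Phi>_in[of y'] r y' by auto
        ultimately have "f (\<pi>' y') = N (\<Phi> y') / P (\<Phi> y')" using V(4) by force
        then show "(f \<circ> \<pi>') y' = p y' * e y' / (r y' * e y')" using p r y' by auto
      qed
    qed
    then show ?thesis by (simp add: quotient_variety_def)
  qed
  have "variety_isomorphism ?X ?Y h"
    unfolding variety_isomorphism_def tX using homeo pull push by blast
  then show ?thesis unfolding isomorphic_varieties_def by blast
qed

section \<open>Frames of isotropic flags\<close>

lemma (in finite_dimensional_vector_space) dim_Un_successive:
  assumes "\<And>j. j \<in> {1..k} \<Longrightarrow> v j \<notin> span (A \<union> v ` {1..<j})"
  shows "dim (A \<union> v ` {1..k}) = dim A + k"
  using assms
proof (induction k)
  case (Suc k)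
  have "{1..Suc k} = insert (Suc k) {1..k}" by auto
  then have "A \<union> v ` {1..Suc k} = insert (v (Suc k)) (A \<union> v ` {1..k})" by auto
  moreover have "v (Suc k) \<notin> span (A \<union> v ` {1..k})"
    using Suc.prems[of "Suc k"] by (simp add: atLeastLessThanSuc_atLeastAtMost)
  moreover have "dim (A \<union> v ` {1..k}) = dim A + k" using Suc by auto
  ultimately show ?case by (simp add: dim_insert)
qed simp

text \<open>Frames are handled one vector at a time throughout: each member is compared with the span
  of its predecessors, which is a step of the flag.\<close>

lemma (in finite_dimensional_vector_space) inj_on_independent_iff_successive:
  fixes v :: "nat \<Rightarrow> 'b"
  shows "inj_on v {1..k} \<and> independent (v ` {1..k}) \<longleftrightarrow> (\<forall>j\<in>{1..k}. v j \<notin> span (v ` {1..<j}))"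
proof (induction k)
  case 0
  show ?case by (simp add: independent_empty)
next
  case (Suc k)
  have ins: "{1..Suc k} = insert (Suc k) {1..k}" "Suc k \<notin> {1..k}" by auto
  have "inj_on v {1..Suc k} \<and> independent (v ` {1..Suc k}) \<longleftrightarrow>
      v (Suc k) \<notin> span (v ` {1..k}) \<and> inj_on v {1..k} \<and> independent (v ` {1..k})"
    unfolding ins(1) using ins(2)
    by (auto simp: independent_insert span_base)
  then show ?case using Suc.IH unfolding ins(1)
    by (simp add: atLeastLessThanSuc_atLeastAtMost)
qed

locale skew_space = finite_dimensional_vector_space s Basis
  for s :: "complex \<Rightarrow> 'a::ab_group_add \<Rightarrow> 'a" and Basis +
  fixes \<omega> :: "'a \<Rightarrow> 'a \<Rightarrow> complex"
  assumes skew_form: "skew_form s \<omega>"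
begin

lemma skew: "\<omega> x y = - \<omega> y x"
  using skew_form unfolding skew_form_def by blast

lemma linear_form: "Vector_Spaces.linear s (*) (\<omega> x)"
  using skew_form unfolding skew_form_def by blast

lemma form_right [simp]: "\<omega> x (y + z) = \<omega> x y + \<omega> x z" "\<omega> x (s c y) = c * \<omega> x y"
  using linear_form[of x] unfolding Vector_Spaces.linear_iff by auto

lemma form_left [simp]: "\<omega> (x + y) z = \<omega> x z + \<omega> y z" "\<omega> (s c x) z = c * \<omega> x z"
  using skew[of "x + y" z] skew[of x z] skew[of y z] skew[of "s c x" z] by auto

lemma form_zero [simp]: "\<omega> x 0 = 0" "\<omega> 0 x = 0"
  using form_right(2)[of x 0 0] form_left(2)[of 0 0 x] by auto

lemma form_self [simp]: "\<omega> x x = 0"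
  using skew[of x x] by simp

lemma form_minus [simp]: "\<omega> x (- y) = - \<omega> x y" "\<omega> (- x) y = - \<omega> x y"
  using form_right(1)[of x y "- y"] form_left(1)[of x "- x" y]
  by (auto simp: add_eq_0_iff simp del: form_right form_left)

lemma form_diff [simp]: "\<omega> x (y - z) = \<omega> x y - \<omega> x z" "\<omega> (x - y) z = \<omega> x z - \<omega> y z"
  using form_right(1)[of x y "- z"] form_left(1)[of x "- y" z] by auto

lemma form_sum [simp]: "\<omega> x (sum f I) = (\<Sum>i\<in>I. \<omega> x (f i))" "\<omega> (sum f I) x = (\<Sum>i\<in>I. \<omega> (f i) x)"
  by (induction I rule: infinite_finite_induct) auto

lemma subspace_orthogonal: "subspace {x. \<omega> x y = 0}"
  by (auto simp: subspace_def)

lemma orthogonal_span: "x \<in> span S \<Longrightarrow> (\<And>z. z \<in> S \<Longrightarrow> \<omega> z y = 0) \<Longrightarrow> \<omega> x y = 0"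
  using span_minimal[OF _ subspace_orthogonal[of y], of S] by blast

lemma isotropic_span_iff: "isotropic \<omega> (span S) \<longleftrightarrow> (\<forall>x\<in>S. \<forall>y\<in>S. \<omega> x y = 0)"
proof
  assume R: "\<forall>x\<in>S. \<forall>y\<in>S. \<omega> x y = 0"
  have "\<omega> x y = 0" if "x \<in> span S" "y \<in> span S" for x y
  proof (rule orthogonal_span[OF that(1)])
    fix z assume z: "z \<in> S"
    have "\<omega> y z = 0" by (rule orthogonal_span[OF that(2)]) (use R z in auto)
    then show "\<omega> z y = 0" using skew[of z y] by simp
  qed
  then show "isotropic \<omega> (span S)" by (simp add: isotropic_def)
qed (auto simp: isotropic_def span_base)

lemma isotropic_frames_iff:
  "v \<in> isotropic_frames s \<omega> k \<longleftrightarrow> v \<in> extensional {1..k} \<and>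
     (\<forall>j\<in>{1..k}. v j \<notin> span (v ` {1..<j})) \<and> (\<forall>a\<in>{1..k}. \<forall>b\<in>{1..k}. \<omega> (v a) (v b) = 0)"
  unfolding isotropic_frames_def isotropic_span_iff inj_on_independent_iff_successive[symmetric]
  by auto

lemma dim_span_frame:
  assumes "v \<in> isotropic_frames s \<omega> k" "j \<le> k"
  shows "dim (span (v ` {1..j})) = j"
  using dim_Un_successive[of j v "{}"] assms by (auto simp: isotropic_frames_iff)

lemma flag_of_frame_in_flags:
  assumes v: "v \<in> isotropic_frames s \<omega> k"
  shows "flag_of_frame s k v \<in> isotropic_flags s \<omega> k"
proof -
  have "isotropic \<omega> (span (v ` {1..j}))" if "j \<le> k" for j
    using v that unfolding isotropic_span_iff isotropic_frames_iff by auto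
  moreover have "span (v ` {1..j}) \<subseteq> span (v ` {1..Suc j})" for j
    by (rule span_mono) auto
  ultimately show ?thesis
    using dim_span_frame[OF v] by (auto simp: isotropic_flags_def flag_of_frame_def)
qed

text \<open>Both sides have a \<open>j\<close>-dimensional \<open>j\<close>-th step, so inclusions in one direction suffice.\<close>

lemma flag_of_frame_eqI:
  assumes v: "v \<in> isotropic_frames s \<omega> k" "v' \<in> isotropic_frames s \<omega> k"
    and mem: "\<And>j m. j \<le> k \<Longrightarrow> 1 \<le> m \<Longrightarrow> m \<le> j \<Longrightarrow> v m \<in> span (v' ` {1..j})"
  shows "flag_of_frame s k v = flag_of_frame s k v'"
proof -
  have "span (v ` {1..j}) = span (v' ` {1..j})" if j: "j \<le> k" for j
  proof (rule subspace_dim_equal)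
    show "span (v ` {1..j}) \<subseteq> span (v' ` {1..j})"
      by (rule span_minimal) (use mem j in auto)
    show "dim (span (v ` {1..j})) \<ge> dim (span (v' ` {1..j}))"
      using dim_span_frame[OF v(1) j] dim_span_frame[OF v(2) j] by simp
  qed auto
  then show ?thesis by (auto simp: flag_of_frame_def intro!: restrict_ext)
qed

lemma
  assumes V: "V \<in> isotropic_flags s \<omega> k" and j: "j \<le> k"
  shows subspace_flag: "subspace (V j)" and dim_flag: "dim (V j) = j"
    and isotropic_flag: "isotropic \<omega> (V j)"
proof -
  have "subspace (V j) \<and> dim (V j) = j \<and> isotropic \<omega> (V j)"
  proof (cases "j = 0")
    case True
    then show ?thesis using V by (simp add: isotropic_flags_def isotropic_def)
  next
    case False
    then show ?thesis using V j by (simp add: isotropic_flags_def)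
  qed
  then show "subspace (V j)" "dim (V j) = j" "isotropic \<omega> (V j)" by blast+
qed

lemma flag_mono:
  assumes V: "V \<in> isotropic_flags s \<omega> k" and j: "i \<le> j" "j \<le> k"
  shows "V i \<subseteq> V j"
  using j
proof (induction j)
  case (Suc j)
  have "V j \<subseteq> V (Suc j)" using V Suc.prems by (simp add: isotropic_flags_def)
  then show ?case using Suc by (cases "i = Suc j") auto
qed simp

text \<open>The span of the first \<open>j\<close> chosen vectors lies in \<open>V j\<close> and already has its dimension.\<close>

lemma frame_of_flag:
  assumes V: "V \<in> isotropic_flags s \<omega> k"
    and u: "\<And>j. j \<in> {1..k} \<Longrightarrow> u j \<in> V j" "\<And>j. j \<in> {1..k} \<Longrightarrow> u j \<notin> V (j - 1)"
  shows "restrict u {1..k} \<in> isotropic_frames s \<omega> k"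
    and "flag_of_frame s k (restrict u {1..k}) = V"
proof -
  let ?v = "restrict u {1..k}"
  have sub: "span (?v ` {1..j}) \<subseteq> V j" if j: "j \<le> k" for j
  proof (rule span_minimal)
    show "?v ` {1..j} \<subseteq> V j" using u(1) flag_mono[OF V _ j] j by fastforce
  qed (rule subspace_flag[OF V j])
  show v: "?v \<in> isotropic_frames s \<omega> k"
    unfolding isotropic_frames_iff
  proof (intro conjI ballI)
    fix j assume j: "j \<in> {1..k}"
    have "{1..<j} = {1..j - 1}" using j by auto
    moreover have "j - 1 \<le> k" "?v j = u j" using j by auto
    ultimately show "?v j \<notin> span (?v ` {1..<j})" using u(2)[OF j] sub[of "j - 1"] by (metis subsetD)
  next
    fix a b assume "a \<in> {1..k}" "b \<in> {1..k}"
    then have "?v a \<in> V k" "?v b \<in> V k"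
      using u(1)[of a] u(1)[of b] flag_mono[OF V, of a k] flag_mono[OF V, of b k] by auto
    then show "\<omega> (?v a) (?v b) = 0" using isotropic_flag[OF V, of k] by (auto simp: isotropic_def)
  qed simp
  have "span (?v ` {1..j}) = V j" if j: "j \<le> k" for j
    by (rule subspace_dim_equal[OF _ subspace_flag[OF V j] sub[OF j]])
      (use dim_span_frame[OF v j] dim_flag[OF V j] in auto)
  then have "flag_of_frame s k ?v j = V j" if "j \<in> {0..k}" for j
    using that unfolding flag_of_frame_def by (metis atLeastAtMost_iff restrict_apply')
  then show "flag_of_frame s k ?v = V"
    using V by (intro extensionalityI[of _ "{0..k}"]) (auto simp: flag_of_frame_def isotropic_flags_def)
qed

lemma flag_of_frame_image: "flag_of_frame s k ` isotropic_frames s \<omega> k = isotropic_flags s \<omega> k"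
proof
  show "isotropic_flags s \<omega> k \<subseteq> flag_of_frame s k ` isotropic_frames s \<omega> k"
  proof
    fix V assume V: "V \<in> isotropic_flags s \<omega> k"
    have "\<exists>x. x \<in> V j \<and> x \<notin> V (j - 1)" if j: "j \<in> {1..k}" for j
    proof (rule ccontr)
      assume "\<nexists>x. x \<in> V j \<and> x \<notin> V (j - 1)"
      then have "dim (V j) \<le> dim (V (j - 1))" by (intro dim_subset) auto
      then show False using dim_flag[OF V, of j] dim_flag[OF V, of "j - 1"] j by auto
    qed
    then obtain u where "\<forall>j\<in>{1..k}. u j \<in> V j \<and> u j \<notin> V (j - 1)" by metis
    then show "V \<in> flag_of_frame s k ` isotropic_frames s \<omega> k"
      using frame_of_flag[OF V, of u] by (metis image_eqI)
  qed
qed (use flag_of_frame_in_flags in blast)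

section \<open>Local sections of the quotient by the Borel group\<close>

text \<open>Relative to functionals \<open>l\<close>, normalised vectors in all steps of a flag are the columns of a
  lower triangular matrix with unit diagonal.  By the factorisation of a generic matrix into a
  lower and an upper triangular one, a generic orbit of the Borel group contains exactly one such
  matrix; it serves as the normal form of a frame.\<close>

definition normalised :: "(nat \<Rightarrow> 'a \<Rightarrow> complex) \<Rightarrow> (nat \<Rightarrow> 'a set) \<Rightarrow> nat \<Rightarrow> 'a \<Rightarrow> bool" where
  "normalised l V b u \<longleftrightarrow> u \<in> V b \<and> (\<forall>a\<in>{1..<b}. l a u = 0) \<and> l b u = 1"

lemma linear_functional_simps:
  assumes "Vector_Spaces.linear s (*) l"
  shows "l (x + y) = l x + l y" "l (s c x) = c * l x" "l 0 = 0" "l (- x) = - l x" "l (x - y) = l x - l y"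
proof -
  show add: "l (x + y) = l x + l y" for x y using assms unfolding Vector_Spaces.linear_iff by auto
  show sc: "l (s c x) = c * l x" for c x using assms unfolding Vector_Spaces.linear_iff by auto
  show z: "l 0 = 0" using sc[of 0 0] by simp
  show m: "l (- x) = - l x" for x using add[of x "- x"] z by (metis add.right_inverse minus_unique)
  show "l (x - y) = l x - l y" using add[of x "- y"] m[of y] by simp
qed

text \<open>The vectors that are normalised for the steps up to \<open>b\<close> form a basis of \<open>V b\<close> on which
  \<open>l 1, \<dots>, l b\<close> are triangular with unit diagonal, so these functionals separate the points
  of \<open>V b\<close>.\<close>

lemma normalised_zero:
  assumes lin: "\<And>a. Vector_Spaces.linear s (*) (l a)" and V: "V \<in> isotropic_flags s \<omega> k"
    and b: "b \<le> k" and ex: "\<forall>a\<in>{1..b}. \<exists>u. normalised l V a u"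
    and x: "x \<in> V b" "\<forall>a\<in>{1..b}. l a x = 0"
  shows "x = 0"
  using b ex x
proof (induction b arbitrary: x)
  case 0
  then show ?case using V by (simp add: isotropic_flags_def)
next
  case (Suc b)
  have "\<exists>u. normalised l V (Suc b) u" using Suc.prems(2) by simp
  then obtain u where u: "u \<in> V (Suc b)" "\<forall>a\<in>{1..<Suc b}. l a u = 0" "l (Suc b) u = 1"
    unfolding normalised_def by blast
  have IH: "y = 0" if "y \<in> V b" "\<forall>a\<in>{1..b}. l a y = 0" for y
    using Suc.IH[of y] Suc.prems that by auto
  have "u \<notin> V b"
  proof
    assume "u \<in> V b"
    then have "u = 0" by (rule IH) (use u in auto)
    then show False using u(3) linear_functional_simps(3)[OF lin] by simp
  qed
  have subV: "subspace (V b)" "subspace (V (Suc b))"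
    using subspace_flag[OF V] Suc.prems(1) by auto
  have "span (insert u (V b)) = V (Suc b)"
  proof (rule subspace_dim_equal)
    show "span (insert u (V b)) \<subseteq> V (Suc b)"
      by (rule span_minimal) (use u flag_mono[OF V, of b "Suc b"] Suc.prems(1) subV in auto)
    have "dim (insert u (V b)) = Suc b"
      using \<open>u \<notin> V b\<close> subV(1) dim_flag[OF V, of b] Suc.prems(1)
      by (simp add: dim_insert span_eq_iff[THEN iffD2])
    then show "dim (span (insert u (V b))) \<ge> dim (V (Suc b))"
      using dim_flag[OF V Suc.prems(1)] by simp
  qed (use subV in auto)
  then obtain c where c: "x - s c u \<in> span (V b)"
    using Suc.prems(3) span_breakdown_eq[of x u "V b"] by auto
  then have "x - s c u \<in> V b" using subV by (simp add: span_eq_iff[THEN iffD2])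
  moreover have "\<forall>a\<in>{1..b}. l a (x - s c u) = 0"
    using Suc.prems(4) u(2) by (simp add: linear_functional_simps[OF lin])
  ultimately have xu: "x - s c u = 0" by (rule IH)
  then have "l (Suc b) (x - s c u) = 0" by (simp add: linear_functional_simps[OF lin])
  moreover have "l (Suc b) x = 0" using Suc.prems(4) by simp
  ultimately have "c = 0" using u(3) by (simp add: linear_functional_simps[OF lin])
  then show ?case using xu by simp
qed

lemma normalised_unique:
  assumes lin: "\<And>a. Vector_Spaces.linear s (*) (l a)" and V: "V \<in> isotropic_flags s \<omega> k"
    and b: "b \<in> {1..k}" and ex: "\<forall>a\<in>{1..b}. \<exists>u. normalised l V a u"
    and u: "normalised l V b u" "normalised l V b u'"
  shows "u = u'"
proof -
  have "u - u' = 0"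
  proof (rule normalised_zero[where l=l, OF lin V _ ex])
    show "u - u' \<in> V b" using u subspace_flag[OF V, of b] b
      by (auto simp: normalised_def intro: subspace_diff)
    show "\<forall>a\<in>{1..b}. l a (u - u') = 0"
    proof
      fix a assume "a \<in> {1..b}"
      then show "l a (u - u') = 0" using u
        by (cases "a = b") (auto simp: normalised_def linear_functional_simps[OF lin])
    qed
  qed (use b in auto)
  then show ?thesis by simp
qed

abbreviation frame_variety :: "nat \<Rightarrow> (nat \<Rightarrow> 'a) variety" where
  "frame_variety k \<equiv> quasi_affine_variety (isotropic_frames s \<omega> k) (frame_coordinates s k)"

text \<open>Gaussian elimination.  From \<open>v (Suc b)\<close> one subtracts multiples of the normalised vectors of
  the earlier steps until \<open>l 1, \<dots>, l b\<close> vanish on the result \<open>r v\<close>.  If \<open>l (Suc b)\<close> does not vanish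
  on it, dividing by its value there gives the normalised vector of the next step; if it does, the
  next step contains no normalised vector.  So at each step the domain shrinks to the locus where
  the regular divisor is nonzero, and the coordinates of the new vector are regular there.\<close>

lemma normalised_regular:
  fixes l k
  defines "N \<equiv> \<lambda>v. normalised l (flag_of_frame s k v)"
  defines "D \<equiv> \<lambda>b. {v \<in> isotropic_frames s \<omega> k. \<forall>a\<in>{1..b}. \<exists>u. N v a u}"
  assumes lin: "\<And>a. Vector_Spaces.linear s (*) (l a)" and "b \<le> k"
  shows "openin (zariski (frame_variety k)) (D b) \<and>
    (\<forall>a\<in>{1..b}. \<forall>c. Vector_Spaces.linear s (*) c \<longrightarrow>
        (\<lambda>v. c (THE u. N v a u)) \<in> regular (frame_variety k) (D b))"
  using \<open>b \<le> k\<close>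
proof (induction b)
  case 0
  have "D 0 = topspace (zariski (frame_variety k))" by (simp add: D_def)
  then show ?case by (metis atLeastatMost_empty_iff2 empty_iff not_one_le_zero openin_topspace)
next
  case (Suc b)
  let ?X = "frame_variety k" and ?F = "isotropic_frames s \<omega> k"
  let ?V = "flag_of_frame s k"
  have DF: "D b' \<subseteq> ?F" for b' by (auto simp: D_def)
  have openD: "openin (zariski ?X) (D b)" and reg: "\<And>a c. a \<in> {1..b} \<Longrightarrow> Vector_Spaces.linear s (*) c \<Longrightarrow>
        (\<lambda>v. c (THE u. N v a u)) \<in> regular ?X (D b)" using Suc by auto
  have flag: "?V v \<in> isotropic_flags s \<omega> k" if "v \<in> D b'" for v b'
    using that DF flag_of_frame_in_flags by blast
  have the: "(THE u. N v a u) = u" if "v \<in> D b'" "N v a u" "a \<in> {1..b'}" "b' \<le> k" for v a b' u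
    using that normalised_unique[where l=l, OF lin flag[OF that(1)], of a]
    by (intro the_equality) (auto simp: N_def D_def)
  have the_N: "N v a (THE u. N v a u)" if v: "v \<in> D b'" "a \<in> {1..b'}" "b' \<le> k" for v a b'
  proof -
    obtain u where "N v a u" using v unfolding D_def by blast
    then show ?thesis using the[OF v(1) _ v(2,3)] by simp
  qed
  \<comment> \<open>Elimination against the first \<open>m\<close> normalised vectors, which keeps the class of
     \<open>v (Suc b)\<close> modulo the \<open>b\<close>-th step.\<close>
  have "\<exists>r. (\<forall>v\<in>D b. r v - v (Suc b) \<in> ?V v b \<and> (\<forall>a\<in>{1..m}. l a (r v) = 0)) \<and>
      (\<forall>c. Vector_Spaces.linear s (*) c \<longrightarrow> (\<lambda>v. c (r v)) \<in> regular ?X (D b))" if "m \<le> b" for m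
    using that
  proof (induction m)
    case 0
    have "(\<lambda>v. c (v (Suc b))) \<in> regular ?X (D b)" if "Vector_Spaces.linear s (*) c" for c
      using that Suc.prems
      by (intro regular_polynomial[OF openD] polynomial_functions.coord) (auto simp: frame_coordinates_def)
    moreover have "0 \<in> ?V v b" if "v \<in> D b" for v
      using subspace_flag[OF flag[OF that], of b] Suc.prems by (simp add: subspace_0)
    ultimately show ?case by (intro exI[of _ "\<lambda>v. v (Suc b)"]) auto
  next
    case (Suc m)
    then have "m \<le> b" by simp
    from Suc.IH[OF this] obtain r where "(\<forall>v\<in>D b. r v - v (Suc b) \<in> ?V v b \<and> (\<forall>a\<in>{1..m}. l a (r v) = 0)) \<and>
      (\<forall>c. Vector_Spaces.linear s (*) c \<longrightarrow> (\<lambda>v. c (r v)) \<in> regular ?X (D b))" by blast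
    then have r: "\<And>v. v \<in> D b \<Longrightarrow> r v - v (Suc b) \<in> ?V v b"
      "\<And>v a. v \<in> D b \<Longrightarrow> a \<in> {1..m} \<Longrightarrow> l a (r v) = 0"
      "\<And>c. Vector_Spaces.linear s (*) c \<Longrightarrow> (\<lambda>v. c (r v)) \<in> regular ?X (D b)" by blast+
    define w where "w v = (THE u. N v (Suc m) u)" for v
    define r' where "r' v = r v - s (l (Suc m) (r v)) (w v)" for v
    have m: "Suc m \<in> {1..b}" "b \<le> k" using Suc \<open>Suc b \<le> k\<close> by auto
    have w: "N v (Suc m) (w v)" if "v \<in> D b" for v unfolding w_def by (rule the_N[OF that m])
    show ?case
    proof (intro exI[of _ r'] conjI ballI allI impI)
      fix v assume v: "v \<in> D b"
      have "w v \<in> ?V v b"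
        using w[OF v] m flag_mono[OF flag[OF v], of "Suc m" b] by (auto simp: N_def normalised_def)
      then have "(r v - v (Suc b)) - s (l (Suc m) (r v)) (w v) \<in> ?V v b"
        by (intro subspace_diff[OF _ r(1)[OF v]] subspace_scale subspace_flag[OF flag[OF v] m(2)])
      then show "r' v - v (Suc b) \<in> ?V v b" by (simp add: r'_def algebra_simps)
      fix a assume a: "a \<in> {1..Suc m}"
      then show "l a (r' v) = 0" using w[OF v] r(2)[OF v, of a]
        by (cases "a = Suc m") (auto simp: r'_def N_def normalised_def linear_functional_simps[OF lin])
    next
      fix c assume c: "Vector_Spaces.linear s (*) c"
      have "(\<lambda>v. c (r v) + (-1) * (l (Suc m) (r v) * c (w v))) \<in> regular ?X (D b)"
        unfolding w_def
        by (intro regular_add[OF DF] regular_mult[OF DF] r(3) c lin reg m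
            regular_polynomial[OF openD] polynomial_functions.const)
      then show "(\<lambda>v. c (r' v)) \<in> regular ?X (D b)"
        by (simp add: r'_def linear_functional_simps[OF c])
    qed
  qed
  from this[OF order_refl] obtain r where "(\<forall>v\<in>D b. r v - v (Suc b) \<in> ?V v b \<and> (\<forall>a\<in>{1..b}. l a (r v) = 0)) \<and>
      (\<forall>c. Vector_Spaces.linear s (*) c \<longrightarrow> (\<lambda>v. c (r v)) \<in> regular ?X (D b))" by blast
    then have r: "\<And>v. v \<in> D b \<Longrightarrow> r v - v (Suc b) \<in> ?V v b"
      "\<And>v a. v \<in> D b \<Longrightarrow> a \<in> {1..b} \<Longrightarrow> l a (r v) = 0"
      "\<And>c. Vector_Spaces.linear s (*) c \<Longrightarrow> (\<lambda>v. c (r v)) \<in> regular ?X (D b)" by blast+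
  have D_Suc: "v \<in> D (Suc b) \<longleftrightarrow> v \<in> D b \<and> (\<exists>u. N v (Suc b) u)" for v
  proof -
    have ins: "{1..Suc b} = insert (Suc b) {1..b}" by auto
    show ?thesis unfolding D_def ins by blast
  qed
  have V_Suc: "x \<in> ?V v (Suc b) \<longleftrightarrow> (\<exists>c. x - s c (v (Suc b)) \<in> ?V v b)" if "v \<in> ?F" for x v
  proof -
    have "{1..Suc b} = insert (Suc b) {1..b}" by auto
    then show ?thesis using Suc.prems by (auto simp: flag_of_frame_def span_breakdown_eq)
  qed
  have norm: "N v (Suc b) (s (inverse (l (Suc b) (r v))) (r v))"
    if v: "v \<in> D b" and nz: "l (Suc b) (r v) \<noteq> 0" for v
  proof -
    have "r v \<in> ?V v (Suc b)" using r(1)[OF v] V_Suc[of v "r v"] v DF by (metis scale_one subsetD)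
    then show ?thesis
      using r(2)[OF v] nz subspace_flag[OF flag[OF v] Suc.prems]
      by (auto simp: N_def normalised_def linear_functional_simps[OF lin] intro: subspace_scale)
  qed
  have nonzero: "l (Suc b) (r v) \<noteq> 0" if v: "v \<in> D b" and u: "N v (Suc b) u" for v u
  proof
    assume z: "l (Suc b) (r v) = 0"
    have sub: "subspace (?V v b)" using subspace_flag[OF flag[OF v], of b] Suc.prems by simp
    obtain c where c: "u - s c (v (Suc b)) \<in> ?V v b"
      using u V_Suc[of v u] v DF by (auto simp: N_def normalised_def)
    have "(u - s c (v (Suc b))) - s c (r v - v (Suc b)) \<in> ?V v b"
      by (intro subspace_diff[OF sub c] subspace_scale[OF sub] r(1)[OF v])
    then have "u - s c (r v) \<in> ?V v b" by (simp add: algebra_simps)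
    moreover have "\<forall>a\<in>{1..b}. l a (u - s c (r v)) = 0"
      using u r(2)[OF v] by (auto simp: N_def normalised_def linear_functional_simps[OF lin])
    ultimately have "u - s c (r v) = 0"
      using v Suc.prems by (intro normalised_zero[where l=l, OF lin flag[OF v], of b]) (auto simp: D_def N_def)
    then have "l (Suc b) u = c * l (Suc b) (r v)" by (simp add: linear_functional_simps[OF lin])
    then show False using z u by (simp add: N_def normalised_def)
  qed
  have D_eq: "D (Suc b) = {v \<in> D b. l (Suc b) (r v) \<noteq> 0}"
    using D_Suc norm nonzero by blast
  have openD': "openin (zariski ?X) (D (Suc b))"
    unfolding D_eq by (rule openin_regular_nonzero[OF DF r(3)[OF lin]])
  have sub: "D (Suc b) \<subseteq> D b" using D_eq by blast
  have "(\<lambda>v. c (THE u. N v a u)) \<in> regular ?X (D (Suc b))"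
    if a: "a \<in> {1..Suc b}" and c: "Vector_Spaces.linear s (*) c" for a c
  proof (cases "a = Suc b")
    case True
    have "(\<lambda>v. inverse (l (Suc b) (r v)) * c (r v)) \<in> regular ?X (D (Suc b))"
      by (intro regular_mult[OF DF] regular_inverse[OF DF] regular_subset[OF openD' sub DF] r(3) c lin)
        (use D_eq in auto)
    then show ?thesis
    proof (rule regular_cong[OF DF])
      fix v assume v: "v \<in> D (Suc b)"
      then have "(THE u. N v a u) = s (inverse (l (Suc b) (r v))) (r v)"
        using D_eq True Suc.prems by (intro the[OF v]) (auto intro!: norm)
      then show "inverse (l (Suc b) (r v)) * c (r v) = c (THE u. N v a u)"
        by (simp add: linear_functional_simps[OF c])
    qed
  next
    case False
    then show ?thesis using a by (intro regular_subset[OF openD' sub DF] reg c) auto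
  qed
  then show ?case using openD' by blast
qed

text \<open>With functionals dual to \<open>v0\<close> the frame \<open>v0\<close> is its own normal form.  The normal form depends
  only on the flag, and it is defined on a saturated neighbourhood of \<open>v0\<close>.\<close>

lemma flag_of_frame_local_section:
  assumes v0: "v0 \<in> isotropic_frames s \<omega> k"
  shows "\<exists>D \<sigma>. local_section (isotropic_frames s \<omega> k) (frame_coordinates s k) (flag_of_frame s k) v0 D \<sigma>"
proof -
  let ?F = "isotropic_frames s \<omega> k"
  interpret vector_space_pair s "(*)"
    by unfold_locales (auto simp: algebra_simps)
  have inj: "inj_on v0 {1..k}" and ind: "independent (v0 ` {1..k})"
    using v0 by (auto simp: isotropic_frames_def)
  have "\<exists>g. Vector_Spaces.linear s (*) g \<and> (\<forall>x\<in>v0 ` {1..k}. g x = (if x = v0 a then 1 else 0))" for a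
    by (rule linear_independent_extend[OF ind])
  then obtain l where lin: "\<And>a. Vector_Spaces.linear s (*) (l a)"
    and l: "\<And>a x. x \<in> v0 ` {1..k} \<Longrightarrow> l a x = (if x = v0 a then 1 else 0)" by metis
  have l: "l a (v0 b) = (if a = b then 1 else 0)" if "a \<in> {1..k}" "b \<in> {1..k}" for a b
    using l[of "v0 b" a] that inj_on_eq_iff[OF inj, of b a] by auto
  define N where "N v = normalised l (flag_of_frame s k v)" for v
  define D where "D = {v \<in> ?F. \<forall>a\<in>{1..k}. \<exists>u. N v a u}"
  define \<sigma> where "\<sigma> v = (\<lambda>a\<in>{1..k}. THE u. N v a u)" for v
  have flag: "flag_of_frame s k v \<in> isotropic_flags s \<omega> k" if "v \<in> D" for v
    using that flag_of_frame_in_flags by (auto simp: D_def)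
  have the: "(THE u. N v a u) = u" if "v \<in> D" "N v a u" "a \<in> {1..k}" for v a u
    using that normalised_unique[where l=l, OF lin flag[OF that(1)], of a]
    by (intro the_equality) (auto simp: N_def D_def)
  have \<sigma>: "N v a (\<sigma> v a)" if v: "v \<in> D" "a \<in> {1..k}" for v a
  proof -
    obtain u where "N v a u" using v unfolding D_def by blast
    then show ?thesis using the[OF v(1) _ v(2)] v(2) by (simp add: \<sigma>_def)
  qed
  have N0: "N v0 a (v0 a)" if "a \<in> {1..k}" for a
    using l that by (auto simp: N_def normalised_def flag_of_frame_def intro!: span_base)
  have v0D: "v0 \<in> D" using N0 v0 unfolding D_def by blast
  have "\<sigma> v0 = v0"
  proof (rule extensionalityI)
    show "\<sigma> v0 \<in> extensional {1..k}" by (simp add: \<sigma>_def)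
    show "v0 \<in> extensional {1..k}" using v0 by (simp add: isotropic_frames_def)
    fix a assume a: "a \<in> {1..k}"
    then show "\<sigma> v0 a = v0 a" using the[OF v0D N0[OF a] a] by (simp add: \<sigma>_def)
  qed
  moreover have "\<sigma> v \<in> ?F \<and> flag_of_frame s k (\<sigma> v) = flag_of_frame s k v" if v: "v \<in> D" for v
  proof -
    have "\<sigma> v j \<notin> flag_of_frame s k v (j - 1)" if j: "j \<in> {1..k}" for j
    proof
      assume "\<sigma> v j \<in> flag_of_frame s k v (j - 1)"
      then have "\<sigma> v j = 0"
        using j v \<sigma>[OF v j]
        by (intro normalised_zero[where l=l, OF lin flag[OF v], of "j - 1"]) (auto simp: D_def N_def normalised_def)
      then show False using \<sigma>[OF v j] by (simp add: N_def normalised_def linear_functional_simps[OF lin])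
    qed
    moreover have "\<sigma> v j \<in> flag_of_frame s k v j" if j: "j \<in> {1..k}" for j
      using \<sigma>[OF v j] by (simp add: N_def normalised_def)
    moreover have "restrict (\<sigma> v) {1..k} = \<sigma> v" by (simp add: \<sigma>_def)
    ultimately show ?thesis using frame_of_flag[OF flag[OF v], of "\<sigma> v"] by simp
  qed
  moreover have "v' \<in> D \<and> \<sigma> v' = \<sigma> v" if "v \<in> D" "v' \<in> ?F" "flag_of_frame s k v' = flag_of_frame s k v" for v v'
    using that by (simp add: D_def \<sigma>_def N_def)
  moreover have "openin (zariski (frame_variety k)) D"
    "\<And>a c. a \<in> {1..k} \<Longrightarrow> Vector_Spaces.linear s (*) c \<Longrightarrow>
        (\<lambda>v. c (THE u. N v a u)) \<in> regular (frame_variety k) D"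
    using normalised_regular[where l=l, OF lin, of k k] by (auto simp: D_def N_def)
  then have "openin (zariski (frame_variety k)) D"
    "\<forall>c\<in>frame_coordinates s k. (\<lambda>v. c (\<sigma> v)) \<in> regular (frame_variety k) D"
    by (auto simp: frame_coordinates_def \<sigma>_def)
  ultimately show ?thesis unfolding local_section_def using v0D by blast
qed

end

section \<open>Darboux bases\<close>

text \<open>In terms of Darboux families \<open>x, y\<close> and \<open>x', y'\<close> this is the linear map that sends \<open>x a\<close> to
  \<open>x' a\<close> and \<open>y a\<close> to \<open>y' a\<close>: the coefficient of \<open>x a\<close> in \<open>z\<close> is \<open>\<omega> z (y a)\<close>, and that of
  \<open>y a\<close> is \<open>- \<omega> z (x a)\<close>.\<close>

definition darboux_map ::
    "(complex \<Rightarrow> 'b::ab_group_add \<Rightarrow> 'b) \<Rightarrow> ('a \<Rightarrow> 'a \<Rightarrow> complex) \<Rightarrow> nat \<Rightarrow>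
      (nat \<Rightarrow> 'a) \<Rightarrow> (nat \<Rightarrow> 'a) \<Rightarrow> (nat \<Rightarrow> 'b) \<Rightarrow> (nat \<Rightarrow> 'b) \<Rightarrow> 'a \<Rightarrow> 'b" where
  "darboux_map s' \<omega> m x y x' y' z =
     (\<Sum>a=1..m. s' (\<omega> z (y a)) (x' a) - s' (\<omega> z (x a)) (y' a))"

text \<open>Symplectic spaces (\<open>e0 = 0\<close>) and odd symplectic spaces (\<open>e0 \<noteq> 0\<close>) at the same
  time; \<open>dim {e0}\<close> is \<open>0\<close> or \<open>1\<close> accordingly.\<close>

locale skew_space_with_kernel = skew_space s Basis \<omega>
  for s :: "complex \<Rightarrow> 'a::ab_group_add \<Rightarrow> 'a" and Basis and \<omega> +
  fixes e0 :: 'a and n :: nat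
  assumes form_kernel: "form_kernel \<omega> = span {e0}"
    and dim_space: "dim UNIV = 2 * n + dim {e0}"
begin

lemma kernel_iff: "x \<in> span {e0} \<longleftrightarrow> (\<forall>y. \<omega> x y = 0)"
  unfolding form_kernel[symmetric] by (simp add: form_kernel_def)

lemma form_e0 [simp]: "\<omega> e0 y = 0" "\<omega> y e0 = 0"
  using kernel_iff[of e0] skew[of y e0] by (auto simp: span_base)

definition darboux :: "nat \<Rightarrow> (nat \<Rightarrow> 'a) \<Rightarrow> (nat \<Rightarrow> 'a) \<Rightarrow> bool" where
  "darboux m x y \<longleftrightarrow> (\<forall>a\<in>{1..m}. \<forall>b\<in>{1..m}.
     \<omega> (x a) (x b) = 0 \<and> \<omega> (y a) (y b) = 0 \<and> \<omega> (x a) (y b) = (if a = b then 1 else 0))"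

lemma darbouxD:
  assumes "darboux m x y" "a \<in> {1..m}" "b \<in> {1..m}"
  shows "\<omega> (x a) (x b) = 0" "\<omega> (y a) (y b) = 0" "\<omega> (x a) (y b) = (if a = b then 1 else 0)"
    "\<omega> (y a) (x b) = (if a = b then - 1 else 0)"
proof -
  show "\<omega> (x a) (x b) = 0" "\<omega> (y a) (y b) = 0" "\<omega> (x a) (y b) = (if a = b then 1 else 0)"
    using assms unfolding darboux_def by blast+
  have "\<omega> (x b) (y a) = (if b = a then 1 else 0)" using assms unfolding darboux_def by blast
  then show "\<omega> (y a) (x b) = (if a = b then - 1 else 0)" using skew[of "y a" "x b"] by auto
qed

text \<open>Since \<open>x (Suc m)\<close> is independent of the earlier vectors modulo the kernel, its combination
  \<open>u\<close> with them is not in the kernel and pairs nontrivially with some \<open>z\<close>; made orthogonal to the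
  earlier \<open>x\<close> and rescaled, \<open>z\<close> becomes the next dual vector.  The coefficients of \<open>u\<close> are such
  that this correction of \<open>z\<close> turns its pairing with \<open>u\<close> into one with \<open>x (Suc m)\<close>.\<close>

lemma dual_frame_exists:
  fixes x :: "nat \<Rightarrow> 'a"
  assumes "\<And>j. j \<in> {1..m} \<Longrightarrow> x j \<notin> span (insert e0 (x ` {1..<j}))"
  shows "\<exists>y. \<forall>a\<in>{1..m}. \<forall>b\<in>{1..m}. \<omega> (x a) (y b) = (if a = b then 1 else 0)"
  using assms
proof (induction m)
  case (Suc m)
  then obtain y where y: "\<And>a b. a \<in> {1..m} \<Longrightarrow> b \<in> {1..m} \<Longrightarrow> \<omega> (x a) (y b) = (if a = b then 1 else 0)"
    by (metis atLeastAtMost_iff le_Suc_eq)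
  let ?t = "x (Suc m)"
  define u where "u = ?t - (\<Sum>a=1..m. s (\<omega> ?t (y a)) (x a))"
  have "u \<notin> span {e0}"
  proof
    assume "u \<in> span {e0}"
    then have "u \<in> span (insert e0 (x ` {1..m}))" by (rule rev_subsetD[OF _ span_mono]) auto
    moreover have "(\<Sum>a=1..m. s (\<omega> ?t (y a)) (x a)) \<in> span (insert e0 (x ` {1..m}))"
      by (intro span_sum span_scale span_base) auto
    ultimately have "u + (\<Sum>a=1..m. s (\<omega> ?t (y a)) (x a)) \<in> span (insert e0 (x ` {1..m}))"
      by (rule span_add)
    then show False using Suc.prems[of "Suc m"] by (simp add: u_def atLeastLessThanSuc_atLeastAtMost)
  qed
  then obtain z where z: "\<omega> u z \<noteq> 0" using kernel_iff by blast
  define z' where "z' = z - (\<Sum>a=1..m. s (\<omega> (x a) z) (y a))"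
  have z'_x: "\<omega> (x b) z' = 0" if b: "b \<in> {1..m}" for b
  proof -
    have "(\<Sum>a=1..m. \<omega> (x a) z * \<omega> (x b) (y a)) = (\<Sum>a=1..m. if b = a then \<omega> (x a) z else 0)"
      by (rule sum.cong) (use y b in auto)
    also have "\<dots> = \<omega> (x b) z" using b by (simp add: sum.delta')
    finally show ?thesis by (simp add: z'_def)
  qed
  have z'_t: "\<omega> ?t z' = \<omega> u z"
    by (simp add: z'_def u_def mult.commute)
  define w where "w = s (inverse (\<omega> ?t z')) z'"
  have w: "\<omega> ?t w = 1" "\<And>b. b \<in> {1..m} \<Longrightarrow> \<omega> (x b) w = 0"
    using z'_x z'_t z by (auto simp: w_def)
  define y' where "y' b = (if b = Suc m then w else y b - s (\<omega> ?t (y b)) w)" for b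
  have "\<omega> (x a) (y' b) = (if a = b then 1 else 0)" if "a \<in> {1..Suc m}" "b \<in> {1..Suc m}" for a b
  proof (cases "a = Suc m"; cases "b = Suc m")
    assume "a \<noteq> Suc m" "b \<noteq> Suc m"
    then have "a \<in> {1..m}" "b \<in> {1..m}" using that by auto
    then show ?thesis using y[of a b] w(2)[of a] \<open>b \<noteq> Suc m\<close> by (simp add: y'_def)
  next
    assume "a \<noteq> Suc m" "b = Suc m"
    then have "a \<in> {1..m}" using that by auto
    then show ?thesis using w(2)[of a] \<open>b = Suc m\<close> \<open>a \<noteq> Suc m\<close> by (simp add: y'_def)
  qed (use w(1) in \<open>auto simp: y'_def\<close>)
  then show ?case by blast
qed simp

text \<open>Adding \<open>- \<omega> (y b) (y c) / 2\<close> times \<open>x c\<close> to each \<open>y b\<close> makes dual vectors orthogonal to each other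
  and does not affect their pairings with the isotropic family \<open>x\<close>.\<close>

lemma darboux_extend:
  assumes iso: "\<And>a b. a \<in> {1..m} \<Longrightarrow> b \<in> {1..m} \<Longrightarrow> \<omega> (x a) (x b) = 0"
    and ind: "\<And>j. j \<in> {1..m} \<Longrightarrow> x j \<notin> span (insert e0 (x ` {1..<j}))"
  shows "\<exists>y. darboux m x y"
proof -
  obtain y where y: "\<And>a b. a \<in> {1..m} \<Longrightarrow> b \<in> {1..m} \<Longrightarrow> \<omega> (x a) (y b) = (if a = b then 1 else 0)"
    using dual_frame_exists[OF ind] by blast
  have y_sym: "\<omega> (y a) (x b) = (if b = a then - 1 else 0)" if "a \<in> {1..m}" "b \<in> {1..m}" for a b
    using skew[of "y a" "x b"] y[OF that(2,1)] by auto
  define t where "t a b = - (\<omega> (y a) (y b) / 2)" for a b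
  define y' where "y' b = y b + (\<Sum>c=1..m. s (t b c) (x c))" for b
  have xy': "\<omega> (x a) (y' b) = (if a = b then 1 else 0)" if a: "a \<in> {1..m}" and b: "b \<in> {1..m}" for a b
    using y[OF a b] iso[OF a] by (simp add: y'_def)
  have "\<omega> (y' a) (y' b) = 0" if a: "a \<in> {1..m}" and b: "b \<in> {1..m}" for a b
  proof -
    have "(\<Sum>c=1..m. t b c * \<omega> (y a) (x c)) = (\<Sum>c=1..m. if c = a then - t b c else 0)"
      by (rule sum.cong) (use y_sym a in auto)
    then have 1: "(\<Sum>c=1..m. t b c * \<omega> (y a) (x c)) = - t b a" using a by (simp add: sum.delta)
    have "(\<Sum>c=1..m. t a c * \<omega> (x c) (y' b)) = (\<Sum>c=1..m. if c = b then t a c else 0)"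
      by (rule sum.cong) (use xy' b in auto)
    then have 2: "(\<Sum>c=1..m. t a c * \<omega> (x c) (y' b)) = t a b" using b by (simp add: sum.delta)
    have "\<omega> (y' a) (y' b) = \<omega> (y a) (y' b) + (\<Sum>c=1..m. t a c * \<omega> (x c) (y' b))"
      by (simp add: y'_def[of a])
    also have "\<dots> = \<omega> (y a) (y b) - t b a + t a b"
      using 1 2 by (simp add: y'_def)
    also have "\<dots> = 0" using skew[of "y b" "y a"] by (simp add: t_def)
    finally show ?thesis .
  qed
  then have "darboux m x y'" unfolding darboux_def using xy' iso by blast
  then show ?thesis by blast
qed

text \<open>The component of \<open>z\<close> orthogonal to a Darboux family.\<close>

definition remainder :: "nat \<Rightarrow> (nat \<Rightarrow> 'a) \<Rightarrow> (nat \<Rightarrow> 'a) \<Rightarrow> 'a \<Rightarrow> 'a" where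
  "remainder m x y z = z - darboux_map s \<omega> m x y x y z"

lemma darboux_map_self:
  assumes D: "darboux m x y" and b: "b \<in> {1..m}"
  shows "\<omega> (darboux_map s \<omega> m x y x y z) (x b) = \<omega> z (x b)"
    and "\<omega> (darboux_map s \<omega> m x y x y z) (y b) = \<omega> z (y b)"
proof -
  have "\<omega> (darboux_map s \<omega> m x y x y z) (x b) = (\<Sum>a=1..m. if a = b then \<omega> z (x a) else 0)"
    unfolding darboux_map_def form_sum by (rule sum.cong) (use darbouxD[OF D _ b] in auto)
  then show "\<omega> (darboux_map s \<omega> m x y x y z) (x b) = \<omega> z (x b)" using b by (simp add: sum.delta)
  have "\<omega> (darboux_map s \<omega> m x y x y z) (y b) = (\<Sum>a=1..m. if a = b then \<omega> z (y a) else 0)"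
    unfolding darboux_map_def form_sum by (rule sum.cong) (use darbouxD[OF D _ b] in auto)
  then show "\<omega> (darboux_map s \<omega> m x y x y z) (y b) = \<omega> z (y b)" using b by (simp add: sum.delta)
qed

lemma remainder_orthogonal:
  assumes "darboux m x y" "b \<in> {1..m}"
  shows "\<omega> (remainder m x y z) (x b) = 0" "\<omega> (remainder m x y z) (y b) = 0"
  using darboux_map_self[OF assms] by (auto simp: remainder_def)

lemma remainder_linear: "Vector_Spaces.linear s s (remainder m x y)"
  unfolding Vector_Spaces.linear_iff remainder_def darboux_map_def
  by (auto simp: vector_space_axioms algebra_simps sum.distrib sum_subtractf scale_sum_right)

lemma remainder_e0: "remainder m x y e0 = e0"
  by (simp add: remainder_def darboux_map_def)

lemma remainder_basis:
  assumes D: "darboux m x y" and b: "b \<in> {1..m}"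
  shows "remainder m x y (x b) = 0" "remainder m x y (y b) = 0"
proof -
  have "darboux_map s \<omega> m x y x y (x b) = (\<Sum>a=1..m. if a = b then x a else 0)"
    unfolding darboux_map_def by (rule sum.cong) (use darbouxD[OF D b] in auto)
  then show "remainder m x y (x b) = 0" using b by (simp add: sum.delta remainder_def)
  have "darboux_map s \<omega> m x y x y (y b) = (\<Sum>a=1..m. if a = b then y a else 0)"
    unfolding darboux_map_def by (rule sum.cong) (use darbouxD[OF D b] in auto)
  then show "remainder m x y (y b) = 0" using b by (simp add: sum.delta remainder_def)
qed

lemma darboux_independent:
  assumes D: "darboux m x y" and j: "j \<in> {1..m}"
  shows "x j \<notin> span (insert e0 (x ` {1..<j}))"
proof
  assume "x j \<in> span (insert e0 (x ` {1..<j}))"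
  then have "\<omega> (x j) (y j) = 0"
    by (rule orthogonal_span) (use darbouxD(3)[OF D _ j] j in auto)
  then show False using darbouxD(3)[OF D j j] by simp
qed

text \<open>A remainder outside the kernel extends \<open>x\<close> to a longer isotropic family.  It is independent of
  \<open>x\<close> modulo the kernel because taking remainders fixes it but sends \<open>x\<close> to zero and fixes the
  kernel.\<close>

lemma darboux_step:
  assumes D: "darboux m x y" and r: "remainder m x y z \<notin> span {e0}"
  shows "\<exists>x' y'. darboux (Suc m) x' y'"
proof -
  let ?r = "remainder m x y z"
  define x' where "x' j = (if j = Suc m then ?r else x j)" for j
  have img: "x' ` {1..m} = x ` {1..m}" by (auto simp: x'_def)
  have new: "?r \<notin> span (insert e0 (x ` {1..m}))"
  proof
    assume "?r \<in> span (insert e0 (x ` {1..m}))"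
    moreover have "subspace {w. remainder m x y w \<in> span {e0}}"
      using remainder_linear[of m x y]
      by (auto simp: subspace_def Vector_Spaces.linear_iff span_add span_scale
          intro: span_add span_scale) (metis scale_zero_left span_zero)
    moreover have "insert e0 (x ` {1..m}) \<subseteq> {w. remainder m x y w \<in> span {e0}}"
      using remainder_basis(1)[OF D] by (auto simp: remainder_e0 span_base span_zero)
    ultimately have "remainder m x y ?r \<in> span {e0}" using span_minimal by blast
    moreover have "remainder m x y ?r = ?r"
    proof -
      have "darboux_map s \<omega> m x y x y ?r = 0"
        unfolding darboux_map_def using remainder_orthogonal[OF D] by (intro sum.neutral) auto
      then show ?thesis by (metis remainder_def diff_zero)
    qed
    ultimately show False using r by simp
  qed
  have "x' j \<notin> span (insert e0 (x' ` {1..<j}))" if j: "j \<in> {1..Suc m}" for j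
  proof (cases "j = Suc m")
    case True
    then show ?thesis using new img by (simp add: atLeastLessThanSuc_atLeastAtMost x'_def)
  next
    case False
    then have "x' ` {1..<j} = x ` {1..<j}" using j by (auto simp: x'_def)
    then show ?thesis using darboux_independent[OF D, of j] j False by (simp add: x'_def)
  qed
  moreover have "\<omega> (x' a) (x' b) = 0" if "a \<in> {1..Suc m}" "b \<in> {1..Suc m}" for a b
    using that darbouxD(1)[OF D, of a b] remainder_orthogonal(1)[OF D, of a z]
      remainder_orthogonal(1)[OF D, of b z] skew[of "x a" ?r]
    by (auto simp: x'_def le_Suc_eq)
  ultimately show ?thesis using darboux_extend[of "Suc m" x'] by blast
qed

text \<open>The \<open>2 m\<close> vectors of a Darboux family are independent modulo the kernel, as each of them is
  detected by its partner.\<close>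

lemma darboux_le:
  assumes D: "darboux m x y"
  shows "m \<le> n"
proof -
  define v where "v j = (if j \<le> m then x j else y (j - m))" for j
  have "v j \<notin> span ({e0} \<union> v ` {1..<j})" if j: "j \<in> {1..2 * m}" for j
  proof (cases "j \<le> m")
    case True
    then have "v ` {1..<j} = x ` {1..<j}" by (auto simp: v_def)
    then show ?thesis using darboux_independent[OF D, of j] True j by (simp add: v_def)
  next
    case False
    then have jm: "j - m \<in> {1..m}" using j by auto
    show ?thesis
    proof
      assume "v j \<in> span ({e0} \<union> v ` {1..<j})"
      then have "\<omega> (v j) (x (j - m)) = 0"
      proof (rule orthogonal_span)
        fix z assume "z \<in> {e0} \<union> v ` {1..<j}"
        then consider "z = e0" | i where "i \<in> {1..<j}" "z = v i" by blast
        then show "\<omega> z (x (j - m)) = 0"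
        proof cases
          case (2 i)
          show ?thesis
          proof (cases "i \<le> m")
            case True
            then show ?thesis using 2 darbouxD(1)[OF D _ jm, of i] by (simp add: v_def)
          next
            case i: False
            then have "i - m \<in> {1..m}" "i - m \<noteq> j - m" using 2 j by auto
            then show ?thesis using 2 i darbouxD(4)[OF D _ jm, of "i - m"] by (simp add: v_def)
          qed
        qed simp
      qed
      then show False using darbouxD(4)[OF D jm jm] False by (simp add: v_def)
    qed
  qed
  then have "dim ({e0} \<union> v ` {1..2 * m}) = dim {e0} + 2 * m" by (rule dim_Un_successive)
  moreover have "dim ({e0} \<union> v ` {1..2 * m}) \<le> dim UNIV" by (rule dim_subset) simp
  ultimately show ?thesis using dim_space by linarith
qed

text \<open>Otherwise the family could be prolonged beyond the bound given by the dimension.\<close>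

lemma remainder_in_kernel:
  assumes "darboux n x y"
  shows "remainder n x y z \<in> span {e0}"
  using darboux_step[OF assms] darboux_le[of "Suc n"] by fastforce

text \<open>As long as \<open>m < n\<close>, a Darboux family and the kernel together have too few vectors to span the
  space, so some remainder lies outside the kernel.\<close>

lemma darboux_exists: "\<exists>x y. darboux n x y"
proof -
  have "\<exists>x y. darboux m x y" if "m \<le> n" for m
    using that
  proof (induction m)
    case 0
    show ?case by (simp add: darboux_def)
  next
    case (Suc m)
    then obtain x y where D: "darboux m x y" by auto
    have "\<exists>z. remainder m x y z \<notin> span {e0}"
    proof (rule ccontr)
      assume "\<nexists>z. remainder m x y z \<notin> span {e0}"
      then have r: "remainder m x y z \<in> span {e0}" for z by blast
      let ?S = "insert e0 (x ` {1..m} \<union> y ` {1..m})"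
      have "z \<in> span ?S" for z
      proof -
        have "remainder m x y z \<in> span ?S" using r[of z] span_mono[of "{e0}" ?S] by auto
        moreover have "darboux_map s \<omega> m x y x y z \<in> span ?S"
          unfolding darboux_map_def by (intro span_sum span_diff span_scale span_base) auto
        ultimately have "remainder m x y z + darboux_map s \<omega> m x y x y z \<in> span ?S" by (rule span_add)
        then show ?thesis by (simp add: remainder_def)
      qed
      then have "dim UNIV \<le> card ?S" by (intro dim_le_card) auto
      also have "\<dots> \<le> Suc (card (x ` {1..m} \<union> y ` {1..m}))" by (simp add: card_insert_le_m1 card_insert_if)
      also have "\<dots> \<le> Suc (card (x ` {1..m}) + card (y ` {1..m}))" using card_Un_le by auto
      also have "\<dots> \<le> Suc (m + m)"
        using card_image_le[of "{1..m}" x] card_image_le[of "{1..m}" y] by simp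
      finally show False using dim_space Suc.prems by linarith
    qed
    then show ?case using darboux_step[OF D] by blast
  qed
  then show ?thesis by blast
qed

text \<open>The coordinate along \<open>e0\<close> in the basis that consists of \<open>e0\<close> and a Darboux family.\<close>

lemma kernel_coordinate:
  assumes e0: "e0 \<noteq> 0" and D: "darboux n x y"
  shows "\<exists>\<mu>. Vector_Spaces.linear s (*) \<mu> \<and> \<mu> e0 = 1 \<and>
    (\<forall>z. z = darboux_map s \<omega> n x y x y z + s (\<mu> z) e0) \<and> (\<forall>a\<in>{1..n}. \<mu> (x a) = 0 \<and> \<mu> (y a) = 0)"
proof -
  interpret vector_space_pair s "(*)"
    by unfold_locales (auto simp: algebra_simps)
  have "independent {e0}" using e0 by simp
  then obtain \<nu> where \<nu>: "Vector_Spaces.linear s (*) \<nu>" "\<nu> e0 = 1"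
    using linear_independent_extend[of "{e0}" "\<lambda>_. 1"] by auto
  define \<mu> where "\<mu> z = \<nu> (remainder n x y z)" for z
  have "Vector_Spaces.linear s (*) \<mu>"
    using \<nu>(1) remainder_linear[of n x y] unfolding \<mu>_def Vector_Spaces.linear_iff by simp
  moreover have "remainder n x y z = s (\<mu> z) e0" for z
  proof -
    obtain c where "remainder n x y z = s c e0"
      using remainder_in_kernel[OF D, of z] by (auto simp: span_singleton)
    then show ?thesis using \<nu> unfolding \<mu>_def by (simp add: linear_functional_simps[OF \<nu>(1)])
  qed
  then have "z = darboux_map s \<omega> n x y x y z + s (\<mu> z) e0" for z
    by (metis remainder_def add.commute diff_add_cancel)
  moreover have "\<mu> (x a) = 0 \<and> \<mu> (y a) = 0" if "a \<in> {1..n}" for a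
    using remainder_basis[OF D that] linear_functional_simps(3)[OF \<nu>(1)] by (simp add: \<mu>_def)
  moreover have "\<mu> e0 = 1" using \<nu> by (simp add: \<mu>_def remainder_e0)
  ultimately show ?thesis by blast
qed

end

locale skew_space_pair =
  E: skew_space_with_kernel s Basis \<omega> e0 n + F: skew_space_with_kernel s' Basis' \<sigma> f0 n
  for s :: "complex \<Rightarrow> 'a::ab_group_add \<Rightarrow> 'a" and Basis \<omega> e0 n
    and s' :: "complex \<Rightarrow> 'b::ab_group_add \<Rightarrow> 'b" and Basis' \<sigma> f0
begin

lemma darboux_map_linear: "Vector_Spaces.linear s s' (darboux_map s' \<omega> m x y x' y')"
  unfolding Vector_Spaces.linear_iff darboux_map_def
  by (auto simp: E.vector_space_axioms F.vector_space_axioms algebra_simps sum.distrib sum_subtractf F.scale_sum_right)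

lemma darboux_map_pairing:
  assumes D: "F.darboux m x' y'" and b: "b \<in> {1..m}"
  shows "\<sigma> (darboux_map s' \<omega> m x y x' y' z) (x' b) = \<omega> z (x b)"
    and "\<sigma> (darboux_map s' \<omega> m x y x' y' z) (y' b) = \<omega> z (y b)"
proof -
  have "\<sigma> (darboux_map s' \<omega> m x y x' y' z) (x' b) = (\<Sum>a=1..m. if a = b then \<omega> z (x a) else 0)"
    unfolding darboux_map_def F.form_sum by (rule sum.cong) (use F.darbouxD[OF D _ b] in auto)
  then show "\<sigma> (darboux_map s' \<omega> m x y x' y' z) (x' b) = \<omega> z (x b)" using b by (simp add: sum.delta)
  have "\<sigma> (darboux_map s' \<omega> m x y x' y' z) (y' b) = (\<Sum>a=1..m. if a = b then \<omega> z (y a) else 0)"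
    unfolding darboux_map_def F.form_sum by (rule sum.cong) (use F.darbouxD[OF D _ b] in auto)
  then show "\<sigma> (darboux_map s' \<omega> m x y x' y' z) (y' b) = \<omega> z (y b)" using b by (simp add: sum.delta)
qed

lemma darboux_map_back:
  assumes D: "F.darboux m x' y'"
  shows "darboux_map s \<sigma> m x' y' x y (darboux_map s' \<omega> m x y x' y' z) = darboux_map s \<omega> m x y x y z"
  unfolding darboux_map_def[of s \<sigma>] darboux_map_def[of s \<omega>]
  by (rule sum.cong) (simp_all add: darboux_map_pairing[OF D])

lemma darboux_map_basis:
  assumes D: "E.darboux m x y" and b: "b \<in> {1..m}"
  shows "darboux_map s' \<omega> m x y x' y' (x b) = x' b"
proof -
  have "darboux_map s' \<omega> m x y x' y' (x b) = (\<Sum>a=1..m. if a = b then x' a else 0)"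
    unfolding darboux_map_def by (rule sum.cong) (use E.darbouxD[OF D b] in auto)
  then show ?thesis using b by (simp add: sum.delta)
qed

text \<open>The two sides agree because replacing \<open>z'\<close> by its component in the Darboux family only drops
  a vector of the kernel.\<close>

lemma darboux_map_isometry:
  assumes D: "E.darboux n x y" and D': "F.darboux n x' y'"
  shows "\<sigma> (darboux_map s' \<omega> n x y x' y' z) (darboux_map s' \<omega> n x y x' y' z') = \<omega> z z'"
proof -
  have "\<sigma> (darboux_map s' \<omega> n x y x' y' z) (darboux_map s' \<omega> n x y x' y' z') =
      \<omega> z (darboux_map s \<omega> n x y x y z')"
    unfolding darboux_map_def[of s' \<omega> n x y x' y' z'] darboux_map_def[of s \<omega> n x y x y z']
    by (simp add: darboux_map_pairing[OF D'])
  also have "\<dots> = \<omega> z z'"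
  proof -
    have "\<omega> (E.remainder n x y z') z = 0"
      using E.remainder_in_kernel[OF D] E.kernel_iff by blast
    then have "\<omega> z (E.remainder n x y z') = 0" using E.skew[of z "E.remainder n x y z'"] by simp
    then show ?thesis by (simp add: E.remainder_def)
  qed
  finally show ?thesis .
qed

end

section \<open>Odd symplectic flags over symplectic flags\<close>

text \<open>The increasing enumeration of the natural numbers other than \<open>i\<close>.\<close>

definition skip :: "nat \<Rightarrow> nat \<Rightarrow> nat" where
  "skip i j = (if j < i then j else Suc j)"

text \<open>The space \<open>p\<close> maps to is the quotient of \<open>E\<close> by its kernel line, up to an isometry;
  \<open>\<iota>\<close> is a linear section of \<open>p\<close> and \<open>\<kappa>\<close> the coordinate along \<open>e0\<close> of the resulting
  splitting.\<close>

locale odd_symplectic_projection =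
  skew_space_pair s Basis \<omega> e0 n s' Basis' \<sigma> "0 :: 'b"
  for s :: "complex \<Rightarrow> 'a::ab_group_add \<Rightarrow> 'a" and Basis \<omega> e0 n
    and s' :: "complex \<Rightarrow> 'b::ab_group_add \<Rightarrow> 'b" and Basis' \<sigma> +
  fixes p :: "'a \<Rightarrow> 'b" and \<iota> :: "'b \<Rightarrow> 'a" and \<kappa> :: "'a \<Rightarrow> complex"
  assumes p_linear: "Vector_Spaces.linear s s' p"
    and \<iota>_linear: "Vector_Spaces.linear s' s \<iota>"
    and \<kappa>_linear: "Vector_Spaces.linear s (*) \<kappa>"
    and p_\<iota> [simp]: "p (\<iota> w) = w"
    and \<kappa>_\<iota> [simp]: "\<kappa> (\<iota> w) = 0"
    and \<kappa>_e0 [simp]: "\<kappa> e0 = 1"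
    and split: "z = \<iota> (p z) + s (\<kappa> z) e0"
    and p_isometry: "\<sigma> (p z) (p z') = \<omega> z z'"

text \<open>Darboux families of the same length on both sides provide maps in both directions that
  preserve the forms.\<close>

lemma (in skew_space_pair) odd_symplectic_projection_exists:
  assumes "e0 \<noteq> 0" and f0: "f0 = 0"
  shows "\<exists>p \<iota> \<kappa>. odd_symplectic_projection s Basis \<omega> e0 n s' Basis' \<sigma> p \<iota> \<kappa>"
proof -
  interpret inverse: skew_space_pair s' Basis' \<sigma> f0 n s Basis \<omega> e0
    by unfold_locales
  obtain x y where D: "E.darboux n x y" using E.darboux_exists by blast
  obtain x' y' where D': "F.darboux n x' y'" using F.darboux_exists by blast
  obtain \<mu> where \<mu>: "Vector_Spaces.linear s (*) \<mu>" "\<mu> e0 = 1"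
    "\<And>z. z = darboux_map s \<omega> n x y x y z + s (\<mu> z) e0"
    using E.kernel_coordinate[OF assms(1) D] by blast
  let ?p = "darboux_map s' \<omega> n x y x' y'" and ?i = "darboux_map s \<sigma> n x' y' x y"
  have "F.remainder n x' y' w = 0" for w
    using F.remainder_in_kernel[OF D', of w] f0 by simp
  then have pi: "?p (?i w) = w" for w
    using inverse.darboux_map_back[OF D, of x' y' w] by (simp add: F.remainder_def)
  have \<mu>i: "\<mu> (?i w) = 0" for w
  proof -
    have "darboux_map s \<omega> n x y x y (?i w) = ?i w"
      using darboux_map_back[OF D', of x y "?i w"] pi by simp
    then have "s (\<mu> (?i w)) e0 = 0" using \<mu>(3)[of "?i w"] by simp
    then show ?thesis using assms(1) by simp
  qed
  have "odd_symplectic_projection s Basis \<omega> e0 n s' Basis' \<sigma> ?p ?i \<mu>"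
  proof (intro odd_symplectic_projection.intro odd_symplectic_projection_axioms.intro)
    show "skew_space_pair s Basis \<omega> e0 n s' Basis' \<sigma> 0" using skew_space_pair_axioms f0 by simp
    show "z = ?i (?p z) + s (\<mu> z) e0" for z
      using \<mu>(3)[of z] darboux_map_back[OF D', of x y z] by simp
  qed (use \<mu> \<mu>i pi darboux_map_linear inverse.darboux_map_linear darboux_map_isometry[OF D D'] in auto)
  then show ?thesis by blast
qed

context odd_symplectic_projection
begin

lemma p_simps [simp]: "p (x + y) = p x + p y" "p (s c x) = s' c (p x)" "p 0 = 0" "p (x - y) = p x - p y"
proof -
  show add: "p (x + y) = p x + p y" for x y using p_linear by (simp add: Vector_Spaces.linear_iff)
  show "p (s c x) = s' c (p x)" for c x using p_linear by (simp add: Vector_Spaces.linear_iff)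
  show "p 0 = 0" using add[of 0 0] by simp
  show "p (x - y) = p x - p y" using add[of "x - y" y] by simp
qed

lemma \<iota>_simps [simp]: "\<iota> (x + y) = \<iota> x + \<iota> y" "\<iota> (s' c x) = s c (\<iota> x)" "\<iota> 0 = 0"
proof -
  show add: "\<iota> (x + y) = \<iota> x + \<iota> y" for x y using \<iota>_linear by (simp add: Vector_Spaces.linear_iff)
  show "\<iota> (s' c x) = s c (\<iota> x)" for c x using \<iota>_linear by (simp add: Vector_Spaces.linear_iff)
  show "\<iota> 0 = 0" using add[of 0 0] by simp
qed

lemmas \<kappa>_simps [simp] = E.linear_functional_simps[OF \<kappa>_linear]

lemma p_e0 [simp]: "p e0 = 0"
  using split[of e0] p_\<iota>[of "p e0"] by simp

lemma p_zeroD: "p z = 0 \<Longrightarrow> z = s (\<kappa> z) e0"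
  using split[of z] by simp

lemma p_span: "p ` E.span S = F.span (p ` S)"
  using module_hom.span_image[of s s' p S] p_linear by (simp add: module_hom_iff_linear)

text \<open>The kernel of \<open>p\<close> is the line of \<open>e0\<close>.\<close>

lemma p_injective:
  assumes V: "E.subspace V" "e0 \<notin> V" and xy: "x \<in> V" "y \<in> V" "p x = p y"
  shows "x = y"
proof -
  have xy0: "x - y = s (\<kappa> (x - y)) e0" using xy by (intro p_zeroD) simp
  have "\<kappa> (x - y) = 0"
  proof (rule ccontr)
    assume nz: "\<kappa> (x - y) \<noteq> 0"
    have "s (inverse (\<kappa> (x - y))) (x - y) \<in> V"
      using xy by (intro E.subspace_scale[OF V(1)] E.subspace_diff[OF V(1)])
    moreover have "s (inverse (\<kappa> (x - y))) (x - y) = e0"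
      by (subst (2) xy0) (use nz in simp)
    ultimately show False using V by simp
  qed
  then show ?thesis using xy0 by simp
qed

text \<open>Over a frame of \<open>W\<close> and a functional \<open>\<phi>\<close> on \<open>W (i - 1)\<close> sits a frame with \<open>e0\<close> in position
  \<open>i\<close>, whose earlier members are taken on the graph of \<open>\<phi>\<close>.  The later ones matter only modulo
  \<open>e0\<close>, so the section \<open>\<iota>\<close> may be used for them.\<close>

definition lift_frame :: "nat \<Rightarrow> (nat \<Rightarrow> 'b) \<Rightarrow> ('b \<Rightarrow> complex) \<Rightarrow> nat \<Rightarrow> 'a" where
  "lift_frame i w \<phi> = (\<lambda>j\<in>{1..n + 1}.
     if j < i then \<iota> (w j) + s (\<phi> (w j)) e0 else if j = i then e0 else \<iota> (w (j - 1)))"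

definition project_frame :: "nat \<Rightarrow> (nat \<Rightarrow> 'a) \<Rightarrow> nat \<Rightarrow> 'b" where
  "project_frame i v = (\<lambda>j\<in>{1..n}. p (v (skip i j)))"

text \<open>A subspace \<open>V\<close> that does not contain \<open>e0\<close> is the graph, over its image, of the functional
  that returns the \<open>e0\<close>-coordinate of the unique preimage in \<open>V\<close>.\<close>

definition graph_functional :: "'a set \<Rightarrow> 'b \<Rightarrow> complex" where
  "graph_functional V = (\<lambda>x\<in>p ` V. \<kappa> (inv_into V p x))"

abbreviation "frames\<^sub>E \<equiv> isotropic_frames s \<omega> (n + 1)"
abbreviation "frames\<^sub>F \<equiv> isotropic_frames s' \<sigma> n"
abbreviation "flag\<^sub>E \<equiv> flag_of_frame s (n + 1)"
abbreviation "flag\<^sub>F \<equiv> flag_of_frame s' n"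
abbreviation "orbit\<^sub>E \<equiv> odd_orbit n s \<omega> e0"
abbreviation "framed_dual i \<equiv>
  SIGMA w : frames\<^sub>F. dual_of_subspace s' (F.span (w ` {1..i - 1}))"

lemma graph_functional_apply:
  assumes "E.subspace V" "e0 \<notin> V" "z \<in> V"
  shows "graph_functional V (p z) = \<kappa> z"
proof -
  have "inj_on p V" using p_injective[OF assms(1,2)] by (auto intro: inj_onI)
  then show ?thesis using assms(3) by (simp add: graph_functional_def)
qed

lemma graph_functional_dual:
  assumes V: "E.subspace V" "e0 \<notin> V"
  shows "graph_functional V \<in> dual_of_subspace s' (p ` V)"
  unfolding dual_of_subspace_def
proof (intro CollectI conjI ballI allI)
  show "graph_functional V \<in> extensional (p ` V)" by (simp add: graph_functional_def)
  fix x assume "x \<in> p ` V"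
  then obtain x0 where x0: "x0 \<in> V" "x = p x0" by blast
  show "graph_functional V (s' c x) = c * graph_functional V x" for c
    using graph_functional_apply[OF V, of "s c x0"] graph_functional_apply[OF V, of x0] x0
      E.subspace_scale[OF V(1)] by simp
  fix y assume "y \<in> p ` V"
  then obtain y0 where y0: "y0 \<in> V" "y = p y0" by blast
  show "graph_functional V (x + y) = graph_functional V x + graph_functional V y"
    using graph_functional_apply[OF V, of "x0 + y0"] graph_functional_apply[OF V, of x0]
      graph_functional_apply[OF V, of y0] x0 y0 E.subspace_add[OF V(1)] by simp
qed

lemma flag_in_orbit_iff:
  assumes "v \<in> frames\<^sub>E" "i \<in> {1..n + 1}"
  shows "flag\<^sub>E v \<in> orbit\<^sub>E i \<longleftrightarrow> e0 \<in> E.span (v ` {1..i}) \<and> e0 \<notin> E.span (v ` {1..i - 1})"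
  using assms E.flag_of_frame_in_flags[OF assms(1)]
  by (auto simp: odd_orbit_def flag_of_frame_def)

lemma dual_simps:
  assumes "\<phi> \<in> dual_of_subspace s' W"
  shows "x \<in> W \<Longrightarrow> y \<in> W \<Longrightarrow> \<phi> (x + y) = \<phi> x + \<phi> y" "x \<in> W \<Longrightarrow> \<phi> (s' c x) = c * \<phi> x"
  using assms by (auto simp: dual_of_subspace_def)

lemma lift_frame_coordinates:
  assumes "j \<in> {1..n + 1}"
  shows "p (lift_frame i w \<phi> j) = (if j < i then w j else if j = i then 0 else w (j - 1))"
    and "\<kappa> (lift_frame i w \<phi> j) = (if j < i then \<phi> (w j) else if j = i then 1 else 0)"
  using assms by (auto simp: lift_frame_def)

lemma lift_frame_graph:
  assumes i: "i \<in> {1..n + 1}" "j \<le> i" and \<phi>: "\<phi> \<in> dual_of_subspace s' (F.span (w ` {1..i - 1}))"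
    and x: "x \<in> E.span (lift_frame i w \<phi> ` {1..<j})"
  shows "p x \<in> F.span (w ` {1..<j}) \<and> \<kappa> x = \<phi> (p x)"
proof -
  let ?G = "{x. p x \<in> F.span (w ` {1..<j}) \<and> \<kappa> x = \<phi> (p x)}"
  have sub: "F.span (w ` {1..<j}) \<subseteq> F.span (w ` {1..i - 1})"
    by (rule F.span_mono) (use i in auto)
  have "\<phi> 0 = 0" using dual_simps(2)[OF \<phi>, of 0 0] by (simp add: F.span_zero)
  then have "E.subspace ?G"
    unfolding E.subspace_def using dual_simps[OF \<phi>] sub
    by (auto simp: F.span_zero F.span_add F.span_scale subset_iff)
  moreover have "lift_frame i w \<phi> ` {1..<j} \<subseteq> ?G"
    using i by (auto simp: lift_frame_coordinates intro!: F.span_base)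
  ultimately show ?thesis using x E.span_minimal by blast
qed

text \<open>Before position \<open>i\<close> and after it, independence is inherited from \<open>w\<close> through \<open>p\<close>; at position
  \<open>i\<close> it holds because a graph meets the line of \<open>e0\<close> in \<open>0\<close> only.\<close>

lemma lift_frame_in:
  assumes i: "i \<in> {1..n + 1}" and w: "w \<in> frames\<^sub>F"
    and \<phi>: "\<phi> \<in> dual_of_subspace s' (F.span (w ` {1..i - 1}))"
  shows "lift_frame i w \<phi> \<in> frames\<^sub>E" "flag\<^sub>E (lift_frame i w \<phi>) \<in> orbit\<^sub>E i"
proof -
  let ?u = "lift_frame i w \<phi>"
  have w_ind: "\<And>j. j \<in> {1..n} \<Longrightarrow> w j \<notin> F.span (w ` {1..<j})"
    and w_iso: "\<And>a b. a \<in> {1..n} \<Longrightarrow> b \<in> {1..n} \<Longrightarrow> \<sigma> (w a) (w b) = 0"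
    using w by (auto simp: F.isotropic_frames_iff)
  have \<phi>0: "\<phi> 0 = 0" using dual_simps(2)[OF \<phi>, of 0 0] by (simp add: F.span_zero)
  have e0_notin: "e0 \<notin> E.span (?u ` {1..<i})"
    using lift_frame_graph[OF i order_refl \<phi>, of e0] \<phi>0 by auto
  show frame: "?u \<in> frames\<^sub>E"
    unfolding E.isotropic_frames_iff
  proof (intro conjI ballI)
    show "?u \<in> extensional {1..n + 1}" by (simp add: lift_frame_def)
    fix j assume j: "j \<in> {1..n + 1}"
    consider "j < i" | "j = i" | "i < j" by linarith
    then show "?u j \<notin> E.span (?u ` {1..<j})"
    proof cases
      case 1
      then show ?thesis using lift_frame_graph[OF i _ \<phi>, of j "?u j"] lift_frame_coordinates(1)[OF j]
        w_ind[of j] i j by auto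
    next
      case 2
      then have "?u j = e0" using j by (simp add: lift_frame_def)
      then show ?thesis using e0_notin 2 by simp
    next
      case 3
      have "E.subspace {x. p x \<in> F.span (w ` {1..<j - 1})}"
        by (auto simp: E.subspace_def F.span_zero F.span_add F.span_scale)
      moreover have "?u ` {1..<j} \<subseteq> {x. p x \<in> F.span (w ` {1..<j - 1})}"
      proof
        fix x assume "x \<in> ?u ` {1..<j}"
        then obtain m where m: "m \<in> {1..<j}" "x = ?u m" by blast
        then have pm: "p x = (if m < i then w m else if m = i then 0 else w (m - 1))"
          using lift_frame_coordinates(1)[of m i w \<phi>] j by auto
        consider "m < i" | "m = i" | "i < m" by linarith
        then show "x \<in> {x. p x \<in> F.span (w ` {1..<j - 1})}"
        proof cases
          case 1
          then have "w m \<in> w ` {1..<j - 1}" using m 3 by (intro imageI) auto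
          then show ?thesis using pm 1 by (simp add: F.span_base)
        next
          case 2
          then show ?thesis using pm by (simp add: F.span_zero)
        next
          case 3
          then have "w (m - 1) \<in> w ` {1..<j - 1}" using m i by (intro imageI) auto
          then show ?thesis using pm 3 by (simp add: F.span_base)
        qed
      qed
      ultimately have "E.span (?u ` {1..<j}) \<subseteq> {x. p x \<in> F.span (w ` {1..<j - 1})}"
        by (intro E.span_minimal)
      moreover have "p (?u j) = w (j - 1)" using 3 lift_frame_coordinates(1)[OF j] by simp
      moreover have "j - 1 \<in> {1..n}" using 3 i j by auto
      ultimately show ?thesis using w_ind[of "j - 1"] by auto
    qed
  next
    fix a b assume ab: "a \<in> {1..n + 1}" "b \<in> {1..n + 1}"
    have "p (?u j) = 0 \<or> (\<exists>k\<in>{1..n}. p (?u j) = w k)" if j: "j \<in> {1..n + 1}" for j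
    proof -
      consider "j < i" "j \<in> {1..n}" | "j = i" | "i < j" "j - 1 \<in> {1..n}" using i j by force
      then show ?thesis using lift_frame_coordinates(1)[OF j, of i w \<phi>]
        by cases auto
    qed
    from this[OF ab(1)] this[OF ab(2)] have "\<sigma> (p (?u a)) (p (?u b)) = 0" by (auto simp: w_iso)
    then show "\<omega> (?u a) (?u b) = 0" by (simp add: p_isometry)
  qed
  have "?u i = e0" using i by (simp add: lift_frame_def)
  then have "e0 \<in> E.span (?u ` {1..i})" using i by (metis E.span_base atLeastAtMost_iff image_eqI order_refl)
  moreover have "{1..<i} = {1..i - 1}" using i by auto
  ultimately show "flag\<^sub>E ?u \<in> orbit\<^sub>E i"
    using flag_in_orbit_iff[OF frame i] e0_notin by simp
qed

text \<open>Modulo the kernel line, \<open>v i\<close> is a combination of its predecessors, since \<open>e0\<close> enters the flag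
  at step \<open>i\<close>.  Omitting its image therefore does not change the spans.\<close>

lemma project_frame_span:
  assumes i: "i \<in> {1..n + 1}" and v: "v \<in> frames\<^sub>E" "flag\<^sub>E v \<in> orbit\<^sub>E i" and j: "j \<le> n + 1"
    and x: "x \<in> E.span (v ` {1..j})"
  shows "p x \<in> F.span (project_frame i v ` {1..(if j < i then j else j - 1)})"
proof -
  let ?w = "project_frame i v"
  let ?W = "\<lambda>j. F.span (?w ` {1..(if j < i then j else j - 1)})"
  have e0: "e0 \<in> E.span (v ` {1..i})" "e0 \<notin> E.span (v ` {1..i - 1})"
    using v flag_in_orbit_iff[OF v(1) i] by auto
  have w_lt: "?w a = p (v a)" if "a < i" "a \<in> {1..n + 1}" for a
    using that i by (auto simp: project_frame_def skip_def)
  have w_ge: "?w (a - 1) = p (v a)" if "i < a" "a \<in> {1..n + 1}" for a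
    using that i by (auto simp: project_frame_def skip_def)
  have p_vi: "p (v i) \<in> F.span (?w ` {1..i - 1})"
  proof -
    have "{1..i} = insert i {1..i - 1}" using i by auto
    then have "e0 \<in> E.span (insert (v i) (v ` {1..i - 1}))" using e0(1) by simp
    then have "v i \<in> E.span (insert e0 (v ` {1..i - 1}))" by (rule E.in_span_insert[OF _ e0(2)])
    then have "p (v i) \<in> F.span (p ` insert e0 (v ` {1..i - 1}))" using p_span by blast
    also have "p ` insert e0 (v ` {1..i - 1}) = insert 0 (?w ` {1..i - 1})"
    proof -
      have "p ` v ` {1..i - 1} = ?w ` {1..i - 1}"
        unfolding image_image by (rule image_cong) (use w_lt i in auto)
      then show ?thesis by simp
    qed
    finally show ?thesis by simp
  qed
  have gen: "p (v a) \<in> ?W j" if a: "a \<in> {1..j}" for a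
  proof -
    consider "a < i" | "a = i" | "i < a" by linarith
    then show ?thesis
    proof cases
      case 1
      then show ?thesis using w_lt[of a] a j i by (auto intro!: F.span_base image_eqI[of _ ?w a])
    next
      case 2
      have "F.span (?w ` {1..i - 1}) \<subseteq> ?W j" using 2 a by (intro F.span_mono) auto
      then show ?thesis using p_vi 2 by blast
    next
      case 3
      then show ?thesis using w_ge[of a] a j i by (auto intro!: F.span_base image_eqI[of _ ?w "a - 1"])
    qed
  qed
  have "E.subspace {x. p x \<in> ?W j}"
    by (auto simp: E.subspace_def F.span_zero F.span_add F.span_scale)
  then have "E.span (v ` {1..j}) \<subseteq> {x. p x \<in> ?W j}"
    by (rule E.span_minimal[rotated]) (use gen in blast)
  then show ?thesis using x by blast
qed

lemma span_project_frame_below: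
  assumes i: "i \<in> {1..n + 1}"
  shows "F.span (project_frame i v ` {1..i - 1}) = p ` E.span (v ` {1..i - 1})"
proof -
  have "project_frame i v ` {1..i - 1} = p ` v ` {1..i - 1}"
    using i by (force simp: project_frame_def skip_def image_image)
  then show ?thesis by (simp add: p_span)
qed

text \<open>A relation among the images of \<open>v\<close> is a relation among the vectors themselves up to a multiple
  of \<open>e0\<close>.  Before position \<open>i\<close> this multiple is zero, as \<open>e0\<close> is not in the flag yet; after it,
  \<open>e0\<close> is in the span of the preceding vectors.\<close>

lemma project_frame_in:
  assumes i: "i \<in> {1..n + 1}" and v: "v \<in> frames\<^sub>E" "flag\<^sub>E v \<in> orbit\<^sub>E i"
  shows "(project_frame i v, graph_functional (E.span (v ` {1..i - 1}))) \<in> framed_dual i"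
proof -
  let ?w = "project_frame i v"
  have v_ind: "\<And>j. j \<in> {1..n + 1} \<Longrightarrow> v j \<notin> E.span (v ` {1..<j})"
    and v_iso: "\<And>a b. a \<in> {1..n + 1} \<Longrightarrow> b \<in> {1..n + 1} \<Longrightarrow> \<omega> (v a) (v b) = 0"
    using v by (auto simp: E.isotropic_frames_iff)
  have e0: "e0 \<in> E.span (v ` {1..i})" "e0 \<notin> E.span (v ` {1..i - 1})"
    using v flag_in_orbit_iff[OF v(1) i] by auto
  have "?w \<in> frames\<^sub>F"
    unfolding F.isotropic_frames_iff
  proof (intro conjI ballI)
    show "?w \<in> extensional {1..n}" by (simp add: project_frame_def)
    fix j assume j: "j \<in> {1..n}"
    let ?k = "skip i j"
    have k: "?k \<in> {1..n + 1}" using j by (auto simp: skip_def)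
    show "?w j \<notin> F.span (?w ` {1..<j})"
    proof
      assume "?w j \<in> F.span (?w ` {1..<j})"
      moreover have "?w ` {1..<j} = p ` (v ` skip i ` {1..<j})"
        using j by (force simp: project_frame_def image_image)
      ultimately have "p (v ?k) \<in> p ` E.span (v ` skip i ` {1..<j})"
        using j by (simp add: p_span project_frame_def)
      moreover have "skip i ` {1..<j} \<subseteq> {1..<?k}" by (auto simp: skip_def)
      then have "E.span (v ` skip i ` {1..<j}) \<subseteq> E.span (v ` {1..<?k})"
        by (intro E.span_mono image_mono)
      ultimately obtain x where x: "x \<in> E.span (v ` {1..<?k})" "p (v ?k) = p x" by blast
      show False
      proof (cases "j < i")
        case True
        then have kj: "?k = j" by (simp add: skip_def)
        have "v j = x"
        proof (rule p_injective[OF E.subspace_span e0(2)])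
          show "v j \<in> E.span (v ` {1..i - 1})" using True j by (intro E.span_base) auto
          have "E.span (v ` {1..<j}) \<subseteq> E.span (v ` {1..i - 1})"
            using True by (intro E.span_mono) auto
          then show "x \<in> E.span (v ` {1..i - 1})" using x kj by auto
          show "p (v j) = p x" using x kj by simp
        qed
        then show False using v_ind[OF k] x kj by simp
      next
        case False
        then have "E.span (v ` {1..i}) \<subseteq> E.span (v ` {1..<?k})"
          by (intro E.span_mono) (auto simp: skip_def)
        then have "e0 \<in> E.span (v ` {1..<?k})" using e0 by blast
        then have "x + s (\<kappa> (v ?k - x)) e0 \<in> E.span (v ` {1..<?k})"
          by (intro E.span_add E.span_scale x)
        moreover have "v ?k - x = s (\<kappa> (v ?k - x)) e0" using x by (intro p_zeroD) simp
        ultimately have "v ?k \<in> E.span (v ` {1..<?k})" by (metis add.commute diff_add_cancel)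
        then show False using v_ind[OF k] by simp
      qed
    qed
  next
    fix a b assume "a \<in> {1..n}" "b \<in> {1..n}"
    then show "\<sigma> (?w a) (?w b) = 0" by (auto simp: project_frame_def p_isometry skip_def intro!: v_iso)
  qed
  moreover have "graph_functional (E.span (v ` {1..i - 1})) \<in> dual_of_subspace s' (F.span (?w ` {1..i - 1}))"
    unfolding span_project_frame_below[OF i] by (rule graph_functional_dual[OF E.subspace_span e0(2)])
  ultimately show ?thesis by simp
qed

text \<open>The round trip keeps the vectors before position \<open>i\<close>, puts \<open>e0\<close> there, and changes the later
  ones by multiples of \<open>e0\<close>, which lies in step \<open>i\<close>.\<close>

lemma lift_project_flag:
  assumes i: "i \<in> {1..n + 1}" and v: "v \<in> frames\<^sub>E" "flag\<^sub>E v \<in> orbit\<^sub>E i"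
  shows "flag\<^sub>E (lift_frame i (project_frame i v) (graph_functional (E.span (v ` {1..i - 1})))) = flag\<^sub>E v"
proof -
  let ?\<phi> = "graph_functional (E.span (v ` {1..i - 1}))"
  have e0: "e0 \<in> E.span (v ` {1..i})" "e0 \<notin> E.span (v ` {1..i - 1})"
    using v flag_in_orbit_iff[OF v(1) i] by auto
  show ?thesis
  proof (rule E.flag_of_frame_eqI[OF _ v(1)])
    show "lift_frame i (project_frame i v) ?\<phi> \<in> frames\<^sub>E"
      using project_frame_in[OF i v] by (intro lift_frame_in(1)[OF i]) auto
    fix j m assume jm: "j \<le> n + 1" "1 \<le> m" "m \<le> j"
    consider "m < i" | "m = i" | "i < m" by linarith
    then show "lift_frame i (project_frame i v) ?\<phi> m \<in> E.span (v ` {1..j})"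
    proof cases
      case 1
      have "?\<phi> (p (v m)) = \<kappa> (v m)"
        using 1 jm by (intro graph_functional_apply[OF E.subspace_span e0(2)] E.span_base) auto
      then have "lift_frame i (project_frame i v) ?\<phi> m = v m"
        using 1 jm i split[of "v m"] by (simp add: lift_frame_def project_frame_def skip_def)
      then show ?thesis using jm by (auto intro: E.span_base)
    next
      case 2
      have "E.span (v ` {1..i}) \<subseteq> E.span (v ` {1..j})" using 2 jm by (intro E.span_mono) auto
      then show ?thesis using e0 2 jm by (auto simp: lift_frame_def)
    next
      case 3
      have "E.span (v ` {1..i}) \<subseteq> E.span (v ` {1..j})" using 3 jm by (intro E.span_mono) auto
      then have "v m - s (\<kappa> (v m)) e0 \<in> E.span (v ` {1..j})"
        using e0 jm by (intro E.span_diff E.span_scale) (auto intro: E.span_base)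
      moreover have "v m - s (\<kappa> (v m)) e0 = \<iota> (p (v m))" using split[of "v m"] by (metis add_diff_cancel)
      moreover have "m - 1 \<in> {1..n}" "skip i (m - 1) = m" using 3 jm i by (auto simp: skip_def)
      then have "lift_frame i (project_frame i v) ?\<phi> m = \<iota> (p (v m))"
        using 3 jm by (simp add: lift_frame_def project_frame_def)
      ultimately show ?thesis by simp
    qed
  qed
qed

text \<open>On framed data, projecting undoes lifting exactly and not only up to the Borel group.\<close>

lemma project_lift:
  assumes i: "i \<in> {1..n + 1}" and w: "w \<in> frames\<^sub>F"
    and \<phi>: "\<phi> \<in> dual_of_subspace s' (F.span (w ` {1..i - 1}))"
  shows "project_frame i (lift_frame i w \<phi>) = w"
    and "graph_functional (E.span (lift_frame i w \<phi> ` {1..i - 1})) = \<phi>"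
proof -
  let ?u = "lift_frame i w \<phi>"
  let ?V = "E.span (?u ` {1..i - 1})"
  show pw: "project_frame i ?u = w"
  proof (rule extensionalityI[of _ "{1..n}"])
    show "project_frame i ?u \<in> extensional {1..n}" by (simp add: project_frame_def)
    show "w \<in> extensional {1..n}" using w by (simp add: isotropic_frames_def)
    fix j assume "j \<in> {1..n}"
    then show "project_frame i ?u j = w j"
      using lift_frame_coordinates(1)[of "skip i j" i w \<phi>] by (auto simp: project_frame_def skip_def)
  qed
  have "e0 \<notin> ?V"
    using lift_frame_in[OF i w \<phi>] flag_in_orbit_iff[OF _ i] by blast
  note apply_V = graph_functional_apply[OF E.subspace_span this]
  have pV: "p ` ?V = F.span (w ` {1..i - 1})" using span_project_frame_below[OF i, of ?u] pw by simp
  have i1: "{1..i - 1} = {1..<i}" using i by auto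
  show "graph_functional ?V = \<phi>"
  proof (rule extensionalityI[of _ "p ` ?V"])
    show "graph_functional ?V \<in> extensional (p ` ?V)" by (simp add: graph_functional_def)
    show "\<phi> \<in> extensional (p ` ?V)" using \<phi> pV by (simp add: dual_of_subspace_def)
    fix x assume "x \<in> p ` ?V"
    then obtain z where z: "z \<in> ?V" "x = p z" by blast
    then show "graph_functional ?V x = \<phi> x"
      using apply_V[OF z(1)] lift_frame_graph[OF i order_refl \<phi>, of z] i1 by simp
  qed
qed

text \<open>The span of the lifted vectors is described by \<open>\<phi>\<close> and the spans of \<open>w\<close> alone: below step \<open>i\<close> it
  is the graph of \<open>\<phi>\<close> over a step of the flag of \<open>w\<close>, and from step \<open>i\<close> on it is the preimage of
  such a step.\<close>

lemma lift_frame_descends: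
  assumes i: "i \<in> {1..n + 1}" and w: "w \<in> frames\<^sub>F" "w' \<in> frames\<^sub>F" "flag\<^sub>F w = flag\<^sub>F w'"
    and \<phi>: "\<phi> \<in> dual_of_subspace s' (F.span (w ` {1..i - 1}))"
  shows "flag\<^sub>E (lift_frame i w \<phi>) = flag\<^sub>E (lift_frame i w' \<phi>)"
proof -
  let ?u = "lift_frame i w \<phi>" and ?u' = "lift_frame i w' \<phi>"
  have span_eq: "F.span (w ` {1..j}) = F.span (w' ` {1..j})" if "j \<le> n" for j
    using fun_cong[OF w(3), of j] that by (simp add: flag_of_frame_def)
  have \<phi>': "\<phi> \<in> dual_of_subspace s' (F.span (w' ` {1..i - 1}))"
    using \<phi> span_eq[of "i - 1"] i by auto
  have \<phi>0: "\<phi> 0 = 0" using dual_simps(2)[OF \<phi>, of 0 0] by (simp add: F.span_zero)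
  show ?thesis
  proof (rule E.flag_of_frame_eqI[OF lift_frame_in(1)[OF i w(1) \<phi>] lift_frame_in(1)[OF i w(2) \<phi>']])
    fix j m assume jm: "j \<le> n + 1" "1 \<le> m" "m \<le> j"
    consider "m < i" | "m = i" | "i < m" by linarith
    then show "?u m \<in> E.span (?u' ` {1..j})"
    proof cases
      case 1
      let ?G = "{x \<in> F.span (w' ` {1..i - 1}). \<iota> x + s (\<phi> x) e0 \<in> E.span (?u' ` {1..j})}"
      have "F.subspace ?G"
        unfolding F.subspace_def
      proof (intro conjI ballI allI)
        show "0 \<in> ?G" using \<phi>0 by (simp add: F.span_zero E.span_zero)
        fix x assume x: "x \<in> ?G"
        have "s c (\<iota> x + s (\<phi> x) e0) \<in> E.span (?u' ` {1..j})" for c using x by (intro E.span_scale) simp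
        then show "s' c x \<in> ?G" for c
          using x dual_simps(2)[OF \<phi>', of x c] by (simp add: F.span_scale E.scale_right_distrib)
        fix y assume y: "y \<in> ?G"
        have "\<iota> x + s (\<phi> x) e0 \<in> E.span (?u' ` {1..j})" "\<iota> y + s (\<phi> y) e0 \<in> E.span (?u' ` {1..j})"
          using x y by blast+
        then have "(\<iota> x + s (\<phi> x) e0) + (\<iota> y + s (\<phi> y) e0) \<in> E.span (?u' ` {1..j})"
          by (rule E.span_add)
        then show "x + y \<in> ?G"
          using x y dual_simps(1)[OF \<phi>', of x y] by (simp add: F.span_add E.scale_left_distrib algebra_simps)
      qed
      moreover have "w' ` {1..m} \<subseteq> ?G"
      proof
        fix x assume "x \<in> w' ` {1..m}"
        then obtain a where a: "a \<in> {1..m}" "x = w' a" by blast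
        have "\<iota> x + s (\<phi> x) e0 = ?u' a" using a 1 jm by (auto simp: lift_frame_def)
        moreover have "?u' a \<in> E.span (?u' ` {1..j})" using a jm by (intro E.span_base) auto
        moreover have "x \<in> F.span (w' ` {1..i - 1})" using a 1 by (intro F.span_base) auto
        ultimately show "x \<in> ?G" by simp
      qed
      ultimately have "F.span (w' ` {1..m}) \<subseteq> ?G" by (rule F.span_minimal[rotated])
      moreover have "w m \<in> F.span (w' ` {1..m})"
        using span_eq[of m] 1 i jm F.span_base[of "w m" "w ` {1..m}"] by auto
      ultimately have "w m \<in> ?G" by blast
      then show ?thesis using 1 jm by (simp add: lift_frame_def)
    next
      case 2
      then have "?u m = ?u' m" using jm by (simp add: lift_frame_def)
      then show ?thesis using jm by (auto intro: E.span_base)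
    next
      case 3
      let ?G = "{x. \<iota> x \<in> E.span (?u' ` {1..j})}"
      have "F.subspace ?G"
        by (auto simp: F.subspace_def E.span_zero E.span_add E.span_scale)
      moreover have "w' ` {1..m - 1} \<subseteq> ?G"
      proof
        fix x assume "x \<in> w' ` {1..m - 1}"
        then obtain a where a: "a \<in> {1..m - 1}" "x = w' a" by blast
        have u': "?u' b \<in> E.span (?u' ` {1..j})" if "b \<in> {1..j}" for b using that by (intro E.span_base) auto
        have e0: "e0 \<in> E.span (?u' ` {1..j})" using u'[of i] i 3 jm by (simp add: lift_frame_def)
        show "x \<in> ?G"
        proof (cases "a < i")
          case True
          then have "?u' a - s (\<phi> x) e0 \<in> E.span (?u' ` {1..j})"
            using a jm by (intro E.span_diff E.span_scale e0 u') auto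
          moreover have "?u' a - s (\<phi> x) e0 = \<iota> x" using True a jm by (auto simp: lift_frame_def)
          ultimately show ?thesis by simp
        next
          case False
          then have "?u' (Suc a) = \<iota> x" using a jm by (auto simp: lift_frame_def)
          then show ?thesis using u'[of "Suc a"] a jm by auto
        qed
      qed
      ultimately have "F.span (w' ` {1..m - 1}) \<subseteq> ?G" by (rule F.span_minimal[rotated])
      moreover have "w (m - 1) \<in> F.span (w' ` {1..m - 1})"
        using span_eq[of "m - 1"] 3 i jm F.span_base[of "w (m - 1)" "w ` {1..m - 1}"] by auto
      ultimately have "w (m - 1) \<in> ?G" by blast
      then show ?thesis using 3 jm by (simp add: lift_frame_def)
    qed
  qed
qed

lemma project_frame_descends:
  assumes i: "i \<in> {1..n + 1}" and v: "v \<in> frames\<^sub>E" "v' \<in> frames\<^sub>E" "flag\<^sub>E v \<in> orbit\<^sub>E i"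
    and eq: "flag\<^sub>E v = flag\<^sub>E v'"
  shows "flag\<^sub>F (project_frame i v) = flag\<^sub>F (project_frame i v')"
proof (rule F.flag_of_frame_eqI)
  have span_eq: "E.span (v ` {1..j}) = E.span (v' ` {1..j})" if "j \<le> n + 1" for j
    using fun_cong[OF eq, of j] that by (simp add: flag_of_frame_def)
  show "project_frame i v \<in> frames\<^sub>F" using project_frame_in[OF i v(1,3)] by simp
  show "project_frame i v' \<in> frames\<^sub>F" using project_frame_in[OF i v(2)] v(3) eq by simp
  fix j m assume jm: "j \<le> n" "1 \<le> m" "m \<le> j"
  let ?k = "skip i m"
  have k: "?k \<in> {1..n + 1}" using jm by (auto simp: skip_def)
  have "v ?k \<in> E.span (v' ` {1..?k})"
    using span_eq[of ?k] k E.span_base[of "v ?k" "v ` {1..?k}"] by auto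
  from project_frame_span[OF i v(2) _ _ this] have "p (v ?k) \<in> F.span (project_frame i v' ` {1..m})"
    using v(3) eq k by (auto simp: skip_def split: if_splits)
  moreover have "F.span (project_frame i v' ` {1..m}) \<subseteq> F.span (project_frame i v' ` {1..j})"
    using jm by (intro F.span_mono) auto
  moreover have "project_frame i v m = p (v ?k)" using jm by (simp add: project_frame_def)
  ultimately show "project_frame i v m \<in> F.span (project_frame i v' ` {1..j})" by auto
qed

text \<open>In coordinates, lifting sends \<open>(w, \<phi>)\<close> to expressions in the \<open>w m\<close> and the numbers \<open>\<phi> (w m)\<close>,
  which are exactly the coordinates of the framed bundle.  Conversely, the number attached to the
  \<open>m\<close>-th projected vector is \<open>\<kappa> (v m)\<close>, a coordinate function of frames.  So both maps are
  polynomial, and they induce mutually inverse maps of the quotients.\<close>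

theorem orbit_isomorphic_dual_tautological:
  assumes i: "i \<in> {1..n + 1}"
  shows "isomorphic_varieties
     (subvariety (isotropic_flag_variety s \<omega> (n + 1)) (orbit\<^sub>E i))
     (dual_tautological_total_space s' \<sigma> n (i - 1))"
  unfolding isotropic_flag_variety_def dual_tautological_total_space_def framed_dual_variety_def
proof (rule isomorphic_varieties_by_lifts[where
      \<Phi> = "\<lambda>(w, \<phi>). lift_frame i w \<phi>" and
      \<Psi> = "\<lambda>v. (project_frame i v, graph_functional (E.span (v ` {1..i - 1})))"])
  let ?C' = "{(\<lambda>(v, \<phi>). c v) | c. c \<in> frame_coordinates s' n} \<union>
        {(\<lambda>(v, \<phi>). \<phi> (v m)) | m. m \<in> {1..i - 1}} :: ((nat \<Rightarrow> 'b) \<times> ('b \<Rightarrow> complex) \<Rightarrow> complex) set"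
  let ?\<pi>' = "\<lambda>(v, \<phi>). (flag\<^sub>F v, \<phi> :: 'b \<Rightarrow> complex)"
  show "flag\<^sub>E ` frames\<^sub>E \<subseteq> isotropic_flags s \<omega> (n + 1)" by (simp only: E.flag_of_frame_image)
  show "orbit\<^sub>E i \<subseteq> flag\<^sub>E ` frames\<^sub>E" unfolding E.flag_of_frame_image by (auto simp: odd_orbit_def)
  show "?\<pi>' ` framed_dual i = dual_tautological_points s' \<sigma> n (i - 1)"
  proof -
    have "flag\<^sub>F w (i - 1) = F.span (w ` {1..i - 1})" for w
    proof -
      have "i - 1 \<in> {0..n}" using i by auto
      then show ?thesis by (simp add: flag_of_frame_def)
    qed
    then have "dual_tautological_points s' \<sigma> n (i - 1) =
        (\<Union>w\<in>frames\<^sub>F. {flag\<^sub>F w} \<times> dual_of_subspace s' (F.span (w ` {1..i - 1})))"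
      unfolding dual_tautological_points_def F.flag_of_frame_image[symmetric] by auto
    then show ?thesis by force
  qed
  show "(case y of (w, \<phi>) \<Rightarrow> lift_frame i w \<phi>) \<in> frames\<^sub>E \<and>
      flag\<^sub>E (case y of (w, \<phi>) \<Rightarrow> lift_frame i w \<phi>) \<in> orbit\<^sub>E i" if "y \<in> framed_dual i" for y
    using that lift_frame_in[OF i] by (cases y) simp
  show "(project_frame i v, graph_functional (E.span (v ` {1..i - 1}))) \<in> framed_dual i"
    if "v \<in> frames\<^sub>E" "flag\<^sub>E v \<in> orbit\<^sub>E i" for v
    using project_frame_in[OF i that] .
  show "\<exists>q\<in>polynomial_functions ?C'. \<forall>y\<in>framed_dual i. q y = c (case y of (w, \<phi>) \<Rightarrow> lift_frame i w \<phi>)"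
    if c: "c \<in> frame_coordinates s (n + 1)" for c
  proof -
    obtain l m where l: "Vector_Spaces.linear s (*) l" and m: "m \<in> {1..n + 1}" and c: "c = (\<lambda>v. l (v m))"
      using c by (auto simp: frame_coordinates_def)
    note l_simps = E.linear_functional_simps[OF l]
    have l_i: "Vector_Spaces.linear s' (*) (\<lambda>x. l (\<iota> x))"
      using l F.vector_space_axioms by (simp add: Vector_Spaces.linear_iff)
    have coord: "(\<lambda>(w, \<phi>). l (\<iota> (w a))) \<in> polynomial_functions ?C'" if "a \<in> {1..n}" for a
    proof (rule polynomial_functions.coord, rule UnI1)
      have "(\<lambda>w. l (\<iota> (w a))) \<in> frame_coordinates s' n"
        unfolding frame_coordinates_def
        by (rule CollectI, rule exI[of _ "\<lambda>x. l (\<iota> x)"], rule exI[of _ a]) (use l_i that in simp)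
      then show "(\<lambda>(w, \<phi>). l (\<iota> (w a))) \<in> {(\<lambda>(v, \<phi>). c v) | c. c \<in> frame_coordinates s' n}"
        by (intro CollectI exI[of _ "\<lambda>w. l (\<iota> (w a))"]) simp
    qed
    consider "m < i" | "m = i" | "i < m" by linarith
    then show ?thesis
    proof cases
      case 1
      have "(\<lambda>(w, \<phi>). \<phi> (w m)) \<in> polynomial_functions ?C'"
        by (rule polynomial_functions.coord) (use 1 m in auto)
      then have mem: "(\<lambda>y. (case y of (w, \<phi>) \<Rightarrow> l (\<iota> (w m))) + l e0 * (case y of (w, \<phi>) \<Rightarrow> \<phi> (w m)))
          \<in> polynomial_functions ?C'"
        using 1 m i by (intro polynomial_functions.add polynomial_functions.mult
          polynomial_functions.const coord) auto
      have eq: "(case y of (w, \<phi>) \<Rightarrow> l (\<iota> (w m))) + l e0 * (case y of (w, \<phi>) \<Rightarrow> \<phi> (w m)) =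
          c (case y of (w, \<phi>) \<Rightarrow> lift_frame i w \<phi>)" for y
        using 1 m by (cases y) (simp add: c lift_frame_def l_simps)
      show ?thesis by (rule bexI[OF _ mem], rule ballI, rule eq)
    next
      case 2
      have mem: "(\<lambda>_. l e0) \<in> polynomial_functions ?C'" by (rule polynomial_functions.const)
      have eq: "l e0 = c (case y of (w, \<phi>) \<Rightarrow> lift_frame i w \<phi>)" for y
        using 2 m by (cases y) (simp add: c lift_frame_def)
      show ?thesis by (rule bexI[OF _ mem], rule ballI, rule eq)
    next
      case 3
      have mem: "(\<lambda>(w, \<phi>). l (\<iota> (w (m - 1)))) \<in> polynomial_functions ?C'"
        by (rule coord) (use 3 m i in auto)
      have eq: "(case y of (w, \<phi>) \<Rightarrow> l (\<iota> (w (m - 1)))) = c (case y of (w, \<phi>) \<Rightarrow> lift_frame i w \<phi>)" for y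
        using 3 m by (cases y) (simp add: c lift_frame_def)
      show ?thesis by (rule bexI[OF _ mem], rule ballI, rule eq)
    qed
  qed
  show "\<exists>q\<in>polynomial_functions (frame_coordinates s (n + 1)).
      \<forall>v\<in>{v \<in> frames\<^sub>E. flag\<^sub>E v \<in> orbit\<^sub>E i}.
        q v = c (project_frame i v, graph_functional (E.span (v ` {1..i - 1})))" if c: "c \<in> ?C'" for c
  proof -
    from c consider l m where "Vector_Spaces.linear s' (*) l" "m \<in> {1..n}" "c = (\<lambda>(w, \<phi>). l (w m))"
      | m where "m \<in> {1..i - 1}" "c = (\<lambda>(w, \<phi>). \<phi> (w m))"
      by (auto simp: frame_coordinates_def)
    then show ?thesis
    proof cases
      case (1 l m)
      have "Vector_Spaces.linear s (*) (\<lambda>x. l (p x))"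
        using 1(1) E.vector_space_axioms by (simp add: Vector_Spaces.linear_iff)
      moreover have "skip i m \<in> {1..n + 1}" using 1 by (auto simp: skip_def)
      ultimately have "(\<lambda>v. l (p (v (skip i m)))) \<in> polynomial_functions (frame_coordinates s (n + 1))"
        by (intro polynomial_functions.coord) (auto simp: frame_coordinates_def)
      then show ?thesis using 1 by (intro bexI) (auto simp: project_frame_def)
    next
      case (2 m)
      have mem: "(\<lambda>v. \<kappa> (v m)) \<in> polynomial_functions (frame_coordinates s (n + 1))"
        unfolding frame_coordinates_def
        by (rule polynomial_functions.coord, rule CollectI, rule exI[of _ \<kappa>], rule exI[of _ m])
          (use 2 i \<kappa>_linear in auto)
      have eq: "\<kappa> (v m) = c (project_frame i v, graph_functional (E.span (v ` {1..i - 1})))"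
        if v: "v \<in> frames\<^sub>E" "flag\<^sub>E v \<in> orbit\<^sub>E i" for v
      proof -
        have "e0 \<notin> E.span (v ` {1..i - 1})" using v flag_in_orbit_iff[OF v(1) i] by blast
        then have "graph_functional (E.span (v ` {1..i - 1})) (p (v m)) = \<kappa> (v m)"
          using 2 by (intro graph_functional_apply[OF E.subspace_span] E.span_base) auto
        moreover have "project_frame i v m = p (v m)"
          using 2 i by (auto simp: project_frame_def skip_def)
        ultimately show ?thesis using 2 by simp
      qed
      show ?thesis by (rule bexI[OF _ mem], rule ballI, rule eq) auto
    qed
  qed
  show "flag\<^sub>E (case y of (w, \<phi>) \<Rightarrow> lift_frame i w \<phi>) = flag\<^sub>E (case y' of (w, \<phi>) \<Rightarrow> lift_frame i w \<phi>)"
    if y: "y \<in> framed_dual i" "y' \<in> framed_dual i" "?\<pi>' y = ?\<pi>' y'" for y y'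
  proof -
    obtain w w' \<phi> where "y = (w, \<phi>)" "y' = (w', \<phi>)" "flag\<^sub>F w = flag\<^sub>F w'"
      using y(3) by (cases y, cases y') auto
    then show ?thesis using y lift_frame_descends[OF i, of w w' \<phi>] by simp
  qed
  show "?\<pi>' (project_frame i v, graph_functional (E.span (v ` {1..i - 1}))) =
      ?\<pi>' (project_frame i v', graph_functional (E.span (v' ` {1..i - 1})))"
    if v: "v \<in> frames\<^sub>E" "v' \<in> frames\<^sub>E" "flag\<^sub>E v \<in> orbit\<^sub>E i" "flag\<^sub>E v = flag\<^sub>E v'" for v v'
  proof -
    have "E.span (v ` {1..i - 1}) = E.span (v' ` {1..i - 1})"
    proof -
      have "i - 1 \<in> {0..n + 1}" using i by auto
      then show ?thesis using fun_cong[OF v(4), of "i - 1"] unfolding flag_of_frame_def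
        by (metis restrict_apply')
    qed
    then show ?thesis using project_frame_descends[OF i v] by simp
  qed
  show "flag\<^sub>E (case (project_frame i v, graph_functional (E.span (v ` {1..i - 1}))) of
      (w, \<phi>) \<Rightarrow> lift_frame i w \<phi>) = flag\<^sub>E v" if "v \<in> frames\<^sub>E" "flag\<^sub>E v \<in> orbit\<^sub>E i" for v
    using lift_project_flag[OF i that] by simp
  show "?\<pi>' (project_frame i (case y of (w, \<phi>) \<Rightarrow> lift_frame i w \<phi>),
      graph_functional (E.span ((case y of (w, \<phi>) \<Rightarrow> lift_frame i w \<phi>) ` {1..i - 1}))) = ?\<pi>' y"
    if "y \<in> framed_dual i" for y
    using that project_lift[OF i] by (cases y) simp
  show "\<exists>D \<sigma>. local_section frames\<^sub>E (frame_coordinates s (n + 1)) flag\<^sub>E v D \<sigma>"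
    if "v \<in> frames\<^sub>E" "flag\<^sub>E v \<in> orbit\<^sub>E i" for v
    using E.flag_of_frame_local_section[OF that(1)] .
qed

text \<open>The lift of any frame with the zero functional lies in the orbit.\<close>

lemma orbit_nonempty:
  assumes i: "i \<in> {1..n + 1}"
  shows "orbit\<^sub>E i \<noteq> {}"
proof -
  obtain x y where D: "F.darboux n x y" using F.darboux_exists by blast
  have "x j \<notin> F.span (x ` {1..<j})" if "j \<in> {1..n}" for j
    using F.darboux_independent[OF D that] F.span_mono[of "x ` {1..<j}" "insert 0 (x ` {1..<j})"] by auto
  moreover have "restrict x {1..n} ` {1..<j} = x ` {1..<j}" if "j \<in> {1..n}" for j
    using that by force
  ultimately have "restrict x {1..n} \<in> frames\<^sub>F"
    unfolding F.isotropic_frames_iff using F.darbouxD(1)[OF D] by simp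
  moreover have "restrict (\<lambda>_. 0) W \<in> dual_of_subspace s' W" if "F.subspace W" for W
    using that by (auto simp: dual_of_subspace_def F.subspace_def)
  ultimately show ?thesis using lift_frame_in(2)[OF i] F.subspace_span by blast
qed

end

section \<open>The action on flags\<close>

context skew_space
begin

abbreviation "isometry_group \<equiv> form_stabilizer s \<omega>"

lemma stabilizerD:
  assumes "g \<in> carrier isometry_group"
  shows "Vector_Spaces.linear s s g" "bij g" "\<omega> (g x) (g y) = \<omega> x y"
  using assms by (auto simp: form_stabilizer_def)

lemma stabilizer_inverse:
  assumes g: "g \<in> carrier isometry_group"
  shows "inv_into UNIV g \<in> carrier isometry_group"
proof -
  have gi: "g (inv_into UNIV g x) = x" for x using stabilizerD(2)[OF g] by (simp add: bij_is_surj surj_f_inv_f)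
  have ig: "inv_into UNIV g (g x) = x" for x using stabilizerD(2)[OF g] by (simp add: bij_is_inj)
  have add: "inv_into UNIV g (x + y) = inv_into UNIV g x + inv_into UNIV g y" for x y
    using stabilizerD(1)[OF g] ig[of "inv_into UNIV g x + inv_into UNIV g y"] by (simp add: Vector_Spaces.linear_iff gi)
  have scale: "inv_into UNIV g (s c x) = s c (inv_into UNIV g x)" for c x
    using stabilizerD(1)[OF g] ig[of "s c (inv_into UNIV g x)"] by (simp add: Vector_Spaces.linear_iff gi)
  have "Vector_Spaces.linear s s (inv_into UNIV g)"
    using add scale by (simp add: Vector_Spaces.linear_iff vector_space_axioms)
  moreover have "\<omega> (inv_into UNIV g x) (inv_into UNIV g y) = \<omega> x y" for x y
    using stabilizerD(3)[OF g, of "inv_into UNIV g x" "inv_into UNIV g y"] by (simp add: gi)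
  ultimately show ?thesis using stabilizerD(2)[OF g] by (simp add: form_stabilizer_def bij_imp_bij_inv)
qed

lemma group_stabilizer: "group isometry_group"
proof (rule groupI)
  fix f g assume "f \<in> carrier isometry_group" "g \<in> carrier isometry_group"
  then show "f \<otimes>\<^bsub>isometry_group\<^esub> g \<in> carrier isometry_group"
    by (auto simp: form_stabilizer_def bij_comp Vector_Spaces.linear_iff)
next
  show "\<one>\<^bsub>isometry_group\<^esub> \<in> carrier isometry_group"
    by (simp add: form_stabilizer_def Vector_Spaces.linear_iff vector_space_axioms)
next
  fix g assume g: "g \<in> carrier isometry_group"
  show "\<exists>f\<in>carrier isometry_group. f \<otimes>\<^bsub>isometry_group\<^esub> g = \<one>\<^bsub>isometry_group\<^esub>"
    using stabilizer_inverse[OF g] stabilizerD(2)[OF g]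
    by (intro bexI[of _ "inv_into UNIV g"]) (simp_all add: form_stabilizer_def bij_is_inj)
qed (auto simp: form_stabilizer_def comp_assoc)

text \<open>An isometry carries a frame of a flag to a frame of the image flag.\<close>

lemma flag_action_in_flags:
  assumes g: "g \<in> carrier isometry_group" and V: "V \<in> isotropic_flags s \<omega> k"
  shows "flag_action s \<omega> k g V \<in> isotropic_flags s \<omega> k"
proof -
  obtain v where v: "v \<in> isotropic_frames s \<omega> k" "V = flag_of_frame s k v"
    using V flag_of_frame_image by blast
  let ?u = "\<lambda>j\<in>{1..k}. g (v j)"
  have span: "g ` span S = span (g ` S)" for S
    using module_hom.span_image[of s s g S] stabilizerD(1)[OF g] by (simp add: module_hom_iff_linear)
  have "?u j \<notin> span (?u ` {1..<j})" if j: "j \<in> {1..k}" for j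
  proof -
    have "?u ` {1..<j} = g ` v ` {1..<j}" unfolding image_image by (rule image_cong) (use j in auto)
    moreover have "v j \<notin> span (v ` {1..<j})" using v j by (auto simp: isotropic_frames_iff)
    ultimately show ?thesis
      using j span[of "v ` {1..<j}"] stabilizerD(2)[OF g] by (metis bij_is_inj inj_image_mem_iff restrict_apply')
  qed
  then have u: "?u \<in> isotropic_frames s \<omega> k"
    using v stabilizerD(3)[OF g] by (simp add: isotropic_frames_iff)
  have "flag_action s \<omega> k g V = flag_of_frame s k ?u"
  proof (rule extensionalityI[of _ "{0..k}"])
    show "flag_action s \<omega> k g V \<in> extensional {0..k}" using V by (simp add: flag_action_def)
    show "flag_of_frame s k ?u \<in> extensional {0..k}" by (simp add: flag_of_frame_def)
    fix j assume j: "j \<in> {0..k}"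
    have "?u ` {1..j} = g ` v ` {1..j}" unfolding image_image by (rule image_cong) (use j in auto)
    then have "g ` span (v ` {1..j}) = span (?u ` {1..j})" using span by simp
    then show "flag_action s \<omega> k g V j = flag_of_frame s k ?u j"
      using V v(2) j unfolding flag_action_def flag_of_frame_def by (metis restrict_apply')
  qed
  then show ?thesis using flag_of_frame_in_flags[OF u] by simp
qed

lemma flag_action_apply:
  "V \<in> isotropic_flags s \<omega> k \<Longrightarrow> j \<le> k \<Longrightarrow> flag_action s \<omega> k g V j = g ` V j"
  by (simp add: flag_action_def)

lemma flag_action_extensional:
  "V \<in> isotropic_flags s \<omega> k \<Longrightarrow> flag_action s \<omega> k g V \<in> extensional {0..k}"
  by (simp add: flag_action_def)

lemma flag_action_compose:
  assumes V: "V \<in> isotropic_flags s \<omega> k" and g: "g \<in> carrier isometry_group"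
  shows "flag_action s \<omega> k (f \<circ> g) V = flag_action s \<omega> k f (flag_action s \<omega> k g V)"
proof (rule extensionalityI[of _ "{0..k}"])
  note gV = flag_action_in_flags[OF g V]
  show "flag_action s \<omega> k (f \<circ> g) V \<in> extensional {0..k}" by (rule flag_action_extensional[OF V])
  show "flag_action s \<omega> k f (flag_action s \<omega> k g V) \<in> extensional {0..k}" by (rule flag_action_extensional[OF gV])
  fix j assume "j \<in> {0..k}"
  then show "flag_action s \<omega> k (f \<circ> g) V j = flag_action s \<omega> k f (flag_action s \<omega> k g V) j"
    using flag_action_apply[OF V] flag_action_apply[OF gV] by (simp add: image_comp)
qed

lemma flag_action_id:
  assumes V: "V \<in> isotropic_flags s \<omega> k"
  shows "flag_action s \<omega> k id V = V"
proof (rule extensionalityI[OF flag_action_extensional[OF V]])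
  show "V \<in> extensional {0..k}" using V by (simp add: isotropic_flags_def)
qed (simp add: flag_action_apply[OF V])

lemma group_action_flags: "group_action isometry_group (isotropic_flags s \<omega> k) (flag_action s \<omega> k)"
proof (intro group_action.intro group_hom.intro group_hom_axioms.intro group_stabilizer group_BijGroup homI)
  let ?F = "isotropic_flags s \<omega> k"
  have Bij: "flag_action s \<omega> k g \<in> Bij ?F" if g: "g \<in> carrier isometry_group" for g
  proof -
    note g' = stabilizer_inverse[OF g]
    have "inv_into UNIV g \<circ> g = id" "g \<circ> inv_into UNIV g = id"
      using stabilizerD(2)[OF g] by (auto simp: bij_is_inj bij_is_surj surj_iff[symmetric])
    then have "bij_betw (flag_action s \<omega> k g) ?F ?F"
      using flag_action_in_flags[OF g] flag_action_in_flags[OF g'] flag_action_compose[OF _ g]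
        flag_action_compose[OF _ g'] flag_action_id
      by (intro bij_betw_byWitness[where f' = "flag_action s \<omega> k (inv_into UNIV g)"]) (auto, metis+)
    then show ?thesis by (simp add: Bij_def flag_action_def)
  qed
  then show "flag_action s \<omega> k g \<in> carrier (BijGroup ?F)" if "g \<in> carrier isometry_group" for g
    using that by (simp add: BijGroup_def)
  fix f g assume fg: "f \<in> carrier isometry_group" "g \<in> carrier isometry_group"
  have "flag_action s \<omega> k (f \<circ> g) = compose ?F (flag_action s \<omega> k f) (flag_action s \<omega> k g)"
  proof (rule extensionalityI[of _ ?F])
    show "flag_action s \<omega> k (f \<circ> g) \<in> extensional ?F" by (simp add: flag_action_def)
    show "compose ?F (flag_action s \<omega> k f) (flag_action s \<omega> k g) \<in> extensional ?F" by (rule compose_extensional)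
  qed (simp add: compose_eq flag_action_compose fg(2))
  then show "flag_action s \<omega> k (f \<otimes>\<^bsub>isometry_group\<^esub> g) =
      flag_action s \<omega> k f \<otimes>\<^bsub>BijGroup ?F\<^esub> flag_action s \<omega> k g"
    using Bij fg by (simp add: BijGroup_def form_stabilizer_def)
qed

end

section \<open>Orbits of the odd symplectic group\<close>

locale odd_symplectic = skew_space_with_kernel +
  assumes e0_nonzero: "e0 \<noteq> 0"
begin

abbreviation "flags \<equiv> isotropic_flags s \<omega> (n + 1)"
abbreviation "action \<equiv> flag_action s \<omega> (n + 1)"

text \<open>Otherwise the \<open>n + 1\<close> vectors of a frame would be isotropic and independent modulo the
  kernel, and would extend to a Darboux family that is too long.\<close>

lemma e0_in_top:
  assumes V: "V \<in> flags"
  shows "e0 \<in> V (n + 1)"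
proof (rule ccontr)
  assume e0: "e0 \<notin> V (n + 1)"
  obtain v where v: "v \<in> isotropic_frames s \<omega> (n + 1)" "V = flag_of_frame s (n + 1) v"
    using V flag_of_frame_image by blast
  have v_ind: "\<And>j. j \<in> {1..n + 1} \<Longrightarrow> v j \<notin> span (v ` {1..<j})"
    and v_iso: "\<And>a b. a \<in> {1..n + 1} \<Longrightarrow> b \<in> {1..n + 1} \<Longrightarrow> \<omega> (v a) (v b) = 0"
    using v by (auto simp: isotropic_frames_iff)
  have "v j \<notin> span (insert e0 (v ` {1..<j}))" if j: "j \<in> {1..n + 1}" for j
  proof
    assume "v j \<in> span (insert e0 (v ` {1..<j}))"
    then have "e0 \<in> span (insert (v j) (v ` {1..<j}))" by (rule in_span_insert[OF _ v_ind[OF j]])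
    moreover have "span (insert (v j) (v ` {1..<j})) \<subseteq> span (v ` {1..n + 1})"
      using j by (intro span_mono) auto
    ultimately show False using e0 v(2) by (auto simp: flag_of_frame_def)
  qed
  then obtain y where "darboux (n + 1) v y" using darboux_extend[where x = v and m = "n + 1", OF v_iso] by blast
  then show False using darboux_le[of "n + 1"] by simp
qed

lemma flag_in_some_orbit:
  assumes V: "V \<in> flags"
  shows "\<exists>i\<in>{1..n + 1}. V \<in> odd_orbit n s \<omega> e0 i"
proof -
  define i where "i = (LEAST i. e0 \<in> V i)"
  have i: "e0 \<in> V i" "i \<le> n + 1"
    unfolding i_def using e0_in_top[OF V] by (auto intro: LeastI Least_le)
  have "V 0 = {0}" using V by (simp add: isotropic_flags_def)
  then have "i \<noteq> 0" using i e0_nonzero by (metis singletonD)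
  then have "e0 \<notin> V (i - 1)" using not_less_Least[of "i - 1" "\<lambda>i. e0 \<in> V i"] by (simp add: i_def)
  then show ?thesis using i \<open>i \<noteq> 0\<close> V by (intro bexI[of _ i]) (auto simp: odd_orbit_def)
qed

lemma odd_orbit_disjoint:
  assumes "V \<in> odd_orbit n s \<omega> e0 i" "V \<in> odd_orbit n s \<omega> e0 j" "i \<in> {1..n + 1}" "j \<in> {1..n + 1}"
  shows "i = j"
proof -
  have "\<not> a < b" if "V \<in> odd_orbit n s \<omega> e0 a" "V \<in> odd_orbit n s \<omega> e0 b" "b \<in> {1..n + 1}" for a b
  proof
    assume "a < b"
    then have "V a \<subseteq> V (b - 1)" using that flag_mono[of V "n + 1" a "b - 1"] by (auto simp: odd_orbit_def)
    then show False using that by (auto simp: odd_orbit_def)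
  qed
  then show ?thesis using assms by (meson linorder_neqE_nat)
qed

text \<open>An isometry preserves the kernel of the form, so it multiplies \<open>e0\<close> by a nonzero scalar.\<close>

lemma stabilizer_e0:
  assumes g: "g \<in> carrier isometry_group" and V: "subspace V"
  shows "e0 \<in> g ` V \<longleftrightarrow> e0 \<in> V"
proof -
  have scale: "g (s c x) = s c (g x)" for c x
    using stabilizerD(1)[OF g] by (simp add: Vector_Spaces.linear_iff)
  have inj: "g x = g y \<longleftrightarrow> x = y" for x y using stabilizerD(2)[OF g] by (simp add: bij_is_inj inj_eq)
  have "\<omega> (g e0) y = 0" for y
  proof -
    obtain x where "y = g x" using stabilizerD(2)[OF g] by (metis bij_pointE)
    then show ?thesis using stabilizerD(3)[OF g, of e0 x] by simp
  qed
  then have "g e0 \<in> span {e0}" using kernel_iff by blast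
  then obtain c where c: "g e0 = s c e0" by (auto simp: span_singleton)
  have "g e0 \<noteq> 0" using inj[of e0 "s 0 e0"] scale[of 0 e0] e0_nonzero by simp
  then have c0: "c \<noteq> 0" using c by auto
  have e: "g (s (inverse c) e0) = e0" using scale[of "inverse c" e0] c c0 by simp
  show ?thesis
  proof
    assume "e0 \<in> g ` V"
    then obtain x where x: "x \<in> V" "e0 = g x" by blast
    then have "s (inverse c) e0 = x" using e inj[of "s (inverse c) e0" x] by simp
    then have "e0 = s c x" using c0 by auto
    then show "e0 \<in> V" using x subspace_scale[OF V] by metis
  next
    assume "e0 \<in> V"
    then have "s (inverse c) e0 \<in> V" by (rule subspace_scale[OF V])
    then show "e0 \<in> g ` V" using e by (metis image_eqI)
  qed
qed

lemma action_preserves_orbit: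
  assumes g: "g \<in> carrier isometry_group" and V: "V \<in> odd_orbit n s \<omega> e0 i" and i: "i \<in> {1..n + 1}"
  shows "action g V \<in> odd_orbit n s \<omega> e0 i"
proof -
  have VF: "V \<in> flags" using V by (simp add: odd_orbit_def)
  have "e0 \<in> action g V j \<longleftrightarrow> e0 \<in> V j" if "j \<le> n + 1" for j
    using flag_action_apply[OF VF that, of g] stabilizer_e0[OF g subspace_flag[OF VF that]] by simp
  then show ?thesis
    using V i flag_action_in_flags[OF g VF] by (auto simp: odd_orbit_def)
qed

text \<open>The map that sends one Darboux family to another and fixes \<open>e0\<close>.  It is an isometry because
  the form only sees the Darboux part, and the map built from the families in the opposite order
  inverts it.\<close>

lemma darboux_isometry:
  assumes D: "darboux n x y" and D': "darboux n x' y'"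
  shows "\<exists>g\<in>carrier isometry_group. g e0 = e0 \<and> (\<forall>a\<in>{1..n}. g (x a) = x' a)"
proof -
  interpret P: skew_space_pair s Basis \<omega> e0 n s Basis \<omega> e0
    by unfold_locales
  \<comment> \<open>Stated for arbitrary families, in order to be used for the map and for its inverse.\<close>
  have *: "\<exists>g. Vector_Spaces.linear s s g \<and> g e0 = e0 \<and> (\<forall>a\<in>{1..n}. g (x a) = x' a) \<and>
      (\<forall>z z'. \<omega> (g z) (g z') = \<omega> z z') \<and> g = (\<lambda>z. darboux_map s \<omega> n x y x' y' z + s (\<mu> z) e0)"
    if D: "darboux n x y" "darboux n x' y'" and \<mu>: "Vector_Spaces.linear s (*) \<mu>" "\<mu> e0 = 1"
      "\<forall>a\<in>{1..n}. \<mu> (x a) = 0 \<and> \<mu> (y a) = 0" for x y x' y' \<mu>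
  proof -
    let ?T = "darboux_map s \<omega> n x y x' y'"
    let ?g = "\<lambda>z. ?T z + s (\<mu> z) e0"
    have "Vector_Spaces.linear s s ?g"
      using P.darboux_map_linear[of n x y x' y'] \<mu>(1)
      by (simp add: Vector_Spaces.linear_iff algebra_simps)
    moreover have "?g e0 = e0" using \<mu>(2) by (simp add: darboux_map_def)
    moreover have "?g (x a) = x' a" if "a \<in> {1..n}" for a
      using P.darboux_map_basis[OF D(1) that, of x' y'] \<mu>(3) that by simp
    moreover have "\<omega> (?g z) (?g z') = \<omega> z z'" for z z'
      using P.darboux_map_isometry[OF D] by simp
    ultimately show ?thesis by blast
  qed
  obtain \<mu> where \<mu>: "Vector_Spaces.linear s (*) \<mu>" "\<mu> e0 = 1"
    "\<And>z. z = darboux_map s \<omega> n x y x y z + s (\<mu> z) e0" "\<forall>a\<in>{1..n}. \<mu> (x a) = 0 \<and> \<mu> (y a) = 0"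
    using kernel_coordinate[OF e0_nonzero D] by blast
  obtain \<mu>' where \<mu>': "Vector_Spaces.linear s (*) \<mu>'" "\<mu>' e0 = 1"
    "\<And>z. z = darboux_map s \<omega> n x' y' x' y' z + s (\<mu>' z) e0" "\<forall>a\<in>{1..n}. \<mu>' (x' a) = 0 \<and> \<mu>' (y' a) = 0"
    using kernel_coordinate[OF e0_nonzero D'] by blast
  obtain g where g: "Vector_Spaces.linear s s g" "g e0 = e0" "\<forall>a\<in>{1..n}. g (x a) = x' a"
      "\<forall>z z'. \<omega> (g z) (g z') = \<omega> z z'" "g = (\<lambda>z. darboux_map s \<omega> n x y x' y' z + s (\<mu> z) e0)"
    using *[OF D D' \<mu>(1,2,4)] by blast
  obtain h where h: "Vector_Spaces.linear s s h" "h e0 = e0"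
      "\<forall>z z'. \<omega> (h z) (h z') = \<omega> z z'" "h = (\<lambda>z. darboux_map s \<omega> n x' y' x y z + s (\<mu>' z) e0)"
    using *[OF D' D \<mu>'(1,2,4)] by blast
  \<comment> \<open>Likewise, for the two orders of composition.\<close>
  have inverse: "h' (g' z) = z"
    if D: "darboux n x y" and D': "darboux n x' y'"
      and g': "g' = (\<lambda>z. darboux_map s \<omega> n x y x' y' z + s (\<mu> z) e0)"
      and h': "h' = (\<lambda>z. darboux_map s \<omega> n x' y' x y z + s (\<mu>' z) e0)"
      and \<mu>: "\<And>z. z = darboux_map s \<omega> n x y x y z + s (\<mu> z) e0"
      and \<mu>': "Vector_Spaces.linear s (*) \<mu>'" "\<mu>' e0 = 1"
        "\<And>z. z = darboux_map s \<omega> n x' y' x' y' z + s (\<mu>' z) e0"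
    for x y x' y' \<mu> \<mu>' g' h' z
  proof -
    let ?T = "darboux_map s \<omega> n x y x' y'" and ?T' = "darboux_map s \<omega> n x' y' x y"
    have "darboux_map s \<omega> n x' y' x' y' (?T z) = ?T z"
      unfolding darboux_map_def[of s \<omega> n x' y' x' y'] darboux_map_def[of s \<omega> n x y x' y' z, symmetric]
        P.darboux_map_pairing[OF D']
      by (subst (2) darboux_map_def, rule sum.cong) (simp_all add: P.darboux_map_pairing[OF D'])
    then have "s (\<mu>' (?T z)) e0 = 0" using \<mu>'(3)[of "?T z"] by simp
    then have \<mu>'T: "\<mu>' (?T z) = 0" using e0_nonzero by simp
    have lin: "?T' (a + b) = ?T' a + ?T' b" "?T' (s c a) = s c (?T' a)" for a b c
      using P.darboux_map_linear[of n x' y' x y] by (simp_all add: Vector_Spaces.linear_iff)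
    have "?T' e0 = 0" by (simp add: darboux_map_def)
    then have "h' (g' z) = ?T' (?T z) + s (\<mu> z) e0"
      using \<mu>'(2) \<mu>'T unfolding g' h' by (simp add: lin linear_functional_simps[OF \<mu>'(1)])
    also have "?T' (?T z) = darboux_map s \<omega> n x y x y z" by (rule P.darboux_map_back[OF D'])
    also have "\<dots> + s (\<mu> z) e0 = z" using \<mu>[of z] by simp
    finally show ?thesis .
  qed
  have "h (g z) = z" for z by (rule inverse[OF D D' g(5) h(4) \<mu>(3) \<mu>'(1,2,3)])
  moreover have "g (h z) = z" for z by (rule inverse[OF D' D h(4) g(5) \<mu>'(3) \<mu>(1,2,3)])
  ultimately have "bij g" by (intro o_bij[of h]) (auto simp: fun_eq_iff)
  then have "g \<in> carrier isometry_group" using g(1,4) by (simp add: form_stabilizer_def)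
  then show ?thesis using g(2,3) by blast
qed

text \<open>The vector in position \<open>i\<close> may be chosen to be \<open>e0\<close>, because \<open>e0\<close> enters the flag there.  The
  other vectors are then isotropic and independent modulo the kernel, so they form one half of a
  Darboux family.\<close>

lemma adapted_frame:
  assumes V: "V \<in> odd_orbit n s \<omega> e0 i" and i: "i \<in> {1..n + 1}"
  shows "\<exists>v\<in>isotropic_frames s \<omega> (n + 1). flag_of_frame s (n + 1) v = V \<and> v i = e0 \<and>
    (\<exists>y. darboux n (\<lambda>j. v (skip i j)) y)"
proof -
  have VF: "V \<in> flags" and e0: "e0 \<in> V i" "e0 \<notin> V (i - 1)" using V by (auto simp: odd_orbit_def)
  obtain u where u: "u \<in> isotropic_frames s \<omega> (n + 1)" "V = flag_of_frame s (n + 1) u"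
    using VF flag_of_frame_image by blast
  have uV: "u j \<in> V j \<and> u j \<notin> V (j - 1)" if j: "j \<in> {1..n + 1}" for j
  proof -
    have "{1..<j} = {1..j - 1}" using j by auto
    moreover have "u j \<notin> span (u ` {1..<j})" using u(1) j by (auto simp: isotropic_frames_iff)
    moreover have "j \<in> {0..n + 1}" "j - 1 \<in> {0..n + 1}" using j by auto
    then have "V j = span (u ` {1..j})" "V (j - 1) = span (u ` {1..j - 1})"
      unfolding u(2) flag_of_frame_def by (simp_all only: restrict_apply' if_True)
    ultimately show ?thesis using j by (simp add: span_base)
  qed
  define v where "v = restrict (u(i := e0)) {1..n + 1}"
  have "(u(i := e0)) j \<in> V j" "(u(i := e0)) j \<notin> V (j - 1)" if "j \<in> {1..n + 1}" for j
    using uV[OF that] e0 by auto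
  from frame_of_flag[OF VF, of "u(i := e0)", OF this]
  have v: "v \<in> isotropic_frames s \<omega> (n + 1)" "flag_of_frame s (n + 1) v = V" unfolding v_def by auto
  have vi: "v i = e0" using i by (simp add: v_def)
  have v_ind: "\<And>j. j \<in> {1..n + 1} \<Longrightarrow> v j \<notin> span (v ` {1..<j})"
    and v_iso: "\<And>a b. a \<in> {1..n + 1} \<Longrightarrow> b \<in> {1..n + 1} \<Longrightarrow> \<omega> (v a) (v b) = 0"
    using v by (auto simp: isotropic_frames_iff)
  let ?x = "\<lambda>j. v (if j < i then j else Suc j)"
  have "\<exists>y. darboux n ?x y"
  proof (rule darboux_extend)
    show "\<omega> (?x a) (?x b) = 0" if "a \<in> {1..n}" "b \<in> {1..n}" for a b
      using that by (intro v_iso) auto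
    fix j assume j: "j \<in> {1..n}"
    show "?x j \<notin> span (insert e0 (?x ` {1..<j}))"
    proof (cases "j < i")
      case True
      have img: "?x ` {1..<j} = v ` {1..<j}" by (rule image_cong) (use True in auto)
      have j': "j \<in> {1..n + 1}" using j by auto
      show ?thesis
      proof
        assume "?x j \<in> span (insert e0 (?x ` {1..<j}))"
        then have "v j \<in> span (insert e0 (v ` {1..<j}))" using True img by simp
        then have "e0 \<in> span (insert (v j) (v ` {1..<j}))" by (rule in_span_insert[OF _ v_ind[OF j']])
        moreover have "span (insert (v j) (v ` {1..<j})) \<subseteq> span (v ` {1..i - 1})"
          using j True by (intro span_mono) auto
        moreover have "i - 1 \<in> {0..n + 1}" using i by auto
        then have "V (i - 1) = span (v ` {1..i - 1})"
          unfolding v(2)[symmetric] flag_of_frame_def by (simp only: restrict_apply' if_True)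
        ultimately show False using e0(2) by auto
      qed
    next
      case False
      have "insert e0 (?x ` {1..<j}) \<subseteq> v ` {1..<Suc j}"
      proof -
        have "e0 \<in> v ` {1..<Suc j}" using vi[symmetric] False i by (intro image_eqI[of _ v i]) auto
        moreover have "?x a \<in> v ` {1..<Suc j}" if "a \<in> {1..<j}" for a using that by (intro imageI) auto
        ultimately show ?thesis by blast
      qed
      then have "span (insert e0 (?x ` {1..<j})) \<subseteq> span (v ` {1..<Suc j})" by (rule span_mono)
      then show ?thesis using v_ind[of "Suc j"] j False by auto
    qed
  qed
  then show ?thesis unfolding skip_def by (intro bexI[OF _ v(1)] conjI v(2) vi)
qed

text \<open>An isometry that matches the Darboux families of two adapted frames matches the frames, and
  hence the flags.\<close>

lemma odd_orbit_transitive: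
  assumes V: "V \<in> odd_orbit n s \<omega> e0 i" and V': "V' \<in> odd_orbit n s \<omega> e0 i" and i: "i \<in> {1..n + 1}"
  shows "\<exists>g\<in>carrier isometry_group. action g V = V'"
proof -
  obtain v y where v: "v \<in> isotropic_frames s \<omega> (n + 1)" "flag_of_frame s (n + 1) v = V" "v i = e0"
    and D: "darboux n (\<lambda>j. v (skip i j)) y"
    using adapted_frame[OF V i] by blast
  obtain v' y' where v': "v' \<in> isotropic_frames s \<omega> (n + 1)" "flag_of_frame s (n + 1) v' = V'" "v' i = e0"
    and D': "darboux n (\<lambda>j. v' (skip i j)) y'"
    using adapted_frame[OF V' i] by blast
  obtain g where g: "g \<in> carrier isometry_group" "g e0 = e0"
    and gx: "\<forall>a\<in>{1..n}. g (v (skip i a)) = v' (skip i a)"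
    using darboux_isometry[OF D D'] by blast
  have gv: "g (v m) = v' m" if m: "m \<in> {1..n + 1}" for m
  proof -
    consider "m < i" "m \<in> {1..n}" | "m = i" | "i < m" "m - 1 \<in> {1..n}" using m i by force
    then show ?thesis
    proof cases
      case 1
      then show ?thesis using bspec[OF gx, of m] by (simp add: skip_def)
    next
      case 2
      then show ?thesis using g(2) v(3) v'(3) by simp
    next
      case 3
      then show ?thesis using bspec[OF gx, of "m - 1"] by (auto simp: skip_def split: if_splits)
    qed
  qed
  have VF: "V \<in> flags" "V' \<in> flags" using V V' by (auto simp: odd_orbit_def)
  have span: "g ` span S = span (g ` S)" for S
    using module_hom.span_image[of s s g S] stabilizerD(1)[OF g(1)] by (simp add: module_hom_iff_linear)
  have "action g V = V'"
  proof (rule extensionalityI[OF flag_action_extensional[OF VF(1)]])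
    show "V' \<in> extensional {0..n + 1}" using VF by (simp add: isotropic_flags_def)
    fix j assume j: "j \<in> {0..n + 1}"
    have "V j = span (v ` {1..j})" "V' j = span (v' ` {1..j})"
      using j unfolding v(2)[symmetric] v'(2)[symmetric] flag_of_frame_def by (simp_all only: restrict_apply' if_True)
    moreover have "g ` v ` {1..j} = v' ` {1..j}"
      unfolding image_image by (rule image_cong) (use j gv in auto)
    ultimately show "action g V j = V' j"
      using flag_action_apply[OF VF(1), of j g] j span by simp
  qed
  then show ?thesis using g by blast
qed

lemma orbit_eq_odd_orbit:
  assumes V: "V \<in> odd_orbit n s \<omega> e0 i" and i: "i \<in> {1..n + 1}"
  shows "orbit isometry_group action V = odd_orbit n s \<omega> e0 i"
  unfolding orbit_def
proof (intro equalityI subsetI)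
  fix V' assume "V' \<in> {action g V |g. g \<in> carrier isometry_group}"
  then show "V' \<in> odd_orbit n s \<omega> e0 i" using action_preserves_orbit[OF _ V i] by blast
next
  fix V' assume "V' \<in> odd_orbit n s \<omega> e0 i"
  then show "V' \<in> {action g V |g. g \<in> carrier isometry_group}" using odd_orbit_transitive[OF V _ i] by blast
qed

text \<open>Every flag acquires \<open>e0\<close> at exactly one step, so the sets in question partition the flags into
  orbits; as they are nonempty, distinct indices give distinct orbits.\<close>

lemma orbits_eq_odd_orbits:
  assumes nonempty: "\<And>i. i \<in> {1..n + 1} \<Longrightarrow> odd_orbit n s \<omega> e0 i \<noteq> {}"
  shows "orbits isometry_group flags action = odd_orbit n s \<omega> e0 ` {1..n + 1}"
    and "card (orbits isometry_group flags action) = n + 1"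
proof -
  show eq: "orbits isometry_group flags action = odd_orbit n s \<omega> e0 ` {1..n + 1}"
    unfolding orbits_def
  proof (intro equalityI subsetI)
    fix X assume "X \<in> {orbit isometry_group action V |V. V \<in> flags}"
    then obtain V where V: "V \<in> flags" "X = orbit isometry_group action V" by blast
    obtain i where "i \<in> {1..n + 1}" "V \<in> odd_orbit n s \<omega> e0 i" using flag_in_some_orbit[OF V(1)] by blast
    then show "X \<in> odd_orbit n s \<omega> e0 ` {1..n + 1}" using orbit_eq_odd_orbit V(2) by blast
  next
    fix X assume "X \<in> odd_orbit n s \<omega> e0 ` {1..n + 1}"
    then obtain i where i: "i \<in> {1..n + 1}" "X = odd_orbit n s \<omega> e0 i" by blast
    obtain V where V: "V \<in> odd_orbit n s \<omega> e0 i" using nonempty[OF i(1)] by blast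
    moreover have "V \<in> flags" using V by (simp add: odd_orbit_def)
    ultimately show "X \<in> {orbit isometry_group action V |V. V \<in> flags}" using orbit_eq_odd_orbit[OF V i(1)] i(2) by blast
  qed
  have "inj_on (odd_orbit n s \<omega> e0) {1..n + 1}"
  proof (rule inj_onI)
    fix i j assume ij: "i \<in> {1..n + 1}" "j \<in> {1..n + 1}" "odd_orbit n s \<omega> e0 i = odd_orbit n s \<omega> e0 j"
    obtain V where "V \<in> odd_orbit n s \<omega> e0 i" using nonempty[OF ij(1)] by blast
    then show "i = j" using odd_orbit_disjoint[of V i j] ij by blast
  qed
  then show "card (orbits isometry_group flags action) = n + 1" unfolding eq by (simp add: card_image)
qed

end

theorem proposition4p5:
  fixes sE :: "complex \<Rightarrow> 'a::ab_group_add \<Rightarrow> 'a" and \<omega> :: "'a \<Rightarrow> 'a \<Rightarrow> complex" and e0 :: 'a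
    and sF :: "complex \<Rightarrow> 'b::ab_group_add \<Rightarrow> 'b" and \<sigma> :: "'b \<Rightarrow> 'b \<Rightarrow> complex"
    and n :: nat
  assumes "odd_symplectic_space n sE \<omega> e0"
    and "symplectic_space n sF \<sigma>"
  shows "group_action (form_stabilizer sE \<omega>) (isotropic_flags sE \<omega> (n + 1))
           (flag_action sE \<omega> (n + 1)) \<and>
         orbits (form_stabilizer sE \<omega>) (isotropic_flags sE \<omega> (n + 1)) (flag_action sE \<omega> (n + 1))
           = odd_orbit n sE \<omega> e0 ` {1..n + 1} \<and>
         card (orbits (form_stabilizer sE \<omega>) (isotropic_flags sE \<omega> (n + 1))
           (flag_action sE \<omega> (n + 1))) = n + 1 \<and>
         (\<forall>i\<in>{1..n + 1}.
            isomorphic_varieties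
              (subvariety (isotropic_flag_variety sE \<omega> (n + 1)) (odd_orbit n sE \<omega> e0 i))
              (dual_tautological_total_space sF \<sigma> n (i - 1)))"
proof -
  obtain BE where BE: "finite_dimensional_vector_space sE BE"
    using assms(1) by (auto simp: odd_symplectic_space_def complex_space_def)
  obtain BF where BF: "finite_dimensional_vector_space sF BF"
    using assms(2) by (auto simp: symplectic_space_def complex_space_def)
  interpret E0: finite_dimensional_vector_space sE BE by (rule BE)
  interpret F0: finite_dimensional_vector_space sF BF by (rule BF)
  have E: "E0.dim UNIV = 2 * n + 1" "skew_form sE \<omega>" "form_kernel \<omega> = E0.span {e0}"
      "form_rank sE \<omega> = 2 * n"
    using assms(1) by (auto simp: odd_symplectic_space_def complex_space_def)
  have F: "F0.dim UNIV = 2 * n" "skew_form sF \<sigma>" "form_kernel \<sigma> = F0.span {0}"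
    using assms(2) by (auto simp: symplectic_space_def complex_space_def)
  have e0: "e0 \<noteq> 0"
  proof
    assume "e0 = 0"
    then have "E0.dim (form_kernel \<omega>) = 0" using E(3) by simp
    then show False using E(1,4) unfolding form_rank_def by linarith
  qed
  interpret pair: skew_space_pair sE BE \<omega> e0 n sF BF \<sigma> 0
    by unfold_locales (use E F e0 in auto)
  interpret odd: odd_symplectic sE BE \<omega> e0 n
    by unfold_locales (rule e0)
  obtain p \<iota> \<kappa> where "odd_symplectic_projection sE BE \<omega> e0 n sF BF \<sigma> p \<iota> \<kappa>"
    using pair.odd_symplectic_projection_exists[OF e0 refl] by blast
  then interpret odd_symplectic_projection sE BE \<omega> e0 n sF BF \<sigma> p \<iota> \<kappa> .
  show ?thesis
    using pair.E.group_action_flags odd.orbits_eq_odd_orbits[OF orbit_nonempty]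
      orbit_isomorphic_dual_tautological by blast
qed

end
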